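(* Let $\tau:\mathcal{D}\to\mathcal{D}$ be a bijection such that there is an $A\ge 1$ with $$\frac1A\,[\![\mathcal{E}]\!]\le[\![\tau(\mathcal{E})]\!]\le A\,[\![\mathcal{E}]\!]$$ for all non-empty $\mathcal{E}\subseteq\mathcal{D}$. Let $X$ be a complex UMD-space and let $1<q<p<\infty$. Then the boundedness of $$\mathrm{Id}_X\otimes T_{p,\tau}: L^p_{X,0}\to L^p_X$$ implies the boundedness of $$\mathrm{Id}_X\otimes T_{q,\tau}: L^q_{X,0}\to L^q_X.$$ If moreover $|\tau(I)|=|I|$ for all $I\in\mathcal{D}$, then the UMD-property is not needed, i.e. the same implication holds for every complex Banach space $X$.
   Context: $\mathcal{D}$ is the set of all dyadic intervals contained in $[0,1)$ (intervals $[j2^{-k},(j+1)2^{-k})$, $k\ge 0$, $0\le j<2^k$), and $\mathcal{D}_k$ the set of those of length $2^{-k}$; $|I|$ denotes Lebesgue measure. $h_I$ is the $L_\infty$-normalized Haar function supported on $I$ ($+1$ on the left half of $I$, $-1$ on the right half, $0$ elsewhere). All Banach spaces have dimension at least one. $L^p_X=L^p_X([0,1))$ is the Bochner space with Lebesgue measure and $L^p_{X,0}$ its subspace of mean zero functions. For a non-empty collection $\mathcal{E}\subseteq\mathcal{D}$ the Carleson constant is $$[\![\mathcal{E}]\!]:=\sup_{I\in\mathcal{E}}\frac1{|I|}\sum_{J\subseteq I,\,J\in\mathcal{E}}|J|\in[1,\infty].$$ For an injective map $\tau:\mathcal{D}\to\mathcal{D}$, a Banach space $X$ and $p\in[1,\infty)$,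 the rearrangement operator $\mathrm{Id}_X\otimes T_{p,\tau}$ maps $\sum_I a_I h_I/|I|^{1/p}$ to $\sum_I a_I h_{\tau(I)}/|\tau(I)|^{1/p}$ for finitely supported $(a_I)_{I\in\mathcal{D}}\subseteq X$. It is called bounded if $$\sup\Big\{\Big\|\sum_{I} a_I\frac{h_{\tau(I)}}{|\tau(I)|^{1/p}}\Big\|_{L^p_X}:\Big\|\sum_I a_I\frac{h_I}{|I|^{1/p}}\Big\|_{L^p_X}\le 1\Big\}<\infty,$$ the supremum being over finitely supported families $(a_I)\subseteq X$. $X$ is a UMD-space if for some (equivalently, all) $p\in(1,\infty)$ there is a constant $c_p>0$ with $\sup_{\theta_k\in[-1,1]}\|\sum_{k=1}^n\theta_k d_k\|_{L^p_X}\le c_p\|\sum_{k=1}^n d_k\|_{L^p_X}$ for all $n\ge1$ and all $X$-valued martingale difference sequences $(d_k)_{k=1}^n$ with respect to the dyadic filtration $\mathcal{F}_k=\sigma(\mathcal{D}_k)$, $k=0,\dots,n$ (i.e. $d_k$ is $\mathcal{F}_k$-measurable and $\mathbb{E}(d_k|\mathcal{F}_{k-1})=0$). *)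

theory Defs
  imports "HOL-Analysis.Analysis"
begin

text \<open>The library has real Banach spaces only. A complex Banach space is a real Banach space with a
  compatible complex scalar multiplication for which the norm is complex-homogeneous.\<close>

class complex_banach = banach +
  fixes scaleC :: "complex \<Rightarrow> 'a \<Rightarrow> 'a"  (infixr \<open>*\<^sub>C\<close> 75)
  assumes scaleC_add_right: "c *\<^sub>C (x + y) = c *\<^sub>C x + c *\<^sub>C y"
    and scaleC_add_left: "(c + d) *\<^sub>C x = c *\<^sub>C x + d *\<^sub>C x"
    and scaleC_scaleC: "c *\<^sub>C (d *\<^sub>C x) = (c * d) *\<^sub>C x"
    and scaleC_of_real: "complex_of_real r *\<^sub>C x = r *\<^sub>R x"
    and norm_scaleC: "norm (c *\<^sub>C x) = cmod c * norm x"

instantiation complex :: complex_banach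
begin

definition scaleC_complex :: "complex \<Rightarrow> complex \<Rightarrow> complex" where
  "scaleC_complex c x = c * x"

instance
  by standard (simp_all add: scaleC_complex_def algebra_simps norm_mult scaleR_conv_of_real)

end


definition dyadic_level :: "nat \<Rightarrow> real set set" where
  "dyadic_level k = {{real j / 2 ^ k ..< (real j + 1) / 2 ^ k} | j. j < 2 ^ k}"

definition dyadic :: "real set set" where
  "dyadic = (\<Union>k. dyadic_level k)"

definition haar :: "real set \<Rightarrow> real \<Rightarrow> real" where
  "haar I t = indicator {Inf I ..< (Inf I + Sup I) / 2} t
            - indicator {(Inf I + Sup I) / 2 ..< Sup I} t"

lemma haar_atLeastLessThan:
  assumes "a < b"
  shows "haar {a..<b} t =
    (if a \<le> t \<and> t < (a + b) / 2 then 1 else if (a + b) / 2 \<le> t \<and> t < b then - 1 else 0)"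
  using assms by (auto simp: haar_def indicator_def)

definition carleson :: "real set set \<Rightarrow> ennreal" where
  "carleson \<E> =
    (SUP I\<in>\<E>. (\<Sum>\<^sub>\<infinity>J\<in>{J \<in> \<E>. J \<subseteq> I}. emeasure lborel J) / emeasure lborel I)"

abbreviation unit_lborel :: "real measure" where
  "unit_lborel \<equiv> restrict_space lborel {0..<1}"

text \<open>Below this norm is only applied to functions that, on the unit interval, take finitely many
  values, each on a Borel set; hence the integrand is always integrable.\<close>

definition Lp_norm :: "real \<Rightarrow> (real \<Rightarrow> 'a::real_normed_vector) \<Rightarrow> real" where
  "Lp_norm p f = (\<integral>t. norm (f t) powr p \<partial>unit_lborel) powr (1 / p)"

definition finite_family :: "(real set \<Rightarrow> 'a::zero) \<Rightarrow> bool" where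
  "finite_family a \<longleftrightarrow> finite {I \<in> dyadic. a I \<noteq> 0}"

definition haar_sum ::
    "real \<Rightarrow> (real set \<Rightarrow> real set) \<Rightarrow> (real set \<Rightarrow> 'a::real_vector) \<Rightarrow> real \<Rightarrow> 'a" where
  "haar_sum p \<sigma> a t =
    (\<Sum>I\<in>{I \<in> dyadic. a I \<noteq> 0}. (haar (\<sigma> I) t / measure lborel (\<sigma> I) powr (1 / p)) *\<^sub>R a I)"

text \<open>Boundedness of the rearrangement operator, which sends \<^term>\<open>haar_sum p id a\<close> to
  \<^term>\<open>haar_sum p \<tau> a\<close>, on finite Haar sums with coefficients in the space \<^typ>\<open>'a\<close>.\<close>

definition rearrangement_bounded ::
    "'a::banach itself \<Rightarrow> real \<Rightarrow> (real set \<Rightarrow> real set) \<Rightarrow> bool" where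
  "rearrangement_bounded _ p \<tau> \<longleftrightarrow>
    bdd_above {Lp_norm p (haar_sum p \<tau> a) | a :: real set \<Rightarrow> 'a.
      finite_family a \<and> Lp_norm p (haar_sum p id a) \<le> 1}"

definition dyadic_sigma :: "nat \<Rightarrow> real measure" where
  "dyadic_sigma k = sigma {0..<1} (dyadic_level k)"

text \<open>An \<open>\<F>\<^sub>k\<close>-measurable function takes finitely many values, so its Bochner integral is
  \<^const>\<open>Bochner_Integration.simple_bochner_integral\<close>; unlike \<^const>\<open>has_bochner_integral\<close>, this does not require
  the space to be separable. The condition \<open>\<bbbE>(d\<^sub>k | \<F>\<^sub>k\<^sub>-\<^sub>1) = 0\<close> is expressed by vanishing
  integrals over all \<open>\<F>\<^sub>k\<^sub>-\<^sub>1\<close>-measurable sets.\<close>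

definition dyadic_mds :: "nat \<Rightarrow> (nat \<Rightarrow> real \<Rightarrow> 'a::banach) \<Rightarrow> bool" where
  "dyadic_mds n d \<longleftrightarrow> (\<forall>k\<in>{1..n}.
     d k \<in> borel_measurable (dyadic_sigma k) \<and>
     (\<forall>A\<in>sets (dyadic_sigma (k - 1)).
        Bochner_Integration.simple_bochner_integral unit_lborel (\<lambda>t. indicator A t *\<^sub>R d k t) = 0))"

definition UMD_space :: "'a::banach itself \<Rightarrow> bool" where
  "UMD_space _ \<longleftrightarrow> (\<exists>p>1. \<exists>c>0. \<forall>n\<ge>1. \<forall>d :: nat \<Rightarrow> real \<Rightarrow> 'a. dyadic_mds n d \<longrightarrow>
     (\<forall>\<theta> :: nat \<Rightarrow> real. (\<forall>k\<in>{1..n}. \<theta> k \<in> {-1..1}) \<longrightarrow>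
        Lp_norm p (\<lambda>t. \<Sum>k=1..n. \<theta> k *\<^sub>R d k t) \<le> c * Lp_norm p (\<lambda>t. \<Sum>k=1..n. d k t)))"

end

theory Submission
  imports Defs
begin

text \<open>Write \<open>T\<^sub>p\<close> for the rearrangement operator with exponent \<open>p\<close>, and
\<open>w\<^sub>I = |I| / |\<tau> I|\<close>. After cancelling normalizations, \<open>T\<^sub>q\<close> maps
\<open>\<Sum> x\<^sub>I h\<^sub>I\<close> to \<open>\<Sum> w\<^sub>I powr (1/q) x\<^sub>I h\<^bsub>\<tau>
I\<^esub>\<close>, so \<open>T\<^sub>q\<close> applied to \<open>(x\<^sub>I)\<close> is \<open>T\<^sub>p\<close>
applied to \<open>(w\<^sub>I powr (1/q - 1/p) x\<^sub>I)\<close>. The proof is a real interpolation argument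
that goes down from the strong type \<open>p\<close> by means of a control of supports; the Carleson condition
provides that control.

Isometric case. Let \<open>f*\<close> be the martingale maximal function of \<open>f = \<Sum> x\<^sub>I
h\<^sub>I\<close>, give an interval \<open>I\<close> the height \<open>s\<^sub>I = min f*\<close> over
\<open>I\<close>, and let \<open>f\<^sub>k\<close> be the part of \<open>f\<close> that lives on the intervals
with \<open>2^k \<le> s\<^sub>I < 2^(k+1)\<close>. Along every branch of the dyadic tree these intervals are
consecutive, so \<open>|f\<^sub>k|\<close> is at most a multiple of \<open>2^k\<close>, and its support lies in
\<open>U\<^sub>k = {f* \<ge> 2^k}\<close>. Hence \<open>T f\<^sub>k\<close> has \<open>p\<close>-th moment at
most \<open>C 2^(kp) |U\<^sub>k|\<close>, and it is supported by the union of the \<open>\<tau> I\<close>, whose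
measure is at most \<open>A |U\<^sub>k|\<close>: a disjoint subfamily of the \<open>\<tau> I\<close> has
Carleson constant 1, so its preimage has Carleson constant at most \<open>A\<close>. An elementary inequality
for \<open>q < p\<close> (\<open>powr_sum_le_sum_endpoints\<close>) turns these two facts into
\<open>\<integral>|T f|^q \<le> C \<Sum>\<^sub>k 2^(kq) |U\<^sub>k| \<le> C \<integral> (f* )^q\<close>, and
Doob's inequality ends the argument.

General case. The ratios \<open>w\<^sub>I\<close> are stratified as well, \<open>4^m \<le> w\<^sub>I <
4^(m+1)\<close>. A stratum \<open>(k, m)\<close> has output height \<open>2^k 4^(m/q)\<close> and output support
of measure at most \<open>A 4^(-m) |U\<^bsub>k,m\<^esub>|\<close>; strata with the same output height are
treated together, and everything reduces to \<open>\<Sum>\<^sub>m |U\<^bsub>k,m\<^esub>| \<le> C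
|U\<^sub>k|\<close>. This is \<open>sum_ratio_classes_le\<close>, the geometric heart of the proof: a family in
which many ratios pile up over the same place would contain a subfamily that is sparse on one side of the
rearrangement and has a large Carleson constant on the other. Since a stratum now selects intervals that are not
consecutive along a branch, the maximal function is replaced by the Rademacher square function \<open>S f(t) =
(\<bbbE>|\<Sum>\<^sub>k \<epsilon>\<^sub>k d\<^sub>k(t)|^r)^(1/r)\<close> of the martingale differences
\<open>d\<^sub>k\<close>, which does not grow when intervals are removed. The UMD property for one exponent
\<open>r\<close> says that \<open>S f\<close> and \<open>f\<close> have comparable norms in \<open>L^r\<close>;
a good-\<open>\<lambda>\<close> argument (\<open>path_norm_extrapolation\<close>) carries this to all exponents,
as is needed for both \<open>p\<close> and \<open>q\<close>.

A finite Haar sum is constant on the intervals of length \<open>2^(-N)\<close> for large \<open>N\<close>, so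
all norms are finite sums over the grid of left end points of these intervals, and every constant is independent
of \<open>N\<close>.\<close>

section \<open>Geometric sums over dyadic scales and Minkowski's inequality\<close>

lemma sum_powr_int_le:
  fixes K :: "int set" and b M :: real
  assumes K: "finite K" and M: "\<And>n. n \<in> K \<Longrightarrow> real_of_int n \<le> M" and b: "0 < b"
  shows "(\<Sum>n\<in>K. 2 powr (b * n)) \<le> 2 powr (b * M) / (1 - 2 powr (- b))"
proof -
  define r where "r = (2::real) powr (- b)"
  have r: "0 < r" "r < 1"
    using b by (auto simp: r_def powr_less_one)
  define i where "i n = nat (\<lfloor>M\<rfloor> - n)" for n
  have nM: "n \<le> \<lfloor>M\<rfloor>" if "n \<in> K" for n
    using M[OF that] by (simp add: le_floor_iff)
  have inj: "inj_on i K"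
    by (auto simp: inj_on_def i_def dest!: nM)
  have term_eq: "2 powr (b * n) = 2 powr (b * \<lfloor>M\<rfloor>) * r ^ i n" if "n \<in> K" for n
  proof -
    have "r ^ i n = r powr (real (i n))"
      using r by (simp add: powr_realpow)
    also have "real (i n) = \<lfloor>M\<rfloor> - n"
      using nM[OF that] by (simp add: i_def)
    finally show ?thesis
      by (simp add: r_def powr_powr flip: powr_add) (simp add: algebra_simps)
  qed
  have "(\<Sum>n\<in>K. 2 powr (b * n)) = 2 powr (b * \<lfloor>M\<rfloor>) * (\<Sum>n\<in>K. r ^ i n)"
    by (simp add: term_eq sum_distrib_left)
  also have "(\<Sum>n\<in>K. r ^ i n) = (\<Sum>j\<in>i ` K. r ^ j)"
    using inj by (simp add: sum.reindex)
  also have "\<dots> \<le> (\<Sum>j. r ^ j)"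
    using r K by (intro sum_le_suminf summable_geometric) auto
  also have "\<dots> = 1 / (1 - r)"
    using r by (intro suminf_geometric) auto
  finally have "(\<Sum>n\<in>K. 2 powr (b * n)) \<le> 2 powr (b * \<lfloor>M\<rfloor>) / (1 - r)"
    by simp
  also have "\<dots> \<le> 2 powr (b * M) / (1 - r)"
    using b r by (intro divide_right_mono) (auto intro!: powr_mono)
  finally show ?thesis
    by (simp add: r_def)
qed

lemma sum_powr_uminus_int_le:
  fixes K :: "int set" and b M :: real
  assumes K: "finite K" and M: "\<And>n. n \<in> K \<Longrightarrow> M \<le> real_of_int n" and b: "0 < b"
  shows "(\<Sum>n\<in>K. 2 powr (- (b * n))) \<le> 2 powr (- (b * M)) / (1 - 2 powr (- b))"
proof -
  have "(\<Sum>n\<in>K. 2 powr (- (b * n))) = (\<Sum>n\<in>uminus ` K. 2 powr (b * n))"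
    by (subst sum.reindex) (auto simp: inj_on_def)
  also have "\<dots> \<le> 2 powr (b * (- M)) / (1 - 2 powr (- b))"
    using assms by (intro sum_powr_int_le) (auto dest: M)
  finally show ?thesis
    by simp
qed

text \<open>A geometric sum is comparable to its largest term, so powers may be moved inside.\<close>

lemma powr_sum_geometric_le:
  fixes K :: "int set" and b p :: real
  assumes K: "finite K" and b: "0 < b" and p: "0 < p"
  shows "(\<Sum>n\<in>K. 2 powr (- (b * n))) powr p
    \<le> (1 / (1 - 2 powr (- b))) powr p * (\<Sum>n\<in>K. 2 powr (- (b * p * n)))"
proof (cases "K = {}")
  case False
  define m where "m = Min K"
  have m: "m \<in> K" "\<And>n. n \<in> K \<Longrightarrow> m \<le> n"
    using K False by (auto simp: m_def)
  have r: "(2::real) powr (- b) < 1"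
    using b by (auto simp: powr_less_one)
  have "(\<Sum>n\<in>K. 2 powr (- (b * n))) \<le> 1 / (1 - 2 powr (- b)) * 2 powr (- (b * m))"
    using sum_powr_uminus_int_le[OF K _ b, of m] m(2) by simp
  then have "(\<Sum>n\<in>K. 2 powr (- (b * n))) powr p \<le> (1 / (1 - 2 powr (- b)) * 2 powr (- (b * m))) powr p"
    using p by (intro powr_mono2) (auto intro!: sum_nonneg)
  also have "\<dots> = (1 / (1 - 2 powr (- b))) powr p * 2 powr (- (b * p * m))"
    using r by (subst powr_mult) (auto simp: powr_powr algebra_simps)
  also have "2 powr (- (b * p * m)) \<le> (\<Sum>n\<in>K. 2 powr (- (b * p * n)))"
    using K m(1) by (intro member_le_sum) auto
  finally show ?thesis
    by (simp add: mult_left_mono)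
qed (use p in auto)

definition endpoint_const :: "real \<Rightarrow> real \<Rightarrow> real" where
  "endpoint_const q p = (1 / (1 - 2 powr - (1 - q / p))) powr q"

text \<open>Weak-type interpolation in pointwise form. If the function \<open>u\<^sub>n\<close> has support
\<open>W\<^sub>n\<close> with \<open>|W\<^sub>n| \<le> 2^(-nq) D\<^sub>n\<close> and \<open>p\<close>-th moment
at most \<open>2^(n(p-q)) D\<^sub>n\<close>, then summing the estimate below at each point, over those
\<open>n\<close> with the point in \<open>W\<^sub>n\<close>, and integrating bounds the \<open>q\<close>-th
moment of \<open>\<Sum> u\<^sub>n\<close> by a multiple of \<open>\<Sum> D\<^sub>n\<close>. The reason is that
some \<open>u\<^sub>n\<close> carries a fixed part of the sum, up to a factor that decays geometrically as
\<open>n\<close> moves below the largest index \<open>m\<close>; the exponent \<open>e = 1 - q/p\<close> of the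
decay is the one for which the resulting bound is the geometric mean of \<open>2^(qm)\<close> and
\<open>2^((q-p)n) u\<^sub>n^p\<close> with weights \<open>e\<close> and \<open>1 - e\<close>.\<close>

lemma powr_sum_le_sum_endpoints:
  fixes q p :: real and K :: "int set"
  assumes q: "0 < q" and qp: "q < p" and K: "finite K" and u: "\<And>n. n \<in> K \<Longrightarrow> 0 \<le> u n"
  shows "(\<Sum>n\<in>K. u n) powr q \<le> endpoint_const q p * (\<Sum>n\<in>K. 2 powr (q * n) + 2 powr ((q - p) * n) * u n powr p)"
proof -
  define e where "e = 1 - q / p"
  have p: "0 < p"
    using q qp by simp
  have e: "0 < e" "e < 1"
    using q qp by (auto simp: e_def field_simps)
  define c where "c = 1 - (2::real) powr (- e)"
  have c: "0 < c"
    using e by (auto simp: c_def powr_less_one)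
  have C: "endpoint_const q p = (1 / c) powr q"
    by (simp add: endpoint_const_def c_def e_def)
  define R where "R = (\<Sum>n\<in>K. u n)"
  let ?f = "\<lambda>n::int. 2 powr (q * n) + 2 powr ((q - p) * n) * u n powr p"
  have f0: "0 \<le> ?f n" for n
    by simp
  have "(\<Sum>n\<in>K. u n) powr q \<le> (1 / c) powr q * (\<Sum>n\<in>K. ?f n)"
  proof (cases "R = 0")
    case True
    then show ?thesis
      using f0 by (auto simp: R_def intro!: mult_nonneg_nonneg sum_nonneg)
  next
    case False
    then have R: "0 < R"
      using u by (simp add: R_def order_less_le sum_nonneg)
    have ne: "K \<noteq> {}"
      using False by (auto simp: R_def)
    define m where "m = Max K"
    have m: "m \<in> K" "\<And>n. n \<in> K \<Longrightarrow> n \<le> m"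
      using K ne by (auto simp: m_def)
    \<comment> \<open>Otherwise the terms would be dominated by a geometric series with sum at most \<open>R\<close>.\<close>
    have "\<exists>n\<in>K. c * 2 powr (e * (n - m)) * R \<le> u n"
    proof (rule ccontr)
      assume "\<not> ?thesis"
      then have *: "u n < c * 2 powr (e * (n - m)) * R" if "n \<in> K" for n
        using that by force
      have "R < (\<Sum>n\<in>K. c * 2 powr (e * (n - m)) * R)"
        unfolding R_def using * K ne by (intro sum_strict_mono) (auto simp: R_def)
      also have "\<dots> = R * c * 2 powr (- e * m) * (\<Sum>n\<in>K. 2 powr (e * n))"
        by (simp add: sum_distrib_left algebra_simps flip: powr_add)
      also have "\<dots> \<le> R * c * 2 powr (- e * m) * (2 powr (e * m) / c)"
        using sum_powr_int_le[OF K _ e(1), of m] m R c by (intro mult_left_mono) (auto simp: c_def)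
      also have "\<dots> = R"
        using c by (simp add: flip: powr_add)
      finally show False
        by simp
    qed
    then obtain n where n: "n \<in> K" "c * 2 powr (e * (n - m)) * R \<le> u n"
      by blast
    have "R \<le> u n * 2 powr (e * (m - n)) / c"
    proof -
      have "R = (c * 2 powr (e * (n - m)) * R) * 2 powr (e * (m - n)) / c"
        using c by (simp add: field_simps flip: powr_add)
      also have "\<dots> \<le> u n * 2 powr (e * (m - n)) / c"
        using n c by (intro divide_right_mono mult_right_mono) auto
      finally show ?thesis .
    qed
    then have "R powr q \<le> (1 / c * (u n * 2 powr (e * (m - n)))) powr q"
      using R q by (intro powr_mono2) auto
    also have "\<dots> = (1 / c) powr q * (u n * 2 powr (e * (m - n))) powr q"
      using c u n by (subst powr_mult) auto
    also have "(u n * 2 powr (e * (m - n))) powr q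
        = (2 powr (q * m)) powr e * (2 powr ((q - p) * n) * u n powr p) powr (1 - e)"
    proof -
      have 1: "p * (1 - e) = q"
        using p by (simp add: e_def)
      have 2: "(q - p) * (1 - e) = - (q * e)"
        using p by (simp add: e_def field_simps)
      have "(2 powr ((q - p) * n) * u n powr p) powr (1 - e)
          = 2 powr (((q - p) * (1 - e)) * n) * u n powr (p * (1 - e))"
        using u n by (subst powr_mult) (auto simp: powr_powr algebra_simps)
      also have "\<dots> = 2 powr (- (q * e) * n) * u n powr q"
        by (simp only: 1 2)
      finally have 3: "(2 powr ((q - p) * n) * u n powr p) powr (1 - e)
          = 2 powr (- (q * e) * n) * u n powr q" .
      have "(u n * 2 powr (e * (m - n))) powr q = u n powr q * 2 powr (e * (m - n) * q)"
        using u n by (subst powr_mult) (auto simp: powr_powr)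
      also have "2 powr (e * (m - n) * q) = 2 powr (q * m * e) * 2 powr (- (q * e) * n)"
        by (simp add: algebra_simps flip: powr_add)
      finally show ?thesis
        unfolding 3 by (simp add: powr_powr)
    qed
    also have "\<dots> \<le> (\<Sum>n\<in>K. ?f n) powr e * (\<Sum>n\<in>K. ?f n) powr (1 - e)"
    proof (intro mult_mono powr_mono2)
      have "2 powr (q * m) \<le> ?f m"
        by simp
      also have "\<dots> \<le> (\<Sum>n\<in>K. ?f n)"
        using K m(1) f0 by (intro member_le_sum) auto
      finally show "2 powr (q * m) \<le> (\<Sum>n\<in>K. ?f n)" .
      have "2 powr ((q - p) * n) * u n powr p \<le> ?f n"
        by simp
      also have "\<dots> \<le> (\<Sum>n\<in>K. ?f n)"
        using K n(1) f0 by (intro member_le_sum) auto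
      finally show "2 powr ((q - p) * n) * u n powr p \<le> (\<Sum>n\<in>K. ?f n)" .
    qed (use e in auto)
    also have "\<dots> = (\<Sum>n\<in>K. ?f n)"
      using f0 by (simp add: sum_nonneg flip: powr_add)
    finally show ?thesis
      using c by (simp add: R_def mult_left_mono)
  qed
  then show ?thesis
    unfolding C .
qed

lemma convex_powr_nonneg:
  fixes x y a b s :: real
  assumes "1 \<le> s" "0 \<le> x" "0 \<le> y" "0 \<le> a" "0 \<le> b" "a + b = 1"
  shows "(a * x + b * y) powr s \<le> a * x powr s + b * y powr s"
proof (cases "x = 0 \<or> y = 0")
  case False
  then have "x \<in> {0<..}" "y \<in> {0<..}"
    using assms by auto
  then show ?thesis
    using convex_onD[OF powr_convex[OF assms(1)], of b x y] assms
    by (simp add: eq_diff_eq[symmetric, of a b])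
next
  case True
  have "(a * x) powr s \<le> a * x powr s" "(b * y) powr s \<le> b * y powr s"
    using assms powr_mono'[of 1 s a] powr_mono'[of 1 s b]
    by (auto simp: powr_mult intro!: mult_right_mono)
  then show ?thesis
    using True assms by auto
qed

lemma minkowski_sum_powr:
  fixes f g :: "'i \<Rightarrow> real"
  assumes s: "1 \<le> s" and f: "\<And>i. i \<in> A \<Longrightarrow> 0 \<le> f i" and g: "\<And>i. i \<in> A \<Longrightarrow> 0 \<le> g i"
  shows "(\<Sum>i\<in>A. (f i + g i) powr s) powr (1 / s)
    \<le> (\<Sum>i\<in>A. f i powr s) powr (1 / s) + (\<Sum>i\<in>A. g i powr s) powr (1 / s)"
proof (cases "finite A")
  case A: True
  define a where "a = (\<Sum>i\<in>A. f i powr s) powr (1 / s)"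
  define b where "b = (\<Sum>i\<in>A. g i powr s) powr (1 / s)"
  have as: "a powr s = (\<Sum>i\<in>A. f i powr s)" and bs: "b powr s = (\<Sum>i\<in>A. g i powr s)"
    using s by (auto simp: a_def b_def powr_powr sum_nonneg)
  have ab: "0 \<le> a" "0 \<le> b"
    by (auto simp: a_def b_def)
  show ?thesis
  proof (cases "a = 0 \<or> b = 0")
    case True
    then have "(\<forall>i\<in>A. f i = 0) \<or> (\<forall>i\<in>A. g i = 0)"
      using A by (auto simp: a_def b_def sum_nonneg_eq_0_iff)
    then show ?thesis
      by (elim disjE) (auto simp: cong: sum.cong)
  next
    case False
    with ab have ab: "0 < a" "0 < b"
      by auto
    have "(\<Sum>i\<in>A. (f i + g i) powr s)
        \<le> (\<Sum>i\<in>A. (a + b) powr s * (a / (a + b) * (f i / a) powr s + b / (a + b) * (g i / b) powr s))"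
    proof (rule sum_mono)
      fix i assume i: "i \<in> A"
      have "f i + g i = (a + b) * (a / (a + b) * (f i / a) + b / (a + b) * (g i / b))"
        using ab by (simp add: add_divide_distrib[symmetric])
      also have "\<dots> powr s = (a + b) powr s * (a / (a + b) * (f i / a) + b / (a + b) * (g i / b)) powr s"
        by (rule powr_mult)
      also have "\<dots> \<le> (a + b) powr s * (a / (a + b) * (f i / a) powr s + b / (a + b) * (g i / b) powr s)"
        using ab f[OF i] g[OF i] s
        by (intro mult_left_mono convex_powr_nonneg) (auto simp: add_divide_distrib[symmetric])
      finally show "(f i + g i) powr s
          \<le> (a + b) powr s * (a / (a + b) * (f i / a) powr s + b / (a + b) * (g i / b) powr s)" .
    qed
    also have "\<dots> = (a + b) powr s * (a / (a + b) * ((\<Sum>i\<in>A. f i powr s) / a powr s)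
        + b / (a + b) * ((\<Sum>i\<in>A. g i powr s) / b powr s))"
      by (subst sum_distrib_left[symmetric])
        (simp add: powr_divide sum.distrib sum_distrib_left sum_divide_distrib)
    also have "\<dots> = (a + b) powr s"
      using ab by (simp flip: as bs add: add_divide_distrib[symmetric])
    finally have "(\<Sum>i\<in>A. (f i + g i) powr s) powr (1 / s) \<le> ((a + b) powr s) powr (1 / s)"
      using s by (intro powr_mono2) (auto intro!: sum_nonneg)
    also have "\<dots> = a + b"
      using ab s by (simp add: powr_powr)
    finally show ?thesis
      by (simp add: a_def b_def)
  qed
qed auto

section \<open>Dyadic intervals, Haar functions and the dyadic grid\<close>

definition grid :: "nat \<Rightarrow> real set" where
  "grid N = (\<lambda>j. real j / 2 ^ N) ` {..<2 ^ N}"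

text \<open>The half-open dyadic interval of length \<open>2^(-k)\<close> that contains \<open>t\<close>. It is
defined for every real \<open>t\<close>, so that the branch of \<open>t\<close> can be followed without side
conditions; it belongs to \<^const>\<open>dyadic_level\<close> when \<open>t\<close> lies in the unit
interval.\<close>

definition dint :: "nat \<Rightarrow> real \<Rightarrow> real set" where
  "dint k t = {of_int \<lfloor>2 ^ k * t\<rfloor> / 2 ^ k ..< (of_int \<lfloor>2 ^ k * t\<rfloor> + 1) / 2 ^ k}"

lemma finite_grid [simp]: "finite (grid N)"
  by (simp add: grid_def)

lemma mem_grid_iff: "t \<in> grid N \<longleftrightarrow> 0 \<le> t \<and> t < 1 \<and> 2 ^ N * t \<in> \<int>"
proof
  assume "t \<in> grid N"
  then obtain j where j: "j < 2 ^ N" "t = real j / 2 ^ N"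
    by (auto simp: grid_def)
  have "real j < 2 ^ N"
    using j(1) by (metis of_nat_less_iff of_nat_numeral of_nat_power)
  then show "0 \<le> t \<and> t < 1 \<and> 2 ^ N * t \<in> \<int>"
    using j(2) by auto
next
  assume *: "0 \<le> t \<and> t < 1 \<and> 2 ^ N * t \<in> \<int>"
  then obtain i where i: "2 ^ N * t = of_int i"
    by (auto elim: Ints_cases)
  have "0 \<le> real_of_int i" "of_int i < (2::real) ^ N"
    using * by (auto simp flip: i)
  then have i2: "0 \<le> i" "i < 2 ^ N"
    by (simp, metis of_int_less_iff of_int_numeral of_int_power)
  then have "t = real (nat i) / 2 ^ N" "nat i < 2 ^ N"
    using i by (auto simp: field_simps nat_less_iff)
  then show "t \<in> grid N"
    by (auto simp: grid_def)
qed

lemma mem_dint_iff: "s \<in> dint k t \<longleftrightarrow> \<lfloor>2 ^ k * s\<rfloor> = \<lfloor>2 ^ k * t\<rfloor>"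
  unfolding dint_def by (auto simp: floor_eq_iff field_simps)

lemma dint_self [simp]: "t \<in> dint k t"
  by (simp add: mem_dint_iff)

lemma dint_eq_iff: "dint k s = dint k t \<longleftrightarrow> s \<in> dint k t"
proof
  assume "s \<in> dint k t"
  then have "\<lfloor>2 ^ k * s\<rfloor> = \<lfloor>2 ^ k * t\<rfloor>"
    by (simp add: mem_dint_iff)
  then show "dint k s = dint k t"
    by (simp add: dint_def)
qed (metis dint_self)

lemma floor_power_two_div:
  assumes "n \<le> k"
  shows "\<lfloor>2 ^ n * t\<rfloor> = \<lfloor>2 ^ k * (t::real)\<rfloor> div 2 ^ (k - n)"
proof -
  have "(2::real) ^ k = 2 ^ n * 2 ^ (k - n)"
    using assms by (simp flip: power_add)
  then have "2 ^ n * t = (2 ^ k * t) / real_of_int (2 ^ (k - n))"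
    by simp
  moreover have "\<lfloor>(2 ^ k * t) / real_of_int (2 ^ (k - n))\<rfloor> = \<lfloor>2 ^ k * t\<rfloor> div 2 ^ (k - n)"
    by (rule floor_divide_real_eq_div) simp
  ultimately show ?thesis
    by simp
qed

lemma dint_antimono:
  assumes "n \<le> k" "s \<in> dint k t"
  shows "s \<in> dint n t"
  using assms by (simp add: mem_dint_iff floor_power_two_div[of n k])

lemma dint_in_dyadic_level:
  assumes "0 \<le> t" "t < 1"
  shows "dint k t \<in> dyadic_level k"
proof -
  have "2 ^ k * t < 2 ^ k"
    using assms by simp
  then have "0 \<le> \<lfloor>2 ^ k * t\<rfloor>" "\<lfloor>2 ^ k * t\<rfloor> < 2 ^ k"
    using assms by (auto simp: floor_less_iff)
  then have "nat \<lfloor>2 ^ k * t\<rfloor> < 2 ^ k" "real_of_int \<lfloor>2 ^ k * t\<rfloor> = real (nat \<lfloor>2 ^ k * t\<rfloor>)"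
    by (auto simp: nat_less_iff)
  then show ?thesis
    unfolding dint_def dyadic_level_def by auto
qed

lemma dyadic_level_eq_dint:
  assumes "I \<in> dyadic_level k" "t \<in> I"
  shows "I = dint k t"
proof -
  obtain j where I: "I = {real j / 2 ^ k ..< (real j + 1) / 2 ^ k}"
    using assms by (auto simp: dyadic_level_def)
  then have "\<lfloor>2 ^ k * t\<rfloor> = int j"
    using assms(2) by (auto simp: floor_eq_iff field_simps)
  then show ?thesis
    by (simp add: I dint_def)
qed

lemma dyadic_level_nonempty:
  assumes "I \<in> dyadic_level k"
  obtains t where "t \<in> I" "t \<in> grid k"
proof -
  obtain j where j: "j < 2 ^ k" and I: "I = {real j / 2 ^ k ..< (real j + 1) / 2 ^ k}"
    using assms by (auto simp: dyadic_level_def)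
  have "real j / 2 ^ k \<in> I"
    by (auto simp: I field_simps)
  then show thesis
    using that j by (auto simp: grid_def)
qed

lemma grid_mono:
  assumes "k \<le> N"
  shows "grid k \<subseteq> grid N"
proof
  fix t assume t: "t \<in> grid k"
  have "2 ^ N * t = 2 ^ (N - k) * (2 ^ k * t)"
    using assms by (simp flip: power_add mult.assoc)
  moreover have "2 ^ (N - k) * (2 ^ k * t) \<in> \<int>"
    using t by (intro Ints_mult[of "2 ^ (N - k)"]) (auto simp: mem_grid_iff)
  ultimately have "2 ^ N * t \<in> \<int>"
    by metis
  then show "t \<in> grid N"
    using t by (simp add: mem_grid_iff)
qed

lemma dyadic_level_subset: 
  assumes "I \<in> dyadic_level k"
  shows "I \<subseteq> {0..<1}"
proof -
  obtain j where j: "j < 2 ^ k" and I: "I = {real j / 2 ^ k ..< (real j + 1) / 2 ^ k}"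
    using assms by (auto simp: dyadic_level_def)
  have "real j + 1 \<le> 2 ^ k"
    using j by (metis Suc_leI add.commute of_nat_Suc of_nat_le_iff of_nat_numeral of_nat_power)
  then have "(real j + 1) / 2 ^ k \<le> 1"
    by simp
  moreover have "0 \<le> real j / 2 ^ k"
    by simp
  ultimately show ?thesis
    unfolding I by (auto intro: order_trans less_le_trans)
qed

lemma dyadic_nested:
  assumes "I \<in> dyadic" "J \<in> dyadic"
  shows "I \<subseteq> J \<or> J \<subseteq> I \<or> I \<inter> J = {}"
proof -
  obtain k l where kl: "I \<in> dyadic_level k" "J \<in> dyadic_level l"
    using assms by (auto simp: dyadic_def)
  show ?thesis
  proof (cases "I \<inter> J = {}")
    case False
    then obtain t where "t \<in> I" "t \<in> J"
      by auto
    then have "I = dint k t" "J = dint l t"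
      using kl dyadic_level_eq_dint by auto
    then show ?thesis
      using dint_antimono[of k l] dint_antimono[of l k] by (metis linear subsetI)
  qed auto
qed

lemma measure_dyadic_level:
  assumes "I \<in> dyadic_level k"
  shows "measure lborel I = 1 / 2 ^ k" "emeasure lborel I = ennreal (1 / 2 ^ k)"
proof -
  obtain j where I: "I = {real j / 2 ^ k ..< (real j + 1) / 2 ^ k}"
    using assms by (auto simp: dyadic_level_def)
  have *: "real j / 2 ^ k \<le> (real j + 1) / 2 ^ k"
    by (simp add: divide_right_mono)
  show "measure lborel I = 1 / 2 ^ k" "emeasure lborel I = ennreal (1 / 2 ^ k)"
    using * by (auto simp: I add_divide_distrib)
qed

lemma emeasure_dyadic:
  assumes "I \<in> dyadic"
  shows "emeasure lborel I = ennreal (measure lborel I)" "0 < measure lborel I"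
  using assms measure_dyadic_level by (auto simp: dyadic_def)

lemma dyadic_level_unique:
  assumes "I \<in> dyadic_level k" "I \<in> dyadic_level l"
  shows "k = l"
  using measure_dyadic_level(1)[OF assms(1)] measure_dyadic_level(1)[OF assms(2)] by simp

lemma card_dyadic_level_grid:
  assumes "I \<in> dyadic_level k" "k \<le> N"
  shows "real (card (I \<inter> grid N)) = 2 ^ N * measure lborel I"
proof -
  obtain i where i: "i < 2 ^ k" and I: "I = {real i / 2 ^ k ..< (real i + 1) / 2 ^ k}"
    using assms by (auto simp: dyadic_level_def)
  define M :: nat where "M = 2 ^ (N - k)"
  have N: "2 ^ N = 2 ^ k * M"
    using assms(2) by (simp add: M_def flip: power_add)
  have NR: "(2::real) ^ N = 2 ^ k * real M"
    using assms(2) by (simp add: M_def flip: power_add)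
  have M: "0 < M"
    by (simp add: M_def)
  have "I \<inter> grid N = (\<lambda>j. real j / 2 ^ N) ` {i * M ..< (i + 1) * M}"
  proof -
    have "real j / 2 ^ N \<in> I \<longleftrightarrow> j \<in> {i * M ..< (i + 1) * M}" for j
    proof -
      have "real j / 2 ^ N \<in> I \<longleftrightarrow> real (i * M) \<le> real j \<and> real j < real ((i + 1) * M)"
        using M unfolding I NR by (simp add: field_simps)
      then show ?thesis
        by (simp only: of_nat_le_iff of_nat_less_iff atLeastLessThan_iff)
    qed
    moreover have "{i * M ..< (i + 1) * M} \<subseteq> {..<2 ^ N}"
    proof -
      have "(i + 1) * M \<le> 2 ^ N"
        unfolding N using i by (intro mult_right_mono) auto
      then show ?thesis
        by auto
    qed
    ultimately show ?thesis
      unfolding grid_def by blast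
  qed
  then have "card (I \<inter> grid N) = M"
    by (simp add: card_image inj_on_def)
  then show ?thesis
    using measure_dyadic_level[OF assms(1)] NR by simp
qed

lemma haar_dyadic_level:
  assumes "I \<in> dyadic_level k" "t \<in> I"
  shows "haar I s = (if s \<in> I then if even \<lfloor>2 ^ Suc k * s\<rfloor> then 1 else - 1 else 0)"
proof -
  obtain j where I: "I = {real j / 2 ^ k ..< (real j + 1) / 2 ^ k}"
    using assms by (auto simp: dyadic_level_def)
  have lt: "real j / 2 ^ k < (real j + 1) / 2 ^ k"
    by (simp add: divide_strict_right_mono)
  have mid: "(real j / 2 ^ k + (real j + 1) / 2 ^ k) / 2 = (2 * real j + 1) / 2 ^ Suc k"
    by (simp add: field_simps)
  have 1: "real j / 2 ^ k \<le> s \<and> s < (2 * real j + 1) / 2 ^ Suc k \<longleftrightarrow> \<lfloor>2 ^ Suc k * s\<rfloor> = 2 * int j"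
    by (auto simp: floor_eq_iff field_simps)
  have 2: "(2 * real j + 1) / 2 ^ Suc k \<le> s \<and> s < (real j + 1) / 2 ^ k \<longleftrightarrow> \<lfloor>2 ^ Suc k * s\<rfloor> = 2 * int j + 1"
    by (auto simp: floor_eq_iff field_simps)
  have 3: "s \<in> I \<longleftrightarrow> \<lfloor>2 ^ Suc k * s\<rfloor> = 2 * int j \<or> \<lfloor>2 ^ Suc k * s\<rfloor> = 2 * int j + 1"
    unfolding 1[symmetric] 2[symmetric] I using lt by (auto simp: field_simps)
  show ?thesis
    unfolding 3 unfolding I haar_atLeastLessThan[OF lt] mid 1 2 by auto
qed

lemma haar_outside: "I \<in> dyadic \<Longrightarrow> s \<notin> I \<Longrightarrow> haar I s = 0"
  by (metis UN_E dyadic_def dyadic_level_nonempty haar_dyadic_level)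

lemma haar_dint:
  assumes "0 \<le> t" "t < 1"
  shows "haar (dint k t) t = (if even \<lfloor>2 ^ Suc k * t\<rfloor> then 1 else - 1)"
  using haar_dyadic_level[OF dint_in_dyadic_level[OF assms] dint_self, of k t] by simp

text \<open>The map that exchanges the two halves of every dyadic interval of length \<open>2^(-n)\<close> by
translation. It preserves every finer grid and the first \<open>n\<close> steps of every branch and changes the
sign of the Haar function at step \<open>n\<close>; averaging a function with its composition with this map
therefore plays the role of a conditional expectation.\<close>

definition sibling :: "nat \<Rightarrow> real \<Rightarrow> real" where
  "sibling n t = (if even \<lfloor>2 ^ Suc n * t\<rfloor> then t + 1 / 2 ^ Suc n else t - 1 / 2 ^ Suc n)"

lemma floor_sibling:
  "\<lfloor>2 ^ Suc n * sibling n t\<rfloor> =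
    (if even \<lfloor>2 ^ Suc n * t\<rfloor> then \<lfloor>2 ^ Suc n * t\<rfloor> + 1 else \<lfloor>2 ^ Suc n * t\<rfloor> - 1)"
proof -
  have "2 ^ Suc n * sibling n t = (if even \<lfloor>2 ^ Suc n * t\<rfloor> then 2 ^ Suc n * t + 1 else 2 ^ Suc n * t - 1)"
    by (simp add: sibling_def distrib_left right_diff_distrib del: power_Suc)
  then show ?thesis
    by (auto simp del: power_Suc)
qed

lemma sibling_sibling [simp]: "sibling n (sibling n t) = t"
proof (cases "even \<lfloor>2 ^ Suc n * t\<rfloor>")
  case True
  then have "\<not> even \<lfloor>2 ^ Suc n * sibling n t\<rfloor>"
    by (simp add: floor_sibling del: power_Suc)
  then have "sibling n (sibling n t) = sibling n t - 1 / 2 ^ Suc n"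
    by (simp add: sibling_def[of n "sibling n t"] del: power_Suc)
  then show ?thesis
    using True by (simp add: sibling_def del: power_Suc)
next
  case False
  then have "even \<lfloor>2 ^ Suc n * sibling n t\<rfloor>"
    by (simp add: floor_sibling del: power_Suc)
  then have "sibling n (sibling n t) = sibling n t + 1 / 2 ^ Suc n"
    by (simp add: sibling_def[of n "sibling n t"] del: power_Suc)
  then show ?thesis
    using False by (simp add: sibling_def del: power_Suc)
qed

lemma sibling_mem_dint:
  assumes "k \<le> n"
  shows "sibling n t \<in> dint k t"
proof (rule dint_antimono[OF assms])
  show "sibling n t \<in> dint n t"
    unfolding mem_dint_iff floor_power_two_div[of n "Suc n", OF le_SucI[OF order_refl]] floor_sibling
    by (auto elim!: evenE oddE simp del: power_Suc)
qed

lemma sibling_grid: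
  assumes "n < N" "t \<in> grid N"
  shows "sibling n t \<in> grid N"
proof -
  have "dint 0 t \<subseteq> {0..<1}"
    using assms(2) by (intro dyadic_level_subset[OF dint_in_dyadic_level]) (auto simp: mem_grid_iff)
  then have "0 \<le> sibling n t" "sibling n t < 1"
    using sibling_mem_dint[of 0 n t] by auto
  moreover have "2 ^ N * (1 / 2 ^ Suc n) = (2::real) ^ (N - Suc n)"
    using assms(1) by (simp add: power_diff del: power_Suc)
  then have "2 ^ N * sibling n t = (if even \<lfloor>2 ^ Suc n * t\<rfloor> then 2 ^ N * t + 2 ^ (N - Suc n)
      else 2 ^ N * t - 2 ^ (N - Suc n))"
    by (simp add: sibling_def distrib_left right_diff_distrib del: power_Suc)
  then have "2 ^ N * sibling n t \<in> \<int>"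
    using assms(2) by (auto simp: mem_grid_iff)
  ultimately show ?thesis
    by (simp add: mem_grid_iff)
qed

lemma sum_sibling:
  assumes "n < N"
  shows "(\<Sum>t\<in>grid N. f (sibling n t)) = (\<Sum>t\<in>grid N. f t)"
  by (rule sum.reindex_bij_witness[where i = "sibling n" and j = "sibling n"])
    (use assms sibling_grid in auto)

lemma dint_grid_unique:
  assumes "s \<in> grid N" "s \<in> dint N t" 
  shows "s = of_int \<lfloor>2 ^ N * t\<rfloor> / 2 ^ N"
proof -
  have "2 ^ N * s = of_int \<lfloor>2 ^ N * s\<rfloor>"
    using assms by (auto simp: mem_grid_iff elim: Ints_cases)
  then show ?thesis
    using assms(2) by (simp add: mem_dint_iff field_simps)
qed

lemma floor_point_grid:
  assumes "0 \<le> t" "t < 1"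
  shows "of_int \<lfloor>2 ^ N * t\<rfloor> / 2 ^ N \<in> grid N" "of_int \<lfloor>2 ^ N * t\<rfloor> / 2 ^ N \<in> dint N t"
proof -
  show *: "of_int \<lfloor>2 ^ N * t\<rfloor> / 2 ^ N \<in> dint N t"
    by (simp add: mem_dint_iff)
  then have "of_int \<lfloor>2 ^ N * t\<rfloor> / 2 ^ N \<in> {0..<1::real}"
    using dyadic_level_subset[OF dint_in_dyadic_level[OF assms]] by blast
  then show "of_int \<lfloor>2 ^ N * t\<rfloor> / 2 ^ N \<in> grid N"
    by (simp add: mem_grid_iff)
qed

section \<open>Path norms and Doob's maximal inequality\<close>

text \<open>The martingale differences of \<open>\<Sum> x\<^sub>I h\<^sub>I\<close> at the point
\<open>t\<close>, one for each level, since only one interval of each level contains \<open>t\<close>.\<close>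

definition haar_path :: "(real set \<Rightarrow> 'a::real_vector) \<Rightarrow> real \<Rightarrow> nat \<Rightarrow> 'a" where
  "haar_path x t k = haar (dint k t) t *\<^sub>R x (dint k t)"

definition trunc :: "nat \<Rightarrow> (nat \<Rightarrow> 'a::zero) \<Rightarrow> nat \<Rightarrow> 'a" where
  "trunc n y k = (if k < n then y k else 0)"

definition pmax :: "nat \<Rightarrow> ((nat \<Rightarrow> 'a::zero) \<Rightarrow> real) \<Rightarrow> (nat \<Rightarrow> 'a) \<Rightarrow> real" where
  "pmax N \<nu> y = Max ((\<lambda>n. \<nu> (trunc n y)) ` {..N})"

text \<open>A seminorm on sequences of martingale differences that extends the norm on single differences. The
two instances of interest are the norm of the sum, which gives the function itself, and the Rademacher average,
which gives the square function. Treating them alike makes one good-\<open>\<lambda>\<close> argument serve both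
directions of their comparison.\<close>

locale path_norm =
  fixes N :: nat and \<nu> :: "(nat \<Rightarrow> 'a::real_normed_vector) \<Rightarrow> real"
  assumes cong: "(\<And>k. k < N \<Longrightarrow> y k = z k) \<Longrightarrow> \<nu> y = \<nu> z"
    and triangle: "\<nu> (\<lambda>k. y k + z k) \<le> \<nu> y + \<nu> z"
    and scale: "\<nu> (\<lambda>k. c *\<^sub>R y k) = \<bar>c\<bar> * \<nu> y"
    and single: "k < N \<Longrightarrow> \<nu> (\<lambda>i. if i = k then v else 0) = norm v"
begin

lemma zero [simp]: "\<nu> (\<lambda>k. 0) = 0"
  using scale[of 0 "\<lambda>k. 0"] by simp

lemma minus: "\<nu> (\<lambda>k. - y k) = \<nu> y"
  using scale[of "-1" y] by simp

lemma nonneg: "0 \<le> \<nu> y"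
proof -
  have "\<nu> (\<lambda>k. y k + - y k) \<le> \<nu> y + \<nu> y"
    using triangle[of y "\<lambda>k. - y k"] by (simp only: minus)
  then show ?thesis
    by simp
qed

lemma triangle_diff: "\<nu> (\<lambda>k. y k - z k) \<le> \<nu> y + \<nu> z"
  using triangle[of y "\<lambda>k. - z k"] by (simp add: minus)

lemma triangle_sum: "finite A \<Longrightarrow> \<nu> (\<lambda>k. \<Sum>a\<in>A. y a k) \<le> (\<Sum>a\<in>A. \<nu> (y a))"
proof (induction A rule: finite_induct)
  case (insert a A)
  then show ?case
    using triangle[of "y a" "\<lambda>k. \<Sum>a\<in>A. y a k"] by simp
qed simp

lemma trunc_0 [simp]: "\<nu> (trunc 0 y) = 0"
  by (simp add: trunc_def[abs_def])

lemma trunc_N: "\<nu> (trunc N y) = \<nu> y"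
  by (rule cong) (simp add: trunc_def)

lemma trunc_Suc_le: 
  assumes "k < N"
  shows "\<nu> (trunc (Suc k) y) \<le> \<nu> (trunc k y) + norm (y k)"
proof -
  have "trunc (Suc k) y = (\<lambda>i. trunc k y i + (if i = k then y k else 0))"
    by (auto simp: trunc_def)
  then show ?thesis
    using triangle[of "trunc k y" "\<lambda>i. if i = k then y k else 0"] single[OF assms, of "y k"] by simp
qed

lemma norm_le_trunc: 
  assumes "k < N"
  shows "norm (y k) \<le> \<nu> (trunc (Suc k) y) + \<nu> (trunc k y)"
proof -
  have "(\<lambda>i. if i = k then y k else 0) = (\<lambda>i. trunc (Suc k) y i - trunc k y i)"
    by (auto simp: trunc_def)
  then show ?thesis
    using triangle_diff[of "trunc (Suc k) y" "trunc k y"] single[OF assms, of "y k"] by simp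
qed

lemma trunc_le_pmax: "n \<le> M \<Longrightarrow> \<nu> (trunc n y) \<le> pmax M \<nu> y"
  by (auto simp: pmax_def intro!: Max_ge)

lemma pmax_nonneg: "0 \<le> pmax M \<nu> y"
  using trunc_le_pmax[of 0 M y] by simp

lemma norm_le_pmax:
  assumes "k < N"
  shows "norm (y k) \<le> 2 * pmax N \<nu> y"
  using norm_le_trunc[OF assms, of y] trunc_le_pmax[of "Suc k" N y] trunc_le_pmax[of k N y] assms by simp

end

lemma haar_path_eq:
  assumes "0 \<le> t" "t < 1" "s \<in> dint k t"
  shows "haar_path x s k = (if even \<lfloor>2 ^ Suc k * s\<rfloor> then x (dint k t) else - x (dint k t))"
proof -
  have "dint k s = dint k t"
    using assms(3) by (simp add: dint_eq_iff)
  then show ?thesis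
    using haar_dyadic_level[OF dint_in_dyadic_level[OF assms(1,2)] dint_self, of k s] assms(3)
    by (simp add: haar_path_def del: power_Suc)
qed

lemma haar_path_cong:
  assumes "0 \<le> t" "t < 1" "s \<in> dint n t" "k < n"
  shows "haar_path x s k = haar_path x t k"
proof -
  have "s \<in> dint k t" "s \<in> dint (Suc k) t"
    using dint_antimono[OF _ assms(3)] assms(4) by auto
  then show ?thesis
    unfolding haar_path_eq[OF assms(1,2) dint_self] haar_path_eq[OF assms(1,2) \<open>s \<in> dint k t\<close>]
    by (simp add: mem_dint_iff del: power_Suc)
qed

lemma trunc_haar_path_cong:
  assumes "0 \<le> t" "t < 1" "s \<in> dint n t" "m \<le> n"
  shows "trunc m (haar_path x s) = trunc m (haar_path x t)"
proof
  fix k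
  show "trunc m (haar_path x s) k = trunc m (haar_path x t) k"
    using haar_path_cong[OF assms(1-3), of k x] assms(4) by (simp add: trunc_def)
qed

lemma haar_path_eq_or_minus:
  assumes "0 \<le> t" "t < 1" "s \<in> dint k t"
  shows "haar_path x s k = haar_path x t k \<or> haar_path x s k = - haar_path x t k"
  unfolding haar_path_eq[OF assms] haar_path_eq[OF assms(1,2) dint_self] by auto

lemma haar_path_sibling:
  assumes "0 \<le> t" "t < 1"
  shows "haar_path x (sibling n t) n = - haar_path x t n"
  unfolding haar_path_eq[OF assms sibling_mem_dint[OF order_refl]] haar_path_eq[OF assms dint_self]
    floor_sibling by auto

lemma norm_haar_path: 
  assumes "0 \<le> t" "t < 1"
  shows "norm (haar_path x t k) = norm (x (dint k t))"
  using assms by (simp add: haar_path_def haar_dint del: power_Suc)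

context path_norm
begin

text \<open>Predictability of the maximal function up to a constant: if the maximal function is small at one
point of an interval, then the path norm is still under control on the sibling half, because the jump across the
interval has the same norm on both halves.\<close>

lemma trunc_Suc_le_pmax:
  assumes t: "0 \<le> t" "t < 1" and s: "s \<in> dint k t" and k: "k < N" and n: "n \<le> Suc k"
  shows "\<nu> (trunc n (haar_path x t)) \<le> 3 * pmax N \<nu> (haar_path x s)"
proof (cases "n = Suc k")
  case True
  have "norm (haar_path x t k) = norm (haar_path x s k)"
    using haar_path_eq_or_minus[OF t s, of x] by auto
  also have "\<dots> \<le> 2 * pmax N \<nu> (haar_path x s)"
    using k by (rule norm_le_pmax)
  finally have "norm (haar_path x t k) \<le> 2 * pmax N \<nu> (haar_path x s)" .
  moreover have "\<nu> (trunc k (haar_path x t)) \<le> pmax N \<nu> (haar_path x s)"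
    using trunc_haar_path_cong[OF t s order_refl, of x] trunc_le_pmax[of k N "haar_path x s"] k by simp
  ultimately show ?thesis
    using trunc_Suc_le[OF k, of "haar_path x t"] True by simp
next
  case False
  then have "\<nu> (trunc n (haar_path x t)) \<le> pmax N \<nu> (haar_path x s)"
    using trunc_haar_path_cong[OF t s, of n x] trunc_le_pmax[of n N "haar_path x s"] n k by simp
  then show ?thesis
    using pmax_nonneg[of N "haar_path x s"] by simp
qed

end

text \<open>The function \<open>y^q - q' y^(q-1) x\<close>, with \<open>q'\<close> the dual exponent, decreases
in \<open>y\<close> up to \<open>y = x\<close>: this is Young's inequality. Here \<open>x\<close> stands for the
current value and \<open>y\<close> for the running maximum.\<close>

lemma doob_potential_antimono:
  fixes x y q :: real
  assumes q: "1 < q" and x: "0 \<le> x" and y: "0 \<le> y"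
  shows "max y x powr q - q / (q - 1) * max y x powr (q - 1) * x
    \<le> y powr q - q / (q - 1) * y powr (q - 1) * x"
proof (cases "y = 0 \<or> x \<le> y")
  case True
  have "x powr q = x powr (q - 1) * x"
    using x q by (cases "x = 0") (auto simp: powr_diff)
  moreover have "x powr q \<le> q / (q - 1) * x powr q"
    using q by (simp add: field_simps)
  ultimately show ?thesis
    using True x by (auto simp: max_def mult.assoc)
next
  case False
  with y have yx: "0 < y" "y < x"
    by auto
  define z where "z = y / x"
  have z: "0 < z"
    using yx by (simp add: z_def)
  have eq: "(1 - 1 / q) * ln (z powr q) + 1 / q * 0 = (q - 1) * ln z"
    using q z by (simp add: ln_powr left_diff_distrib right_diff_distrib)
  have "exp ((1 - 1 / q) * ln (z powr q) + 1 / q * 0) \<le> (1 - 1 / q) * exp (ln (z powr q)) + 1 / q * exp 0"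
    using convex_onD[OF exp_convex, of "1 / q" "ln (z powr q)" 0] q by simp
  then have "exp ((q - 1) * ln z) \<le> (1 - 1 / q) * z powr q + 1 / q"
    unfolding eq using z by (simp add: powr_def)
  then have "z powr (q - 1) \<le> (1 - 1 / q) * z powr q + 1 / q"
    using z by (simp add: powr_def)
  then have "x powr q * (z powr (q - 1)) \<le> x powr q * ((1 - 1 / q) * z powr q + 1 / q)"
    by (intro mult_left_mono) auto
  moreover have "x powr q * z powr (q - 1) = y powr (q - 1) * x"
    using yx by (simp add: z_def powr_divide powr_diff)
  moreover have "x powr q * z powr q = y powr q"
    using yx by (simp add: z_def powr_divide)
  ultimately have *: "y powr (q - 1) * x \<le> (1 - 1 / q) * y powr q + x powr q / q"
    by (simp add: algebra_simps)
  have "q / (q - 1) * (y powr (q - 1) * x) \<le> q / (q - 1) * ((1 - 1 / q) * y powr q + x powr q / q)"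
    using q by (intro mult_left_mono[OF *]) auto
  also have "\<dots> = y powr q + x powr q / (q - 1)"
    using q by (simp add: field_simps)
  finally have "q / (q - 1) * (y powr (q - 1) * x) \<le> y powr q + x powr q / (q - 1)" .
  moreover have "x powr q - q / (q - 1) * (x powr (q - 1) * x) = - (x powr q / (q - 1))"
    using q yx by (simp add: powr_diff field_simps)
  ultimately show ?thesis
    using yx by (simp add: max_def mult.assoc)
qed

text \<open>Along the martingale the average of \<open>M^q - q' M^(q-1) u\<close>, with \<open>u\<close> the
path norm and \<open>M\<close> its running maximum, does not increase: the step of \<open>u\<close> is a
submartingale step against the predictable factor \<open>M^(q-1)\<close>, and raising the maximum is covered by
\<open>doob_potential_antimono\<close>. It starts at \<open>0\<close>, and at the end Young's inequality
separates the two factors.\<close>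

lemma (in path_norm) doob_inequality:
  assumes q: "1 < q"
  shows "(\<Sum>t\<in>grid N. pmax N \<nu> (haar_path x t) powr q)
    \<le> (2 * (q / (q - 1))) powr q * (\<Sum>t\<in>grid N. \<nu> (haar_path x t) powr q)"
proof -
  define c where "c = q / (q - 1)"
  have c: "0 < c"
    using q by (simp add: c_def)
  define M where "M n t = pmax n \<nu> (haar_path x t)" for n t
  define u where "u n t = \<nu> (trunc n (haar_path x t))" for n t
  define U where "U n = (\<Sum>t\<in>grid N. M n t powr q - c * M n t powr (q - 1) * u n t)" for n
  have grid: "0 \<le> t" "t < 1" if "t \<in> grid N" for t
    using that by (auto simp: mem_grid_iff)
  have M0: "0 \<le> M n t" and u0: "0 \<le> u n t" for n t
    by (simp_all add: M_def u_def pmax_nonneg nonneg)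
  have M_Suc: "M (Suc n) t = max (M n t) (u (Suc n) t)" for n t
    unfolding M_def u_def pmax_def by (simp add: atMost_Suc Max_insert max.commute)
  have step: "U (Suc n) \<le> U n" if n: "n < N" for n
  proof -
    have sib_eq: "trunc m (haar_path x (sibling n t)) = trunc m (haar_path x t)"
      if "t \<in> grid N" "m \<le> n" for t m
      using trunc_haar_path_cong[OF grid[OF that(1)] sibling_mem_dint[OF order_refl] that(2)] .
    have M_sib: "M n (sibling n t) = M n t" if "t \<in> grid N" for t
      unfolding M_def pmax_def using sib_eq[OF that] by (intro arg_cong[where f = Max] image_cong) auto
    have mid: "2 * u n t \<le> u (Suc n) t + u (Suc n) (sibling n t)" if t: "t \<in> grid N" for t
    proof -
      have "(\<lambda>k. 2 *\<^sub>R trunc n (haar_path x t) k)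
          = (\<lambda>k. trunc (Suc n) (haar_path x t) k + trunc (Suc n) (haar_path x (sibling n t)) k)"
        using haar_path_sibling[OF grid[OF t], of x n]
          haar_path_cong[OF grid[OF t] sibling_mem_dint[OF order_refl], of _ n x]
        by (auto simp: trunc_def less_Suc_eq scaleR_2 fun_eq_iff)
      then have "\<nu> (\<lambda>k. 2 *\<^sub>R trunc n (haar_path x t) k) \<le> u (Suc n) t + u (Suc n) (sibling n t)"
        unfolding u_def by (simp only: triangle)
      then show ?thesis
        by (simp add: u_def scale)
    qed
    have "2 * (\<Sum>t\<in>grid N. M n t powr (q - 1) * u n t)
        \<le> (\<Sum>t\<in>grid N. M n t powr (q - 1) * u (Suc n) t + M n (sibling n t) powr (q - 1) * u (Suc n) (sibling n t))"
      unfolding sum_distrib_left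
    proof (rule sum_mono)
      fix t assume t: "t \<in> grid N"
      have "M n t powr (q - 1) * (2 * u n t) \<le> M n t powr (q - 1) * (u (Suc n) t + u (Suc n) (sibling n t))"
        using mid[OF t] by (intro mult_left_mono) auto
      then show "2 * (M n t powr (q - 1) * u n t)
          \<le> M n t powr (q - 1) * u (Suc n) t + M n (sibling n t) powr (q - 1) * u (Suc n) (sibling n t)"
        using M_sib[OF t] by (simp add: algebra_simps)
    qed
    also have "\<dots> = 2 * (\<Sum>t\<in>grid N. M n t powr (q - 1) * u (Suc n) t)"
      using sum_sibling[OF n, of "\<lambda>t. M n t powr (q - 1) * u (Suc n) t"] by (simp add: sum.distrib)
    finally have submart: "(\<Sum>t\<in>grid N. M n t powr (q - 1) * u n t) \<le> (\<Sum>t\<in>grid N. M n t powr (q - 1) * u (Suc n) t)"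
      by simp
    have "U (Suc n) \<le> (\<Sum>t\<in>grid N. M n t powr q - c * M n t powr (q - 1) * u (Suc n) t)"
      unfolding U_def M_Suc c_def using q M0 u0 by (intro sum_mono doob_potential_antimono) auto
    also have "\<dots> = (\<Sum>t\<in>grid N. M n t powr q) - c * (\<Sum>t\<in>grid N. M n t powr (q - 1) * u (Suc n) t)"
      by (simp add: sum_subtractf sum_distrib_left mult.assoc)
    also have "\<dots> \<le> (\<Sum>t\<in>grid N. M n t powr q) - c * (\<Sum>t\<in>grid N. M n t powr (q - 1) * u n t)"
      using submart c by (simp add: mult_left_mono)
    also have "\<dots> = U n"
      by (simp add: U_def sum_subtractf sum_distrib_left mult.assoc)
    finally show ?thesis .
  qed
  have "U n \<le> 0" if "n \<le> N" for n
    using that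
  proof (induction n)
    case 0
    have "u 0 t = 0" "M 0 t = 0" for t
      by (simp_all add: u_def M_def pmax_def)
    then show ?case
      by (simp add: U_def)
  next
    case (Suc n)
    then show ?case
      using step[of n] by simp
  qed
  then have UN: "U N \<le> 0"
    by simp
  have pointwise: "(1 / 2) * M N t powr q - (2 * c) powr q / 2 * u N t powr q
      \<le> M N t powr q - c * M N t powr (q - 1) * u N t" for t
  proof (cases "2 * c * u N t \<le> M N t")
    case True
    have "M N t powr (q - 1) * M N t = M N t powr q"
      using M0[of N t] q by (cases "M N t = 0") (auto simp: powr_diff)
    moreover have "M N t powr (q - 1) * (2 * c * u N t) \<le> M N t powr (q - 1) * M N t"
      using True by (intro mult_left_mono) auto
    moreover have "0 \<le> (2 * c) powr q / 2 * u N t powr q"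
      by simp
    moreover have "M N t powr (q - 1) * (2 * c * u N t) = 2 * (c * M N t powr (q - 1) * u N t)"
      by simp
    ultimately show ?thesis
      by linarith
  next
    case False
    have "M N t powr (q - 1) \<le> (2 * c * u N t) powr (q - 1)"
      using False M0[of N t] q by (intro powr_mono2) auto
    then have "c * u N t * M N t powr (q - 1) \<le> c * u N t * (2 * c * u N t) powr (q - 1)"
      using c u0[of N t] by (intro mult_left_mono) auto
    also have "\<dots> = (2 * c * u N t) powr q / 2"
      using c u0[of N t] q by (cases "u N t = 0") (auto simp: powr_diff)
    also have "\<dots> = (2 * c) powr q / 2 * u N t powr q"
      by (simp add: powr_mult)
    finally have "c * u N t * M N t powr (q - 1) \<le> (2 * c) powr q / 2 * u N t powr q" .
    moreover have "0 \<le> M N t powr q" "c * u N t * M N t powr (q - 1) = c * M N t powr (q - 1) * u N t"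
      by simp_all
    ultimately show ?thesis
      by linarith
  qed
  have "(\<Sum>t\<in>grid N. (1 / 2) * M N t powr q - (2 * c) powr q / 2 * u N t powr q) \<le> U N"
    unfolding U_def by (intro sum_mono pointwise)
  with UN have "(\<Sum>t\<in>grid N. (1 / 2) * M N t powr q - (2 * c) powr q / 2 * u N t powr q) \<le> 0"
    by linarith
  then have "(1 / 2) * (\<Sum>t\<in>grid N. M N t powr q) - (2 * c) powr q / 2 * (\<Sum>t\<in>grid N. u N t powr q) \<le> 0"
    by (simp only: sum_subtractf sum_distrib_left)
  then show ?thesis
    by (simp add: M_def u_def c_def trunc_N)
qed

section \<open>Extrapolation by good-\<open>\<lambda>\<close> inequalities\<close>

text \<open>Discrete layer-cake formula. The level sets at heights \<open>4^k\<close> with \<open>|k| \<le>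
K\<close> reproduce \<open>s^p\<close>, for \<open>s \<le> 4^K\<close>, up to a factor and an error that
vanishes as \<open>K\<close> grows; a finite range of \<open>k\<close> keeps all sums finite, so that absorption
is legitimate.\<close>

lemma powr_le_sum_levels:
  fixes s p :: real and K :: nat
  assumes p: "0 < p" and s: "0 \<le> s" "s \<le> 4 powr K"
  shows "s powr p \<le> 4 powr p * ((\<Sum>k\<in>{- int K..int K}. 2 powr (2 * p * k) * of_bool (4 powr k < s)) + 4 powr (- p * K))"
proof -
  define S where "S = (\<Sum>k\<in>{- int K..int K}. 2 powr (2 * p * k) * of_bool (4 powr k < s))"
  have S0: "0 \<le> S"
    unfolding S_def by (intro sum_nonneg mult_nonneg_nonneg) simp_all
  have "s powr p \<le> 4 powr p * (S + 4 powr (- p * K))"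
  proof (cases "s \<le> 4 powr - real K")
    case True
    then have "s powr p \<le> (4 powr - real K) powr p"
      using p s by (intro powr_mono2) auto
    also have "\<dots> = 1 * 4 powr (- p * K)"
      by (simp add: powr_powr mult.commute)
    also have "\<dots> \<le> 4 powr p * 4 powr (- p * K)"
      using p by (intro mult_right_mono) (auto simp: ge_one_powr_ge_zero)
    also have "\<dots> \<le> 4 powr p * (S + 4 powr (- p * K))"
      using S0 by (intro mult_left_mono) simp_all
    finally show ?thesis .
  next
    case False
    then have s0: "0 < s"
      by (smt (verit) powr_gt_zero)
    define k where "k = \<lceil>log 4 s\<rceil> - 1"
    have k: "4 powr k < s" "s \<le> 4 powr (k + 1)"
    proof -
      have "real_of_int k < log 4 s" "log 4 s \<le> real_of_int k + 1"
        unfolding k_def by linarith+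
      then show "4 powr k < s" "s \<le> 4 powr (k + 1)"
        using s0 by (auto simp: less_log_iff log_le_iff)
    qed
    have "- real K < log 4 s" "log 4 s \<le> K"
      using False s s0 by (auto simp: less_log_iff log_le_iff)
    then have kK: "k \<in> {- int K..int K}"
      unfolding k_def by auto linarith+
    have "s powr p \<le> (4 powr (k + 1)) powr p"
      using k s p by (intro powr_mono2) auto
    also have "\<dots> = 4 powr p * 4 powr (p * k)"
      by (simp add: powr_powr algebra_simps flip: powr_add)
    also have "4 powr (p * k) = 2 powr (2 * p * k)"
      using powr_powr[of 2 2 "p * k"] by (simp add: mult.assoc)
    also have "\<dots> = 2 powr (2 * p * k) * of_bool (4 powr k < s)"
      using k by simp
    also have "\<dots> \<le> S"
      unfolding S_def using kK by (intro member_le_sum[of k]) simp_all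
    also have "\<dots> \<le> \<dots> + 4 powr (- p * K)"
      by simp
    finally show ?thesis
      by (simp add: mult_left_mono)
  qed
  then show ?thesis
    by (simp add: S_def)
qed

lemma sum_levels_le:
  fixes s b :: real and K :: "int set"
  assumes b: "0 < b" and K: "finite K"
  shows "(\<Sum>k\<in>K. 2 powr (b * k) * of_bool (2 powr k \<le> s)) \<le> s powr b / (1 - 2 powr - b)"
proof (cases "0 < s")
  case True
  have "(\<Sum>k\<in>K. 2 powr (b * k) * of_bool (2 powr k \<le> s)) = (\<Sum>k\<in>{k\<in>K. 2 powr k \<le> s}. 2 powr (b * k))"
    using K by (auto simp: of_bool_def if_distrib sum.If_cases Int_def cong: if_cong)
  also have "\<dots> \<le> 2 powr (b * log 2 s) / (1 - 2 powr - b)"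
    using K b True by (intro sum_powr_int_le) (auto simp: le_log_iff)
  also have "2 powr (b * log 2 s) = s powr b"
    using True by (subst mult.commute, subst powr_powr[symmetric]) simp
  finally show ?thesis .
next
  case False
  then have "\<not> 2 powr real_of_int k \<le> s" for k
    by (smt (verit) powr_gt_zero)
  moreover have "(2::real) powr - b < 1"
    using b by (auto simp: powr_less_one)
  ultimately show ?thesis
    by simp
qed

text \<open>Multiplying the level-set inequality at height \<open>4^k\<close> by \<open>4^(pk)\<close> and
summing, the last term reproduces half of the left-hand side and is absorbed. The shift from \<open>4 *
L\<close> to \<open>L\<close> loses one boundary term, which tends to \<open>0\<close> with the
truncation.\<close>

lemma good_lambda_imp_Lp:
  fixes u g :: "'i \<Rightarrow> real"
  assumes P: "finite P" and p: "0 < p" and \<delta>: "0 < \<delta>"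
    and u: "\<And>t. t \<in> P \<Longrightarrow> 0 \<le> u t" and g: "\<And>t. t \<in> P \<Longrightarrow> 0 \<le> g t"
    and good: "\<And>L::real. 0 < L \<Longrightarrow> 4 powr p * (\<Sum>t\<in>P. of_bool (4 * L < u t))
      \<le> 4 powr p * (\<Sum>t\<in>P. of_bool (\<delta> * L < g t)) + (1 / 2) * (\<Sum>t\<in>P. of_bool (L < u t))"
  shows "(\<Sum>t\<in>P. u t powr p)
    \<le> 2 * 4 powr (2 * p) / (\<delta> powr p * (1 - 2 powr (- 2 * p))) * (\<Sum>t\<in>P. g t powr p)"
proof -
  define G where "G = (\<Sum>t\<in>P. g t powr p) / (\<delta> powr p * (1 - 2 powr (- 2 * p)))"
  define e where "e K = (4::real) powr (- p * real K)" for K :: nat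
  define N where "N = real (card P)"
  have bound: "(\<Sum>t\<in>P. u t powr p) \<le> 4 powr p * (2 * 4 powr p * G + 3 * N * e K)"
    if K: "\<And>t. t \<in> P \<Longrightarrow> u t \<le> 4 powr K" for K
  proof -
    define S where "S = {- int K..int K}"
    define a where "a k = 2 powr (2 * p * real_of_int k) * (\<Sum>t\<in>P. of_bool (4 powr k < u t))" for k :: int
    have a0: "0 \<le> a k" for k
      unfolding a_def by (intro mult_nonneg_nonneg sum_nonneg) simp_all
    have four: "4 powr p * 2 powr (2 * p * k) = 2 powr (2 * p * (k + 1))" for k :: int
      using powr_powr[of 2 2 p] by (simp add: algebra_simps flip: powr_add)
    have "(\<Sum>k\<in>S. a k) - N * e K \<le> (\<Sum>k\<in>S. a (k + 1))"
    proof -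
      have "(\<Sum>k\<in>S. a (k + 1)) = (\<Sum>k\<in>{- int K + 1..int K + 1}. a k)"
        unfolding S_def by (rule sum.reindex_bij_witness[where i = "\<lambda>k. k - 1" and j = "\<lambda>k. k + 1"]) auto
      moreover have "(\<Sum>k\<in>S. a k) \<le> a (- int K) + (\<Sum>k\<in>{- int K + 1..int K + 1}. a k)"
      proof -
        have "(\<Sum>k\<in>S. a k) \<le> (\<Sum>k\<in>insert (- int K) {- int K + 1..int K + 1}. a k)"
          unfolding S_def using a0 by (intro sum_mono2) auto
        then show ?thesis
          by simp
      qed
      moreover have "a (- int K) \<le> e K * N"
      proof -
        have "2 powr (2 * p * real_of_int (- int K)) = e K"
          using powr_powr[of 2 2 "- p * real K"] by (simp add: e_def mult.assoc)
        moreover have "(\<Sum>t\<in>P. of_bool (4 powr real_of_int (- int K) < u t)) \<le> (\<Sum>t\<in>P. 1::real)"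
          by (intro sum_mono) auto
        ultimately show ?thesis
          unfolding a_def N_def by (simp add: e_def)
      qed
      ultimately show ?thesis
        by (simp add: mult.commute)
    qed
    also have "(\<Sum>k\<in>S. a (k + 1)) \<le> (\<Sum>k\<in>S. 4 powr p * (2 powr (2 * p * k) * (\<Sum>t\<in>P. of_bool (4 powr k < g t / \<delta>)))
        + (1 / 2) * a k)"
    proof (rule sum_mono)
      fix k :: int
      have "4 * 4 powr real_of_int k = 4 powr real_of_int (k + 1)"
        by (simp add: powr_add)
      moreover have "\<delta> * 4 powr real_of_int k < g t \<longleftrightarrow> 4 powr real_of_int k < g t / \<delta>" for t
        using \<delta> by (simp add: field_simps)
      ultimately have "4 powr p * (\<Sum>t\<in>P. of_bool (4 powr (k + 1) < u t))
          \<le> 4 powr p * (\<Sum>t\<in>P. of_bool (4 powr k < g t / \<delta>)) + (1 / 2) * (\<Sum>t\<in>P. of_bool (4 powr k < u t))"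
        using good[of "4 powr k"] by simp
      then have "2 powr (2 * p * k) * (4 powr p * (\<Sum>t\<in>P. of_bool (4 powr (k + 1) < u t)))
          \<le> 2 powr (2 * p * k) * (4 powr p * (\<Sum>t\<in>P. of_bool (4 powr k < g t / \<delta>)) + (1 / 2) * (\<Sum>t\<in>P. of_bool (4 powr k < u t)))"
        by (intro mult_left_mono) auto
      then show "a (k + 1) \<le> 4 powr p * (2 powr (2 * p * k) * (\<Sum>t\<in>P. of_bool (4 powr k < g t / \<delta>))) + (1 / 2) * a k"
        unfolding a_def four[symmetric] by (simp add: algebra_simps)
    qed
    also have "\<dots> = 4 powr p * (\<Sum>k\<in>S. 2 powr (2 * p * k) * (\<Sum>t\<in>P. of_bool (4 powr k < g t / \<delta>)))
        + (1 / 2) * (\<Sum>k\<in>S. a k)"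
      by (simp add: sum.distrib sum_distrib_left)
    also have "(\<Sum>k\<in>S. 2 powr (2 * p * k) * (\<Sum>t\<in>P. of_bool (4 powr k < g t / \<delta>))) \<le> G"
    proof -
      have "(\<Sum>k\<in>S. 2 powr (2 * p * k) * (\<Sum>t\<in>P. of_bool (4 powr k < g t / \<delta>)))
          = (\<Sum>t\<in>P. \<Sum>k\<in>S. 2 powr (2 * p * k) * of_bool (4 powr k < g t / \<delta>))"
        unfolding sum_distrib_left by (rule sum.swap)
      also have "\<dots> \<le> (\<Sum>t\<in>P. (g t / \<delta>) powr p / (1 - 2 powr (- 2 * p)))"
      proof (rule sum_mono)
        fix t assume t: "t \<in> P"
        have "(\<Sum>k\<in>S. 2 powr (2 * p * k) * of_bool (4 powr k < g t / \<delta>))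
            \<le> (\<Sum>k\<in>S. 2 powr (2 * p * k) * of_bool (2 powr k \<le> (g t / \<delta>) powr (1 / 2)))"
        proof (intro sum_mono mult_left_mono)
          fix k :: int
          have "2 powr k \<le> (g t / \<delta>) powr (1 / 2)" if "4 powr k < g t / \<delta>"
          proof -
            have "(4 powr k) powr (1 / 2) \<le> (g t / \<delta>) powr (1 / 2)"
              using that by (intro powr_mono2) auto
            moreover have "(4 powr k) powr (1 / 2) = 2 powr real_of_int k"
              using powr_powr[of 2 2 "k / 2"] by (simp add: powr_powr)
            ultimately show ?thesis
              by simp
          qed
          then show "of_bool (4 powr k < g t / \<delta>) \<le> (of_bool (2 powr k \<le> (g t / \<delta>) powr (1 / 2)) :: real)"
            by simp
        qed simp
        also have "\<dots> \<le> ((g t / \<delta>) powr (1 / 2)) powr (2 * p) / (1 - 2 powr - (2 * p))"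
          using p by (intro sum_levels_le) (auto simp: S_def)
        finally show "(\<Sum>k\<in>S. 2 powr (2 * p * k) * of_bool (4 powr k < g t / \<delta>))
            \<le> (g t / \<delta>) powr p / (1 - 2 powr (- 2 * p))"
          by (simp add: powr_powr)
      qed
      also have "\<dots> = G"
        by (simp add: G_def powr_divide sum_divide_distrib)
      finally show ?thesis .
    qed
    finally have A: "(\<Sum>k\<in>S. a k) \<le> 2 * 4 powr p * G + 2 * N * e K"
      by (simp add: mult_left_mono algebra_simps)
    have "(\<Sum>t\<in>P. u t powr p) \<le> (\<Sum>t\<in>P. 4 powr p * ((\<Sum>k\<in>S. 2 powr (2 * p * k) * of_bool (4 powr k < u t)) + e K))"
      unfolding S_def e_def using p u K by (intro sum_mono powr_le_sum_levels) auto
    also have "\<dots> = 4 powr p * ((\<Sum>t\<in>P. \<Sum>k\<in>S. 2 powr (2 * p * k) * of_bool (4 powr k < u t)) + N * e K)"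
      by (simp add: N_def sum.distrib flip: sum_distrib_left)
    also have "(\<Sum>t\<in>P. \<Sum>k\<in>S. 2 powr (2 * p * k) * of_bool (4 powr k < u t)) = (\<Sum>k\<in>S. a k)"
      unfolding a_def sum_distrib_left by (rule sum.swap)
    also have "4 powr p * ((\<Sum>k\<in>S. a k) + N * e K) \<le> 4 powr p * (2 * 4 powr p * G + 3 * N * e K)"
      using A by (intro mult_left_mono) auto
    finally show ?thesis .
  qed
  have "\<exists>K0. \<forall>K::nat\<ge>K0. \<forall>t\<in>P. u t \<le> 4 powr real K"
  proof -
    obtain K0 :: nat where K0: "(\<Sum>t\<in>P. u t) \<le> K0"
      using real_arch_simple by blast
    have "u t \<le> 4 powr K" if "K0 \<le> K" "t \<in> P" for K t
    proof -
      have "u t \<le> (\<Sum>t\<in>P. u t)"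
        using P u that by (intro member_le_sum) auto
      also have "\<dots> \<le> real K"
        using K0 that by simp
      also have "\<dots> \<le> 4 ^ K"
      proof -
        have "K \<le> 4 ^ K"
          by simp
        then have "real K \<le> real (4 ^ K)"
          by (rule of_nat_mono)
        then show ?thesis
          by simp
      qed
      finally show ?thesis
        by (simp add: powr_realpow)
    qed
    then show ?thesis
      by blast
  qed
  then have ev: "\<exists>K0::nat. \<forall>K\<ge>K0. (\<Sum>t\<in>P. u t powr p) \<le> 4 powr p * (2 * 4 powr p * G + 3 * N * e K)"
    using bound by blast
  have "e \<longlonglongrightarrow> 0"
  proof -
    have "e = (\<lambda>K. (4 powr - p) ^ K)"
    proof
      fix K
      have "(4 powr - p) ^ K = ((4::real) powr - p) powr real K"
        by (rule powr_realpow[symmetric]) simp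
      then show "e K = (4 powr - p) ^ K"
        by (simp add: e_def powr_powr)
    qed
    moreover have "(4::real) powr - p < 1"
      using p by (auto simp: powr_less_one)
    ultimately show ?thesis
      by (auto intro!: LIMSEQ_realpow_zero)
  qed
  then have "(\<lambda>K. 4 powr p * (2 * 4 powr p * G + 3 * N * e K)) \<longlonglongrightarrow> 4 powr p * (2 * 4 powr p * G + 3 * N * 0)"
    by (intro tendsto_intros)
  then have "(\<Sum>t\<in>P. u t powr p) \<le> 4 powr p * (2 * 4 powr p * G + 3 * N * 0)"
    using ev by (rule LIMSEQ_le_const)
  also have "\<dots> = 2 * 4 powr (2 * p) / (\<delta> powr p * (1 - 2 powr (- 2 * p))) * (\<Sum>t\<in>P. g t powr p)"
  proof -
    have "(4::real) powr (2 * p) = 4 powr p * 4 powr p"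
      by (simp flip: powr_add)
    then show ?thesis
      by (simp add: G_def)
  qed
  finally show ?thesis .
qed

text \<open>The comparison hypothesis is applied to the part of the Haar sum that starts when the first path
norm exceeds \<open>L\<close>, stops when it exceeds \<open>4 * L\<close>, and skips all intervals on which the
maximal function of the second path norm is everywhere larger than \<open>\<delta> * L\<close>. Membership of an
interval in this part is decided by the interval alone, hence the part is again a Haar sum. Its second path norm
is at most \<open>6 * \<delta> * L\<close> and vanishes off \<open>{L < u}\<close>; its first path norm is at
least \<open>L\<close> wherever \<open>u\<close> exceeds \<open>4 * L\<close> and the second maximal function
does not exceed \<open>\<delta> * L\<close>.\<close>

lemma good_lambda:
  fixes x :: "real set \<Rightarrow> 'a::real_normed_vector"
  assumes n1: "path_norm N \<nu>1" and n2: "path_norm N \<nu>2"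
    and loc: "\<And>x. (\<Sum>t\<in>grid N. \<nu>1 (haar_path x t) powr r) \<le> C * (\<Sum>t\<in>grid N. \<nu>2 (haar_path x t) powr r)"
    and r: "0 < r" and C: "0 \<le> C" and \<delta>: "0 < \<delta>" "\<delta> \<le> 1 / 2" and L: "0 < L"
  shows "(\<Sum>t\<in>grid N. of_bool (4 * L < pmax N \<nu>1 (haar_path x t)))
    \<le> (\<Sum>t\<in>grid N. of_bool (\<delta> * L < pmax N \<nu>2 (haar_path x t)))
      + C * (6 * \<delta>) powr r * (\<Sum>t\<in>grid N. of_bool (L < pmax N \<nu>1 (haar_path x t)))"
proof -
  interpret n1: path_norm N \<nu>1 by (rule n1)
  interpret n2: path_norm N \<nu>2 by (rule n2)
  define a where "a n t = \<nu>1 (trunc n (haar_path x t))" for n t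
  define u where "u t = pmax N \<nu>1 (haar_path x t)" for t
  define g where "g t = pmax N \<nu>2 (haar_path x t)" for t
  have grid: "0 \<le> t" "t < 1" if "t \<in> grid N" for t
    using that by (auto simp: mem_grid_iff)
  have u_gr: "c < u t \<longleftrightarrow> (\<exists>n\<le>N. c < a n t)" for c t
    by (auto simp: u_def a_def pmax_def Max_gr_iff)
  have a_cong: "a n s = a n t" if "t \<in> grid N" "s \<in> dint k t" "n \<le> k" for n k s t
    using trunc_haar_path_cong[OF grid[OF that(1)] that(2,3), of x] by (simp add: a_def)
  define Q where "Q k t \<longleftrightarrow> (\<exists>s\<in>dint k t \<inter> grid N. g s \<le> \<delta> * L) \<and> (\<exists>n\<le>k. L < a n t) \<and> (\<forall>n\<le>k. a n t \<le> 4 * L)"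
    for k t
  \<comment> \<open>\<open>Q k t\<close> says that the interval of level \<open>k\<close> around \<open>t\<close> is kept; it depends on \<open>t\<close> only through that interval.\<close>
  define y where "y I = (if \<exists>k<N. \<exists>t\<in>grid N. I = dint k t \<and> Q k t then x I else 0)" for I
  have y: "haar_path y t k = (if Q k t then haar_path x t k else 0)" if t: "t \<in> grid N" and k: "k < N" for t k
  proof -
    have "Q k t" if "k' < N" "t' \<in> grid N" "dint k t = dint k' t'" "Q k' t'" for k' t'
    proof -
      have "dint k t \<in> dyadic_level k" "dint k' t' \<in> dyadic_level k'"
        using t that(2) grid by (auto intro!: dint_in_dyadic_level)
      then have [simp]: "k' = k"
        using dyadic_level_unique that(3) by metis
      have "t \<in> dint k t'"
        using dint_self[of t k] that(3) by simp
      then have "a n t = a n t'" if "n \<le> k" for n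
        using a_cong[OF \<open>t' \<in> grid N\<close> _ that] by blast
      then have "(\<exists>n\<le>k. L < a n t) \<longleftrightarrow> (\<exists>n\<le>k. L < a n t')" "(\<forall>n\<le>k. a n t \<le> 4 * L) \<longleftrightarrow> (\<forall>n\<le>k. a n t' \<le> 4 * L)"
        by auto
      then show ?thesis
        using that(3,4) by (simp add: Q_def)
    qed
    then have "(\<exists>k'<N. \<exists>t'\<in>grid N. dint k t = dint k' t' \<and> Q k' t') \<longleftrightarrow> Q k t"
      using t k by blast
    then show ?thesis
      by (simp add: haar_path_def y_def)
  qed
  have upper: "\<nu>2 (haar_path y t) powr r \<le> (6 * \<delta> * L) powr r * of_bool (L < u t)" if t: "t \<in> grid N" for t
  proof (cases "\<exists>k<N. Q k t")
    case False
    then have "\<nu>2 (haar_path y t) = \<nu>2 (\<lambda>k. 0)"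
      by (intro n2.cong) (simp add: y[OF t])
    then show ?thesis
      using r by simp
  next
    case True
    define b where "b = Max {k. k < N \<and> Q k t}"
    have fin: "finite {k. k < N \<and> Q k t}"
      by simp
    have b: "b < N" "Q b t" and b_max: "k \<le> b" if "k < N" "Q k t" for k
    proof -
      have "b \<in> {k. k < N \<and> Q k t}"
        unfolding b_def using True by (intro Max_in) auto
      then show "b < N" "Q b t"
        by auto
      show "k \<le> b"
        unfolding b_def using that by (intro Max_ge) auto
    qed
    obtain k1 where k1: "k1 < N" "Q k1 t"
      using True by blast
    note b = b[OF k1]
    define c where "c = (LEAST k. Q k t)"
    have c: "Q c t" and c_le: "\<And>k. Q k t \<Longrightarrow> c \<le> k"
      unfolding c_def using k1(2) by (auto intro: LeastI Least_le)
    have Q_iff: "Q k t \<longleftrightarrow> c \<le> k \<and> k \<le> b" if k: "k < N" for k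
    proof
      assume ck: "c \<le> k \<and> k \<le> b"
      have "\<exists>s\<in>dint k t \<inter> grid N. g s \<le> \<delta> * L"
        using b(2) ck dint_antimono[of k b] unfolding Q_def by blast
      moreover have "\<exists>n\<le>k. L < a n t"
        using c ck unfolding Q_def by (meson order_trans)
      moreover have "\<forall>n\<le>k. a n t \<le> 4 * L"
        using b(2) ck unfolding Q_def by auto
      ultimately show "Q k t"
        unfolding Q_def by blast
    qed (use c_le b_max k in blast)
    have "c \<le> b"
      using c_le b by blast
    obtain s where s: "s \<in> dint b t" "s \<in> grid N" "g s \<le> \<delta> * L"
      using b(2) unfolding Q_def by blast
    have le: "\<nu>2 (trunc n (haar_path x t)) \<le> 3 * (\<delta> * L)" if "n \<le> Suc b" for n
      using n2.trunc_Suc_le_pmax[OF grid[OF t] s(1) b(1) that, of x] s(3) by (simp add: g_def)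
    have "\<nu>2 (haar_path y t) = \<nu>2 (\<lambda>k. trunc (Suc b) (haar_path x t) k - trunc c (haar_path x t) k)"
      using \<open>c \<le> b\<close> by (intro n2.cong) (auto simp: y[OF t] Q_iff trunc_def)
    also have "\<dots> \<le> \<nu>2 (trunc (Suc b) (haar_path x t)) + \<nu>2 (trunc c (haar_path x t))"
      by (rule n2.triangle_diff)
    also have "\<dots> \<le> 6 * \<delta> * L"
      using le[of "Suc b"] le[of c] \<open>c \<le> b\<close> by simp
    finally have "\<nu>2 (haar_path y t) powr r \<le> (6 * \<delta> * L) powr r"
      using r n2.nonneg by (intro powr_mono2) auto
    moreover have "L < u t"
      unfolding u_gr using b unfolding Q_def by (meson less_imp_le order_trans)
    ultimately show ?thesis
      by simp
  qed
  have lower: "L powr r * of_bool (4 * L < u t) \<le> L powr r * of_bool (\<delta> * L < g t) + \<nu>1 (haar_path y t) powr r"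
    if t: "t \<in> grid N" for t
  proof (cases "4 * L < u t \<and> \<not> \<delta> * L < g t")
    case True
    define b where "b = (LEAST n. 4 * L < a n t)"
    define c where "c = (LEAST n. L < a n t)"
    obtain n where n: "n \<le> N" "4 * L < a n t"
      using True u_gr by blast
    have b: "4 * L < a b t" "b \<le> N" and b_least: "\<And>n. n < b \<Longrightarrow> \<not> 4 * L < a n t"
      unfolding b_def using n by (auto intro: LeastI Least_le order_trans dest: not_less_Least)
    have "L < a b t"
      using b L by simp
    then have c: "L < a c t" "c \<le> b" and c_least: "\<And>n. n < c \<Longrightarrow> \<not> L < a n t"
      unfolding c_def by (auto intro: LeastI Least_le dest: not_less_Least)
    have "a 0 t = 0"
      by (simp add: a_def)
    then have "c \<noteq> 0"
      using c L by (metis less_asym)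
    then obtain c' where c': "c = Suc c'"
      using not0_implies_Suc by blast
    have "a c t \<le> a c' t + norm (haar_path x t c')"
      unfolding a_def c' using c' c b by (intro n1.trunc_Suc_le) auto
    also have "norm (haar_path x t c') \<le> 2 * g t"
      unfolding g_def using c' c b by (intro n2.norm_le_pmax) auto
    also have "a c' t \<le> L"
      using c_least[of c'] c' by simp
    also have "g t \<le> L / 2"
      using True mult_right_mono[OF \<delta>(2), of L] L by linarith
    \<comment> \<open>The path norm crosses \<open>L\<close> by a jump of size at most \<open>2 * \<delta> * L \<le> L\<close>, hence below \<open>4 * L\<close>.\<close>
    finally have ac: "a c t \<le> 2 * L"
      by simp
    then have "c < b"
      using b c L by (metis le_neq_implies_less less_le_trans linorder_not_le mult_less_cancel_right_disj not_less numeral_less_iff semiring_norm(77,78,76,75) order.strict_trans)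
    have Q_iff: "Q k t \<longleftrightarrow> c \<le> k \<and> k < b" for k
    proof
      assume "Q k t"
      then have "\<exists>n\<le>k. L < a n t" "\<forall>n\<le>k. a n t \<le> 4 * L"
        unfolding Q_def by auto
      then show "c \<le> k \<and> k < b"
        using c_least b(1) by (metis le_less_linear less_le_trans linorder_not_less)
    next
      assume "c \<le> k \<and> k < b"
      then show "Q k t"
        unfolding Q_def using True t c b_least by (force simp: not_less)
    qed
    have "a b t \<le> \<nu>1 (haar_path y t) + a c t"
    proof -
      have "a b t = \<nu>1 (\<lambda>k. haar_path y t k + trunc c (haar_path x t) k)"
        unfolding a_def using \<open>c < b\<close> b(2) by (intro n1.cong) (auto simp: y[OF t] Q_iff trunc_def)
      then show ?thesis
        using n1.triangle by (simp add: a_def)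
    qed
    then have "L \<le> \<nu>1 (haar_path y t)"
      using ac b(1) L by linarith
    then have "L powr r \<le> \<nu>1 (haar_path y t) powr r"
      using r L by (intro powr_mono2) auto
    then show ?thesis
      using True by simp
  qed auto
  have "L powr r * (\<Sum>t\<in>grid N. of_bool (4 * L < u t))
      \<le> L powr r * (\<Sum>t\<in>grid N. of_bool (\<delta> * L < g t)) + (\<Sum>t\<in>grid N. \<nu>1 (haar_path y t) powr r)"
    unfolding sum_distrib_left sum.distrib[symmetric] by (intro sum_mono lower)
  also have "(\<Sum>t\<in>grid N. \<nu>1 (haar_path y t) powr r) \<le> C * (\<Sum>t\<in>grid N. \<nu>2 (haar_path y t) powr r)"
    by (rule loc)
  also have "\<dots> \<le> C * (\<Sum>t\<in>grid N. (6 * \<delta> * L) powr r * of_bool (L < u t))"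
    using C by (intro mult_left_mono sum_mono upper)
  also have "\<dots> = L powr r * (C * (6 * \<delta>) powr r * (\<Sum>t\<in>grid N. of_bool (L < u t)))"
    by (simp add: powr_mult flip: sum_distrib_left)
  finally have "L powr r * (\<Sum>t\<in>grid N. of_bool (4 * L < u t))
      \<le> L powr r * ((\<Sum>t\<in>grid N. of_bool (\<delta> * L < g t)) + C * (6 * \<delta>) powr r * (\<Sum>t\<in>grid N. of_bool (L < u t)))"
    by (simp add: distrib_left)
  then show ?thesis
    using L by (simp add: u_def g_def)
qed

text \<open>Small enough for the last term of the good-\<open>\<lambda>\<close> inequality to be
absorbed.\<close>

definition good_lambda_threshold :: "real \<Rightarrow> real \<Rightarrow> real \<Rightarrow> real" where
  "good_lambda_threshold r p C = min (1 / 2) ((1 / (2 * 4 powr p * (C + 1))) powr (1 / r) / 6)"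

definition extrapolation_const :: "real \<Rightarrow> real \<Rightarrow> real \<Rightarrow> real" where
  "extrapolation_const r p C = 2 * 4 powr (2 * p) / (good_lambda_threshold r p C powr p * (1 - 2 powr (- 2 * p)))"

lemma extrapolation_const_nonneg:
  assumes "0 < p"
  shows "0 \<le> extrapolation_const r p C"
proof -
  have "(2::real) powr (- 2 * p) < 1"
    using assms by (auto simp: powr_less_one)
  then show ?thesis
    by (simp add: extrapolation_const_def)
qed

text \<open>One exponent suffices: a comparison of two path norms in \<open>L^r\<close>, valid for all Haar
sums, implies a comparison with the maximal function in every \<open>L^p\<close>, upwards and downwards.\<close>

lemma path_norm_extrapolation:
  fixes x :: "real set \<Rightarrow> 'a::real_normed_vector"
  assumes r: "0 < r" and p: "0 < p" and C: "0 \<le> C" and n1: "path_norm N \<nu>1" and n2: "path_norm N \<nu>2"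
    and loc: "\<And>x. (\<Sum>t\<in>grid N. \<nu>1 (haar_path x t) powr r) \<le> C * (\<Sum>t\<in>grid N. \<nu>2 (haar_path x t) powr r)"
  shows "(\<Sum>t\<in>grid N. \<nu>1 (haar_path x t) powr p)
    \<le> extrapolation_const r p C * (\<Sum>t\<in>grid N. pmax N \<nu>2 (haar_path x t) powr p)"
proof -
  define e where "e = 1 / (2 * 4 powr p * (C + 1))"
  have e: "0 < e"
    using C by (simp add: e_def)
  define \<delta> where "\<delta> = good_lambda_threshold r p C"
  have \<delta>: "0 < \<delta>" "\<delta> \<le> 1 / 2" "6 * \<delta> \<le> e powr (1 / r)"
    using e by (auto simp: \<delta>_def good_lambda_threshold_def e_def min_def)
  have "(6 * \<delta>) powr r \<le> (e powr (1 / r)) powr r"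
    using \<delta> r by (intro powr_mono2) auto
  then have "(6 * \<delta>) powr r \<le> e"
    using r e by (simp add: powr_powr)
  then have "4 powr p * (C * (6 * \<delta>) powr r) \<le> 4 powr p * (C * e)"
    using C by (intro mult_left_mono) auto
  also have "4 powr p * (C * e) = C / (2 * (C + 1))"
    by (simp add: e_def)
  also have "\<dots> \<le> 1 / 2"
    using C by (simp add: field_simps)
  finally have small: "4 powr p * (C * (6 * \<delta>) powr r) \<le> 1 / 2" .
  interpret n1: path_norm N \<nu>1 by (rule n1)
  interpret n2: path_norm N \<nu>2 by (rule n2)
  have "\<nu>1 y \<le> pmax N \<nu>1 y" for y
    using n1.trunc_le_pmax[OF order_refl, of N y] by (simp add: n1.trunc_N)
  then have "(\<Sum>t\<in>grid N. \<nu>1 (haar_path x t) powr p) \<le> (\<Sum>t\<in>grid N. pmax N \<nu>1 (haar_path x t) powr p)"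
    using p n1.nonneg by (intro sum_mono powr_mono2) auto
  also have "\<dots> \<le> extrapolation_const r p C * (\<Sum>t\<in>grid N. pmax N \<nu>2 (haar_path x t) powr p)"
    unfolding extrapolation_const_def \<delta>_def[symmetric]
  proof (rule good_lambda_imp_Lp)
    fix L :: real assume L: "0 < L"
    let ?u = "\<Sum>t\<in>grid N. of_bool (L < pmax N \<nu>1 (haar_path x t)) :: real"
    have "4 powr p * (\<Sum>t\<in>grid N. of_bool (4 * L < pmax N \<nu>1 (haar_path x t)))
        \<le> 4 powr p * ((\<Sum>t\<in>grid N. of_bool (\<delta> * L < pmax N \<nu>2 (haar_path x t))) + C * (6 * \<delta>) powr r * ?u)"
      by (intro mult_left_mono good_lambda[OF n1 n2 loc r C \<delta>(1,2) L]) simp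
    also have "\<dots> = 4 powr p * (\<Sum>t\<in>grid N. of_bool (\<delta> * L < pmax N \<nu>2 (haar_path x t)))
        + 4 powr p * (C * (6 * \<delta>) powr r) * ?u"
      by (simp add: algebra_simps)
    also have "4 powr p * (C * (6 * \<delta>) powr r) * ?u \<le> (1 / 2) * ?u"
      using small by (intro mult_right_mono sum_nonneg) simp_all
    finally show "4 powr p * (\<Sum>t\<in>grid N. of_bool (4 * L < pmax N \<nu>1 (haar_path x t)))
        \<le> 4 powr p * (\<Sum>t\<in>grid N. of_bool (\<delta> * L < pmax N \<nu>2 (haar_path x t))) + (1 / 2) * ?u"
      by simp
  qed (use p \<delta> n1.pmax_nonneg n2.pmax_nonneg in auto)
  finally show ?thesis .
qed

section \<open>Rademacher averages and the UMD property\<close>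

text \<open>Invariance under single sign changes gives the contraction principle, and thereby monotonicity under
the removal of intervals.\<close>

locale sign_invariant_path_norm = path_norm +
  assumes flip: "\<nu> (y(k := - y k)) = \<nu> y"
begin

text \<open>Multiplication of one entry by \<open>c\<close> is the convex combination of the identity and a sign
change with weights \<open>(1 + c) / 2\<close> and \<open>(1 - c) / 2\<close>.\<close>

lemma contraction_single:
  assumes "\<bar>c\<bar> \<le> 1"
  shows "\<nu> (y(k := c *\<^sub>R y k)) \<le> \<nu> y"
proof -
  have "y(k := c *\<^sub>R y k) = (\<lambda>i. ((1 + c) / 2) *\<^sub>R y i + ((1 - c) / 2) *\<^sub>R (y(k := - y k)) i)"
  proof
    fix i
    have "((1 + c) / 2) *\<^sub>R v + ((1 - c) / 2) *\<^sub>R v = v" "((1 + c) / 2) *\<^sub>R v + ((1 - c) / 2) *\<^sub>R - v = c *\<^sub>R v" for v :: 'a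
    proof -
      have "((1 + c) / 2) *\<^sub>R v + ((1 - c) / 2) *\<^sub>R v = ((1 + c) / 2 + (1 - c) / 2) *\<^sub>R v"
        by (simp only: scaleR_left_distrib)
      moreover have "((1 + c) / 2) *\<^sub>R v + ((1 - c) / 2) *\<^sub>R - v = ((1 + c) / 2 - (1 - c) / 2) *\<^sub>R v"
        by (simp only: scaleR_left_diff_distrib scaleR_minus_right add_uminus_conv_diff)
      moreover have "(1 + c) / 2 + (1 - c) / 2 = 1" "(1 + c) / 2 - (1 - c) / 2 = c"
        by (simp_all add: field_simps)
      ultimately show "((1 + c) / 2) *\<^sub>R v + ((1 - c) / 2) *\<^sub>R v = v" "((1 + c) / 2) *\<^sub>R v + ((1 - c) / 2) *\<^sub>R - v = c *\<^sub>R v"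
        by simp_all
    qed
    then show "(y(k := c *\<^sub>R y k)) i = ((1 + c) / 2) *\<^sub>R y i + ((1 - c) / 2) *\<^sub>R (y(k := - y k)) i"
      by simp
  qed
  then have "\<nu> (y(k := c *\<^sub>R y k)) \<le> \<bar>(1 + c) / 2\<bar> * \<nu> y + \<bar>(1 - c) / 2\<bar> * \<nu> y"
    using triangle[of "\<lambda>i. ((1 + c) / 2) *\<^sub>R y i" "\<lambda>i. ((1 - c) / 2) *\<^sub>R (y(k := - y k)) i"]
    by (simp only: scale flip)
  also have "\<dots> = \<nu> y"
    using assms by (simp add: field_simps)
  finally show ?thesis .
qed

lemma contraction:
  assumes c: "\<And>k. k < N \<Longrightarrow> \<bar>c k\<bar> \<le> 1"
  shows "\<nu> (\<lambda>k. c k *\<^sub>R y k) \<le> \<nu> y"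
proof -
  have "\<nu> (\<lambda>k. if k < m then c k *\<^sub>R y k else y k) \<le> \<nu> y" if "m \<le> N" for m
    using that
  proof (induction m)
    case (Suc m)
    let ?z = "\<lambda>k. if k < m then c k *\<^sub>R y k else y k"
    have eq: "(\<lambda>k. if k < Suc m then c k *\<^sub>R y k else y k) = ?z(m := c m *\<^sub>R ?z m)"
      by (auto simp: less_Suc_eq)
    have "\<nu> (?z(m := c m *\<^sub>R ?z m)) \<le> \<nu> ?z"
      using c Suc.prems by (intro contraction_single) auto
    then show ?case
      unfolding eq using Suc by simp
  qed simp
  from this[of N] have "\<nu> (\<lambda>k. if k < N then c k *\<^sub>R y k else y k) \<le> \<nu> y"
    by simp
  also have "\<nu> (\<lambda>k. if k < N then c k *\<^sub>R y k else y k) = \<nu> (\<lambda>k. c k *\<^sub>R y k)"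
    by (rule cong) simp
  finally show ?thesis .
qed

lemma trunc_le: "\<nu> (trunc n y) \<le> \<nu> y"
proof -
  have "trunc n y = (\<lambda>k. of_bool (k < n) *\<^sub>R y k)"
    by (auto simp: trunc_def)
  then show ?thesis
    using contraction[of "\<lambda>k. of_bool (k < n)" y] by simp
qed

lemma pmax_eq: "pmax N \<nu> y = \<nu> y"
proof (rule antisym)
  show "pmax N \<nu> y \<le> \<nu> y"
    unfolding pmax_def using trunc_le by (intro Max.boundedI) auto
  show "\<nu> y \<le> pmax N \<nu> y"
    using trunc_le_pmax[of N N y] by (simp add: trunc_N)
qed

end

lemma path_norm_sum: "path_norm N (\<lambda>y :: nat \<Rightarrow> 'a::real_normed_vector. norm (\<Sum>k<N. y k))"
proof
  fix y z :: "nat \<Rightarrow> 'a" and c :: real and k :: nat and v :: 'a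
  show "norm (\<Sum>k<N. y k) = norm (\<Sum>k<N. z k)" if "\<And>k. k < N \<Longrightarrow> y k = z k"
    using that by simp
  show "norm (\<Sum>k<N. y k + z k) \<le> norm (\<Sum>k<N. y k) + norm (\<Sum>k<N. z k)"
    by (simp add: sum.distrib norm_triangle_ineq)
  show "norm (\<Sum>k<N. c *\<^sub>R y k) = \<bar>c\<bar> * norm (\<Sum>k<N. y k)"
    by (simp flip: scaleR_sum_right)
  show "norm (\<Sum>i<N. if i = k then v else 0) = norm v" if "k < N"
    using that by simp
qed

definition rsign :: "nat set \<Rightarrow> nat \<Rightarrow> real" where
  "rsign S k = (if k \<in> S then - 1 else 1)"

text \<open>The moment \<open>(\<bbbE> |\<Sum> \<epsilon>\<^sub>k y\<^sub>k|^s)^(1/s)\<close> with independent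
random signs. A sign pattern is encoded by the set of indices with negative sign, so the expectation is the
average over all subsets. One sign per level is enough: at a fixed point only one interval of each level is
active, so these averages have the same distribution as those with one sign per interval.\<close>

definition rad_norm :: "real \<Rightarrow> nat \<Rightarrow> (nat \<Rightarrow> 'a::real_normed_vector) \<Rightarrow> real" where
  "rad_norm s N y = ((\<Sum>S\<in>Pow {..<N}. norm (\<Sum>k<N. rsign S k *\<^sub>R y k) powr s) / 2 ^ N) powr (1 / s)"

lemma rad_norm_powr:
  assumes "0 < s"
  shows "rad_norm s N y powr s = (\<Sum>S\<in>Pow {..<N}. norm (\<Sum>k<N. rsign S k *\<^sub>R y k) powr s) / 2 ^ N"
proof -
  have "0 \<le> (\<Sum>S\<in>Pow {..<N}. norm (\<Sum>k<N. rsign S k *\<^sub>R y k) powr s)"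
    by (intro sum_nonneg) simp
  then show ?thesis
    unfolding rad_norm_def powr_powr using assms by simp
qed

lemma sign_invariant_rad_norm:
  assumes s: "1 \<le> s"
  shows "sign_invariant_path_norm N (rad_norm s N :: (nat \<Rightarrow> 'a::real_normed_vector) \<Rightarrow> real)"
proof
  fix y z :: "nat \<Rightarrow> 'a" and c :: real and k :: nat and v :: 'a
  show "rad_norm s N y = rad_norm s N z" if "\<And>k. k < N \<Longrightarrow> y k = z k"
    using that by (simp add: rad_norm_def)
  show "rad_norm s N (\<lambda>k. y k + z k) \<le> rad_norm s N y + rad_norm s N z"
  proof -
    let ?A = "\<lambda>y S. norm (\<Sum>k<N. rsign S k *\<^sub>R y k)"
    have "(\<Sum>S\<in>Pow {..<N}. ?A (\<lambda>k. y k + z k) S powr s) powr (1 / s)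
        \<le> (\<Sum>S\<in>Pow {..<N}. (?A y S + ?A z S) powr s) powr (1 / s)"
      using s by (intro powr_mono2 sum_mono) (auto intro!: sum_nonneg simp: scaleR_right_distrib sum.distrib norm_triangle_ineq)
    also have "\<dots> \<le> (\<Sum>S\<in>Pow {..<N}. ?A y S powr s) powr (1 / s) + (\<Sum>S\<in>Pow {..<N}. ?A z S powr s) powr (1 / s)"
      by (rule minkowski_sum_powr[OF s]) auto
    finally show ?thesis
      by (simp add: rad_norm_def powr_divide divide_right_mono flip: add_divide_distrib)
  qed
  show "rad_norm s N (\<lambda>k. c *\<^sub>R y k) = \<bar>c\<bar> * rad_norm s N y"
  proof -
    have "(\<Sum>k<N. rsign S k *\<^sub>R c *\<^sub>R y k) = c *\<^sub>R (\<Sum>k<N. rsign S k *\<^sub>R y k)" for S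
      by (simp add: scaleR_sum_right mult.commute)
    then have "rad_norm s N (\<lambda>k. c *\<^sub>R y k)
        = (\<bar>c\<bar> powr s * ((\<Sum>S\<in>Pow {..<N}. norm (\<Sum>k<N. rsign S k *\<^sub>R y k) powr s) / 2 ^ N)) powr (1 / s)"
      by (simp add: rad_norm_def powr_mult flip: sum_distrib_left)
    also have "\<dots> = (\<bar>c\<bar> powr s) powr (1 / s) * rad_norm s N y"
      unfolding rad_norm_def by (rule powr_mult)
    also have "(\<bar>c\<bar> powr s) powr (1 / s) = \<bar>c\<bar>"
      using s by (simp add: powr_powr)
    finally show ?thesis .
  qed
  show "rad_norm s N (\<lambda>i. if i = k then v else 0) = norm v" if "k < N"
  proof -
    have "norm (\<Sum>i<N. rsign S i *\<^sub>R (if i = k then v else 0)) = norm v" for S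
    proof -
      have "(\<Sum>i<N. rsign S i *\<^sub>R (if i = k then v else 0)) = (\<Sum>i<N. if i = k then rsign S i *\<^sub>R v else 0)"
        by (intro sum.cong) auto
      also have "\<dots> = rsign S k *\<^sub>R v"
        using that by simp
      finally show ?thesis
        by (simp add: rsign_def)
    qed
    then show ?thesis
      using s by (simp add: rad_norm_def card_Pow powr_powr)
  qed
  show "rad_norm s N (y(k := - y k)) = rad_norm s N y"
  proof (cases "k < N")
    case False
    then show ?thesis
      by (simp add: rad_norm_def)
  next
    case True
    let ?f = "\<lambda>S. if k \<in> S then S - {k} else insert k S"
    define h where "h S = norm (\<Sum>i<N. rsign S i *\<^sub>R y i) powr s" for S
    have bij: "bij_betw ?f (Pow {..<N}) (Pow {..<N})"
      by (rule bij_betwI[where g = ?f]) (use True in \<open>auto split: if_splits\<close>)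
    have "rsign (?f S) i *\<^sub>R y i = rsign S i *\<^sub>R (y(k := - y k)) i" for i S
      by (cases "i = k") (simp_all add: rsign_def)
    then have "norm (\<Sum>i<N. rsign S i *\<^sub>R (y(k := - y k)) i) powr s = h (?f S)" for S
      unfolding h_def by (simp only:)
    then have "(\<Sum>S\<in>Pow {..<N}. norm (\<Sum>i<N. rsign S i *\<^sub>R (y(k := - y k)) i) powr s) = (\<Sum>S\<in>Pow {..<N}. h S)"
      using sum.reindex_bij_betw[OF bij, of h] by (simp only:)
    then have "rad_norm s N (y(k := - y k)) = ((\<Sum>S\<in>Pow {..<N}. h S) / 2 ^ N) powr (1 / s)"
      unfolding rad_norm_def by (simp only:)
    then show ?thesis
      unfolding rad_norm_def h_def .
  qed
qed

lemma sum_grid_rad_norm: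
  assumes "0 < s"
  shows "(\<Sum>t\<in>grid M. rad_norm s N (y t) powr s)
    = (\<Sum>S\<in>Pow {..<N}. \<Sum>t\<in>grid M. norm (\<Sum>k<N. rsign S k *\<^sub>R y t k) powr s) / 2 ^ N"
  unfolding rad_norm_powr[OF assms] sum_divide_distrib[symmetric] by (subst sum.swap) simp

lemma space_dyadic_sigma: "space (dyadic_sigma k) = {0..<1}"
  and sets_dyadic_sigma: "sets (dyadic_sigma k) = sigma_sets {0..<1} (dyadic_level k)"
proof -
  have "dyadic_level k \<subseteq> Pow {0..<1}"
    using dyadic_level_subset by blast
  then show "space (dyadic_sigma k) = {0..<1}" "sets (dyadic_sigma k) = sigma_sets {0..<1} (dyadic_level k)"
    by (auto simp: dyadic_sigma_def)
qed

text \<open>A set in the \<open>k\<close>-th dyadic \<open>\<sigma>\<close>-algebra is a union of intervals of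
level \<open>k\<close>.\<close>

lemma dyadic_sigma_saturated:
  assumes "A \<in> sets (dyadic_sigma k)" "0 \<le> t" "t < 1" "s \<in> dint k t"
  shows "s \<in> A \<longleftrightarrow> t \<in> A"
  using assms(1) unfolding sets_dyadic_sigma
proof (induction A rule: sigma_sets.induct)
  case (Basic I)
  then show ?case
    using dyadic_level_eq_dint[of I k t] dyadic_level_eq_dint[of I k s] assms(4)
    by (metis dint_eq_iff dint_self)
next
  case (Compl A)
  have "s \<in> {0..<1}"
    using dyadic_level_subset[OF dint_in_dyadic_level[OF assms(2,3)]] assms(4) by blast
  then show ?case
    using Compl assms(2,3) by auto
qed auto

lemma measurable_dyadic_sigma:
  assumes f: "\<And>s t. 0 \<le> t \<Longrightarrow> t < 1 \<Longrightarrow> s \<in> dint k t \<Longrightarrow> f s = f t"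
  shows "f \<in> measurable (dyadic_sigma k) borel"
proof (rule measurableI)
  fix B
  have "f -` B \<inter> {0..<1} = (\<Union>t\<in>{t\<in>grid k. f t \<in> B}. dint k t)"
  proof (intro equalityI subsetI)
    fix t assume t: "t \<in> f -` B \<inter> {0..<1}"
    let ?s = "of_int \<lfloor>2 ^ k * t\<rfloor> / 2 ^ k :: real"
    have s: "?s \<in> grid k" "?s \<in> dint k t"
      using floor_point_grid[of t k] t by auto
    then have "f ?s = f t" "t \<in> dint k ?s"
      using f[of t ?s] t by (auto simp: mem_dint_iff)
    then show "t \<in> (\<Union>t\<in>{t\<in>grid k. f t \<in> B}. dint k t)"
      using t s by auto
  next
    fix t assume "t \<in> (\<Union>t\<in>{t\<in>grid k. f t \<in> B}. dint k t)"
    then obtain s where s: "s \<in> grid k" "f s \<in> B" "t \<in> dint k s"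
      by blast
    then have "0 \<le> s" "s < 1"
      by (auto simp: mem_grid_iff)
    then show "t \<in> f -` B \<inter> {0..<1}"
      using s f[of s t] dyadic_level_subset[OF dint_in_dyadic_level, of s k] by auto
  qed
  also have "\<dots> \<in> sets (dyadic_sigma k)"
  proof (intro sets.finite_UN)
    fix t assume "t \<in> {t\<in>grid k. f t \<in> B}"
    then show "dint k t \<in> sets (dyadic_sigma k)"
      unfolding sets_dyadic_sigma by (intro sigma_sets.Basic dint_in_dyadic_level) (auto simp: mem_grid_iff)
  qed simp
  finally show "f -` B \<inter> space (dyadic_sigma k) \<in> sets (dyadic_sigma k)"
    by (simp add: space_dyadic_sigma)
qed simp

lemma simple_bochner_integral_step_function:
  fixes f :: "real \<Rightarrow> 'a::real_normed_vector"
  assumes f: "\<And>s t. 0 \<le> t \<Longrightarrow> t < 1 \<Longrightarrow> s \<in> dint N t \<Longrightarrow> f s = f t"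
  shows "Bochner_Integration.simple_bochner_integrable unit_lborel f"
    and "Bochner_Integration.simple_bochner_integral unit_lborel f = (\<Sum>t\<in>grid N. (1 / 2 ^ N) *\<^sub>R f t)"
proof -
  define g where "g t = of_int \<lfloor>2 ^ N * t\<rfloor> / (2 ^ N :: real)" for t :: real
  have space: "space unit_lborel = {0..<1}"
    by (simp add: space_restrict_space)
  have g: "g t \<in> grid N" "g t \<in> dint N t" if "0 \<le> t" "t < 1" for t
    using floor_point_grid[OF that] by (auto simp: g_def)
  have fg: "f (g t) = f t" if "0 \<le> t" "t < 1" for t
    using f that g by blast
  have gs: "g s = s" if "s \<in> grid N" for s
    using dint_grid_unique[OF that dint_self] by (simp add: g_def)
  have img: "g ` space unit_lborel = grid N"
  proof (intro equalityI subsetI)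
    fix s assume s: "s \<in> grid N"
    then have "s \<in> {0..<1}"
      by (simp add: mem_grid_iff)
    then show "s \<in> g ` space unit_lborel"
      unfolding space using gs[OF s] by (metis imageI)
  qed (use g space in auto)
  have pre: "{t \<in> space unit_lborel. g t = s} = dint N s" if s: "s \<in> grid N" for s
  proof -
    have "g t = s \<longleftrightarrow> t \<in> dint N s" if "0 \<le> t" "t < 1" for t
      using g[OF that] s gs[OF s] by (metis dint_eq_iff dint_self g_def mem_dint_iff)
    moreover have "dint N s \<subseteq> {0..<1}"
      using s by (intro dyadic_level_subset[OF dint_in_dyadic_level]) (auto simp: mem_grid_iff)
    ultimately show ?thesis
      unfolding space by auto
  qed
  have meas: "dint N s \<in> sets unit_lborel" if "s \<in> grid N" for s
  proof -
    have "dint N s \<subseteq> {0..<1}"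
      using that by (intro dyadic_level_subset[OF dint_in_dyadic_level]) (auto simp: mem_grid_iff)
    then show ?thesis
      by (auto simp: sets_restrict_space_iff dint_def)
  qed
  have sg: "simple_function unit_lborel g"
    unfolding simple_function_def img
  proof (intro conjI ballI)
    fix s assume "s \<in> grid N"
    then show "g -` {s} \<inter> space unit_lborel \<in> sets unit_lborel"
      using pre[of s] meas[of s] by (simp add: vimage_def Int_def conj_commute)
  qed simp
  have "simple_function unit_lborel (\<lambda>t. f (g t))"
    by (rule simple_function_compose1[OF sg])
  then have sf: "simple_function unit_lborel f"
    by (rule simple_function_cong[THEN iffD1, rotated]) (simp add: fg)
  have "emeasure unit_lborel {t \<in> space unit_lborel. f t \<noteq> 0} \<le> emeasure unit_lborel (space unit_lborel)"
    by (rule emeasure_space)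
  also have "\<dots> = 1"
    by (simp add: space emeasure_restrict_space)
  finally have "emeasure unit_lborel {t \<in> space unit_lborel. f t \<noteq> 0} \<noteq> \<infinity>"
    by (auto simp: top_unique)
  with sf show integrable: "Bochner_Integration.simple_bochner_integrable unit_lborel f"
    by (rule simple_bochner_integrable.intros)
  have "Bochner_Integration.simple_bochner_integral unit_lborel f
      = (\<Sum>s\<in>g ` space unit_lborel. measure unit_lborel {t \<in> space unit_lborel. g t = s} *\<^sub>R f s)"
    using integrable sg
  proof (rule simple_bochner_integral_partition)
    fix s t assume "s \<in> space unit_lborel" "t \<in> space unit_lborel" "g s = g t"
    then show "f s = f t"
      using fg by (metis atLeastLessThan_iff space)
  next
    fix t assume "t \<in> space unit_lborel"
    then show "f t = f (g t)"
      by (simp add: fg space)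
  qed
  also have "\<dots> = (\<Sum>t\<in>grid N. (1 / 2 ^ N) *\<^sub>R f t)"
    unfolding img
  proof (rule sum.cong)
    fix s assume s: "s \<in> grid N"
    have lev: "dint N s \<in> dyadic_level N"
      using s by (intro dint_in_dyadic_level) (auto simp: mem_grid_iff)
    have "measure unit_lborel (dint N s) = measure lborel (dint N s)"
      using dyadic_level_subset[OF lev] by (intro measure_restrict_space) auto
    then show "measure unit_lborel {t \<in> space unit_lborel. g t = s} *\<^sub>R f s = (1 / 2 ^ N) *\<^sub>R f s"
      unfolding pre[OF s] using measure_dyadic_level(1)[OF lev] by simp
  qed simp
  finally show "Bochner_Integration.simple_bochner_integral unit_lborel f = (\<Sum>t\<in>grid N. (1 / 2 ^ N) *\<^sub>R f t)" .
qed

text \<open>The integral of a difference over a set of the preceding \<open>\<sigma>\<close>-algebra is replaced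
by a grid sum, which the sibling map turns into its negative.\<close>

lemma dyadic_mds_haar_path:
  fixes x :: "real set \<Rightarrow> 'a::banach"
  shows "dyadic_mds n (\<lambda>k t. e k *\<^sub>R haar_path x t (k - 1))"
  unfolding dyadic_mds_def
proof (intro ballI conjI)
  fix k assume "k \<in> {1..n}"
  then obtain m where k: "k = Suc m"
    by (cases k) auto
  have step: "e k *\<^sub>R haar_path x s (k - 1) = e k *\<^sub>R haar_path x t (k - 1)"
    if "0 \<le> t" "t < 1" "s \<in> dint k t" for s t
    using haar_path_cong[OF that, of m x] by (simp add: k)
  show "(\<lambda>t. e k *\<^sub>R haar_path x t (k - 1)) \<in> borel_measurable (dyadic_sigma k)"
    by (rule measurable_dyadic_sigma) (rule step)
  fix A assume A: "A \<in> sets (dyadic_sigma (k - 1))"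
  let ?f = "\<lambda>t. indicator A t *\<^sub>R e k *\<^sub>R haar_path x t (k - 1)"
  have "?f s = ?f t" if "0 \<le> t" "t < 1" "s \<in> dint k t" for s t
    using step[OF that] dyadic_sigma_saturated[OF A that(1,2) dint_antimono[OF _ that(3)]]
    by (simp add: indicator_def k)
  then have *: "Bochner_Integration.simple_bochner_integral unit_lborel ?f = (\<Sum>t\<in>grid k. (1 / 2 ^ k) *\<^sub>R ?f t)"
    by (rule simple_bochner_integral_step_function(2))
  have "(\<Sum>t\<in>grid k. (1 / 2 ^ k) *\<^sub>R ?f t) = (\<Sum>t\<in>grid k. (1 / 2 ^ k) *\<^sub>R ?f (sibling m t))"
    by (rule sum_sibling[symmetric]) (simp add: k)
  also have "\<dots> = (\<Sum>t\<in>grid k. - ((1 / 2 ^ k) *\<^sub>R ?f t))"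
  proof (rule sum.cong)
    fix t assume "t \<in> grid k"
    then have t: "0 \<le> t" "t < 1"
      by (auto simp: mem_grid_iff)
    have "indicator A (sibling m t) = (indicator A t :: real)"
      using dyadic_sigma_saturated[OF A t, of "sibling m t"] sibling_mem_dint[of m m t]
      by (simp add: indicator_def k)
    then show "(1 / 2 ^ k) *\<^sub>R ?f (sibling m t) = - ((1 / 2 ^ k) *\<^sub>R ?f t)"
      using haar_path_sibling[OF t, of x m] by (simp add: k)
  qed simp
  also have "\<dots> = - (\<Sum>t\<in>grid k. (1 / 2 ^ k) *\<^sub>R ?f t)"
    by (rule sum_negf)
  finally have "2 *\<^sub>R (\<Sum>t\<in>grid k. (1 / 2 ^ k) *\<^sub>R ?f t) = 0"
    by (simp only: scaleR_2 eq_neg_iff_add_eq_0)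
  then show "Bochner_Integration.simple_bochner_integral unit_lborel ?f = 0"
    unfolding * by simp
qed

lemma Lp_norm_step_function:
  assumes f: "\<And>s t. 0 \<le> t \<Longrightarrow> t < 1 \<Longrightarrow> s \<in> dint N t \<Longrightarrow> f s = f t"
  shows "Lp_norm p f = ((\<Sum>t\<in>grid N. norm (f t) powr p) / 2 ^ N) powr (1 / p)"
proof -
  have "norm (f s) powr p = norm (f t) powr p" if "0 \<le> t" "t < 1" "s \<in> dint N t" for s t
    by (simp only: f[OF that])
  note pw = this
  have "Bochner_Integration.simple_bochner_integrable unit_lborel (\<lambda>t. norm (f t) powr p)"
    by (rule simple_bochner_integral_step_function(1)[where N = N]) (rule pw)
  moreover have "Bochner_Integration.simple_bochner_integral unit_lborel (\<lambda>t. norm (f t) powr p)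
      = (\<Sum>t\<in>grid N. (1 / 2 ^ N) *\<^sub>R norm (f t) powr p)"
    by (rule simple_bochner_integral_step_function(2)) (rule pw)
  ultimately have "(\<integral>t. norm (f t) powr p \<partial>unit_lborel) = (\<Sum>t\<in>grid N. (1 / 2 ^ N) *\<^sub>R norm (f t) powr p)"
    by (simp only: simple_bochner_integrable_eq_integral)
  then show ?thesis
    by (simp add: Lp_norm_def flip: sum_divide_distrib)
qed

lemma Lp_norm_le_iff_sum_grid:
  assumes f: "\<And>s t. 0 \<le> t \<Longrightarrow> t < 1 \<Longrightarrow> s \<in> dint N t \<Longrightarrow> f s = f t"
    and g: "\<And>s t. 0 \<le> t \<Longrightarrow> t < 1 \<Longrightarrow> s \<in> dint N t \<Longrightarrow> g s = g t"
    and p: "0 < p" and c: "0 \<le> c"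
  shows "Lp_norm p f \<le> c * Lp_norm p g
    \<longleftrightarrow> (\<Sum>t\<in>grid N. norm (f t) powr p) \<le> c powr p * (\<Sum>t\<in>grid N. norm (g t) powr p)"
proof -
  define F G where "F = (\<Sum>t\<in>grid N. norm (f t) powr p)" and "G = (\<Sum>t\<in>grid N. norm (g t) powr p)"
  have FG: "0 \<le> F" "0 \<le> G"
    by (auto simp: F_def G_def intro!: sum_nonneg)
  have "c * (G / 2 ^ N) powr (1 / p) = (c powr p * G / 2 ^ N) powr (1 / p)"
    using p c by (simp add: powr_mult powr_divide powr_powr)
  moreover have "Lp_norm p f = (F / 2 ^ N) powr (1 / p)"
    unfolding F_def by (rule Lp_norm_step_function) (rule f)
  moreover have "Lp_norm p g = (G / 2 ^ N) powr (1 / p)"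
    unfolding G_def by (rule Lp_norm_step_function) (rule g)
  ultimately have "Lp_norm p f \<le> c * Lp_norm p g \<longleftrightarrow> (F / 2 ^ N) powr (1 / p) \<le> (c powr p * G / 2 ^ N) powr (1 / p)"
    by (simp only:)
  also have "\<dots> \<longleftrightarrow> F / 2 ^ N \<le> c powr p * G / 2 ^ N"
  proof
    assume "(F / 2 ^ N) powr (1 / p) \<le> (c powr p * G / 2 ^ N) powr (1 / p)"
    then have "((F / 2 ^ N) powr (1 / p)) powr p \<le> ((c powr p * G / 2 ^ N) powr (1 / p)) powr p"
      by (rule powr_mono2[rotated 2]) (use p in auto)
    then show "F / 2 ^ N \<le> c powr p * G / 2 ^ N"
      using p FG by (simp add: powr_powr)
  qed (use p FG in \<open>auto intro!: powr_mono2\<close>)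
  also have "\<dots> \<longleftrightarrow> F \<le> c powr p * G"
    by (simp add: field_simps)
  finally show ?thesis
    by (simp add: F_def G_def)
qed

text \<open>The UMD inequality is averaged over all sign patterns in one direction. In the other direction it is
applied to the differences with signs, multiplied once more by the same signs.\<close>

lemma UMD_space_rad_norm:
  assumes "UMD_space TYPE('a::banach)"
  obtains r c :: real where "1 < r" "0 < c"
    "\<And>N (x :: real set \<Rightarrow> 'a). (\<Sum>t\<in>grid N. rad_norm r N (haar_path x t) powr r)
      \<le> c * (\<Sum>t\<in>grid N. norm (\<Sum>k<N. haar_path x t k) powr r)"
    "\<And>N (x :: real set \<Rightarrow> 'a). (\<Sum>t\<in>grid N. norm (\<Sum>k<N. haar_path x t k) powr r)
      \<le> c * (\<Sum>t\<in>grid N. rad_norm r N (haar_path x t) powr r)"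
proof -
  obtain r c :: real where r: "1 < r" and c: "0 < c"
    and umd_all: "\<forall>n\<ge>1. \<forall>d :: nat \<Rightarrow> real \<Rightarrow> 'a. dyadic_mds n d \<longrightarrow>
      (\<forall>\<theta>. (\<forall>k\<in>{1..n}. \<theta> k \<in> {-1..1}) \<longrightarrow>
        Lp_norm r (\<lambda>t. \<Sum>k=1..n. \<theta> k *\<^sub>R d k t) \<le> c * Lp_norm r (\<lambda>t. \<Sum>k=1..n. d k t))"
    using assms unfolding UMD_space_def by (elim exE conjE) (rule that)
  note umd = umd_all[rule_format]
  have main: "(\<Sum>t\<in>grid N. norm (\<Sum>k<N. \<theta> k *\<^sub>R e k *\<^sub>R haar_path x t k) powr r)
      \<le> c powr r * (\<Sum>t\<in>grid N. norm (\<Sum>k<N. e k *\<^sub>R haar_path x t k) powr r)"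
    if \<theta>: "\<And>k. \<theta> k \<in> {-1..1}" for N \<theta> e and x :: "real set \<Rightarrow> 'a"
  proof (cases "N = 0")
    case False
    define d where "d = (\<lambda>k t. e (k - 1) *\<^sub>R haar_path x t (k - 1))"
    have shift: "(\<Sum>k=1..N. h (k - 1)) = (\<Sum>k<N. h k)" for h :: "nat \<Rightarrow> 'a"
      by (rule sum.reindex_bij_witness[where i = Suc and j = "\<lambda>k. k - 1"]) auto
    have "Lp_norm r (\<lambda>t. \<Sum>k=1..N. \<theta> (k - 1) *\<^sub>R d k t) \<le> c * Lp_norm r (\<lambda>t. \<Sum>k=1..N. d k t)"
      unfolding d_def using False \<theta> by (intro umd dyadic_mds_haar_path) auto
    then have "Lp_norm r (\<lambda>t. \<Sum>k<N. \<theta> k *\<^sub>R e k *\<^sub>R haar_path x t k) \<le> c * Lp_norm r (\<lambda>t. \<Sum>k<N. e k *\<^sub>R haar_path x t k)"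
      unfolding d_def shift[of "\<lambda>k. \<theta> k *\<^sub>R e k *\<^sub>R haar_path x _ k"] shift[of "\<lambda>k. e k *\<^sub>R haar_path x _ k"] .
    note umd_d = this
    have step: "(\<Sum>k<N. w k *\<^sub>R haar_path x s k) = (\<Sum>k<N. w k *\<^sub>R haar_path x t k)"
      if "0 \<le> t" "t < 1" "s \<in> dint N t" for w s t
      using haar_path_cong[OF that, of _ x] by (intro sum.cong refl) simp
    show ?thesis
    proof (rule Lp_norm_le_iff_sum_grid[THEN iffD1, OF _ _ _ _ umd_d])
      fix s t :: real assume st: "0 \<le> t" "t < 1" "s \<in> dint N t"
      show "(\<Sum>k<N. \<theta> k *\<^sub>R e k *\<^sub>R haar_path x s k) = (\<Sum>k<N. \<theta> k *\<^sub>R e k *\<^sub>R haar_path x t k)"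
        using step[OF st, of "\<lambda>k. \<theta> k * e k"] by (simp only: scaleR_scaleR)
      show "(\<Sum>k<N. e k *\<^sub>R haar_path x s k) = (\<Sum>k<N. e k *\<^sub>R haar_path x t k)"
        using step[OF st] .
    qed (use r c in auto)
  qed (use r in simp)
  have sg: "rsign S k \<in> {-1..1}" "rsign S k *\<^sub>R rsign S k *\<^sub>R v = v" for S k and v :: 'a
    by (auto simp: rsign_def)
  show thesis
  proof (rule that[of r "c powr r"])
    fix N and x :: "real set \<Rightarrow> 'a"
    let ?F = "(\<Sum>t\<in>grid N. norm (\<Sum>k<N. haar_path x t k) powr r)"
    let ?R = "\<lambda>S. \<Sum>t\<in>grid N. norm (\<Sum>k<N. rsign S k *\<^sub>R haar_path x t k) powr r"
    have "(\<Sum>S\<in>Pow {..<N}. ?R S) \<le> (\<Sum>S\<in>Pow {..<N}. c powr r * ?F)"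
    proof (rule sum_mono)
      fix S
      show "?R S \<le> c powr r * ?F"
        using main[where N = N and \<theta> = "rsign S" and e = "\<lambda>k. 1" and x = x] sg(1) by (simp only: scaleR_one)
    qed
    also have "\<dots> = 2 ^ N * (c powr r * ?F)"
      by (simp add: card_Pow)
    finally show "(\<Sum>t\<in>grid N. rad_norm r N (haar_path x t) powr r) \<le> c powr r * ?F"
      using r by (simp add: sum_grid_rad_norm field_simps)
    have "2 ^ N * ?F = (\<Sum>S\<in>Pow {..<N}. ?F)"
      by (simp add: card_Pow)
    also have "\<dots> \<le> (\<Sum>S\<in>Pow {..<N}. c powr r * ?R S)"
    proof (rule sum_mono)
      fix S
      show "?F \<le> c powr r * ?R S"
        using main[where N = N and \<theta> = "rsign S" and e = "rsign S" and x = x] sg(1) by (simp only: sg(2))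
    qed
    also have "\<dots> = c powr r * (\<Sum>S\<in>Pow {..<N}. ?R S)"
      by (simp add: sum_distrib_left)
    finally show "?F \<le> c powr r * (\<Sum>t\<in>grid N. rad_norm r N (haar_path x t) powr r)"
      using r by (simp add: sum_grid_rad_norm field_simps)
  qed (use r c in auto)
qed


text \<open>The maximal function on the right-hand side of the extrapolation is removed by Doob's inequality in
one direction, and by monotonicity of the Rademacher norm in the other.\<close>

lemma UMD_space_rad_norm_Lp:
  fixes p q :: real
  assumes umd: "UMD_space TYPE('a::banach)" and p: "1 < p" and q: "1 < q"
  obtains r c :: real where "1 < r" "0 < c"
    "\<And>N (x :: real set \<Rightarrow> 'a). (\<Sum>t\<in>grid N. rad_norm r N (haar_path x t) powr q)
      \<le> c * (\<Sum>t\<in>grid N. norm (\<Sum>k<N. haar_path x t k) powr q)"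
    "\<And>N (x :: real set \<Rightarrow> 'a). (\<Sum>t\<in>grid N. norm (\<Sum>k<N. haar_path x t k) powr p)
      \<le> c * (\<Sum>t\<in>grid N. rad_norm r N (haar_path x t) powr p)"
proof -
  obtain r c :: real where r: "1 < r" and c: "0 < c"
    and upper: "\<And>N (x :: real set \<Rightarrow> 'a). (\<Sum>t\<in>grid N. rad_norm r N (haar_path x t) powr r)
      \<le> c * (\<Sum>t\<in>grid N. norm (\<Sum>k<N. haar_path x t k) powr r)"
    and lower: "\<And>N (x :: real set \<Rightarrow> 'a). (\<Sum>t\<in>grid N. norm (\<Sum>k<N. haar_path x t k) powr r)
      \<le> c * (\<Sum>t\<in>grid N. rad_norm r N (haar_path x t) powr r)"
    using umd by (rule UMD_space_rad_norm) (rule that; assumption)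
  have rad: "sign_invariant_path_norm N (rad_norm r N :: (nat \<Rightarrow> 'a) \<Rightarrow> real)" for N
    using r by (intro sign_invariant_rad_norm) simp
  have rad': "path_norm N (rad_norm r N :: (nat \<Rightarrow> 'a) \<Rightarrow> real)" for N
    using rad[of N] by (simp add: sign_invariant_path_norm_def)
  have r0: "0 < r" and q0: "0 < q" and p0: "0 < p" and c0: "0 \<le> c"
    using r q p c by auto
  define D1 D2 where "D1 = extrapolation_const r q c" and "D2 = extrapolation_const r p c"
  have D: "0 \<le> D1" "0 \<le> D2"
    using p0 q0 by (auto simp: D1_def D2_def intro: extrapolation_const_nonneg)
  define K where "K = (2 * (q / (q - 1))) powr q"
  define C where "C = max (D1 * K) D2 + 1"
  have C: "0 < C" "D1 * K \<le> C" "D2 \<le> C"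
    using D by (auto simp: C_def)
  show thesis
  proof (rule that[OF r C(1)])
    fix N and x :: "real set \<Rightarrow> 'a"
    have "(\<Sum>t\<in>grid N. rad_norm r N (haar_path x t) powr q)
        \<le> D1 * (\<Sum>t\<in>grid N. pmax N (\<lambda>y. norm (\<Sum>k<N. y k)) (haar_path x t) powr q)"
      unfolding D1_def by (rule path_norm_extrapolation[OF r0 q0 c0 rad' path_norm_sum upper])
    also have "\<dots> \<le> D1 * (K * (\<Sum>t\<in>grid N. norm (\<Sum>k<N. haar_path x t k) powr q))"
      unfolding K_def using D(1) by (intro mult_left_mono path_norm.doob_inequality[OF path_norm_sum q])
    also have "\<dots> = D1 * K * (\<Sum>t\<in>grid N. norm (\<Sum>k<N. haar_path x t k) powr q)"
      by simp
    also have "\<dots> \<le> C * (\<Sum>t\<in>grid N. norm (\<Sum>k<N. haar_path x t k) powr q)"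
      using C(2) by (rule mult_right_mono) (rule sum_nonneg, simp)
    finally show "(\<Sum>t\<in>grid N. rad_norm r N (haar_path x t) powr q)
        \<le> C * (\<Sum>t\<in>grid N. norm (\<Sum>k<N. haar_path x t k) powr q)" .
    have "(\<Sum>t\<in>grid N. norm (\<Sum>k<N. haar_path x t k) powr p)
        \<le> D2 * (\<Sum>t\<in>grid N. pmax N (rad_norm r N) (haar_path x t) powr p)"
      unfolding D2_def by (rule path_norm_extrapolation[OF r0 p0 c0 path_norm_sum rad' lower])
    also have "\<dots> = D2 * (\<Sum>t\<in>grid N. rad_norm r N (haar_path x t) powr p)"
      by (simp only: sign_invariant_path_norm.pmax_eq[OF rad])
    also have "\<dots> \<le> C * (\<Sum>t\<in>grid N. rad_norm r N (haar_path x t) powr p)"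
      using C(3) by (rule mult_right_mono) (rule sum_nonneg, simp)
    finally show "(\<Sum>t\<in>grid N. norm (\<Sum>k<N. haar_path x t k) powr p)
        \<le> C * (\<Sum>t\<in>grid N. rad_norm r N (haar_path x t) powr p)" .
  qed
qed

section \<open>Carleson families and bijections preserving them\<close>

text \<open>For unions of intervals from \<open>dyadic_below N\<close> this is Lebesgue measure; as a normalized
counting measure it is additive without any measurability or integrability conditions.\<close>

definition grid_measure :: "nat \<Rightarrow> real set \<Rightarrow> real" where
  "grid_measure N S = real (card (S \<inter> grid N)) / 2 ^ N"

definition dyadic_below :: "nat \<Rightarrow> real set set" where
  "dyadic_below N = (\<Union>k<N. dyadic_level k)"

text \<open>The Carleson constant is at most \<open>c\<close>, expressed with real numbers; see
\<open>carleson_le_iff_packing\<close> for finite families.\<close>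

definition carleson_packing :: "real \<Rightarrow> real set set \<Rightarrow> bool" where
  "carleson_packing c \<E> \<longleftrightarrow> (\<forall>I\<in>\<E>. (\<Sum>J\<in>{J\<in>\<E>. J \<subseteq> I}. measure lborel J) \<le> c * measure lborel I)"

lemma grid_measure_nonneg [simp]: "0 \<le> grid_measure N S"
  by (simp add: grid_measure_def)

lemma grid_measure_mono: "S \<subseteq> T \<Longrightarrow> grid_measure N S \<le> grid_measure N T"
  unfolding grid_measure_def by (intro divide_right_mono of_nat_mono card_mono) auto

lemma grid_measure_UN_le:
  assumes "finite A"
  shows "grid_measure N (\<Union>a\<in>A. S a) \<le> (\<Sum>a\<in>A. grid_measure N (S a))"
proof -
  have "(\<Union>a\<in>A. S a) \<inter> grid N = (\<Union>a\<in>A. S a \<inter> grid N)"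
    by blast
  then have "card ((\<Union>a\<in>A. S a) \<inter> grid N) = card (\<Union>a\<in>A. S a \<inter> grid N)"
    by (simp only:)
  also have "\<dots> \<le> (\<Sum>a\<in>A. card (S a \<inter> grid N))"
    using assms by (rule card_UN_le)
  finally have "real (card ((\<Union>a\<in>A. S a) \<inter> grid N)) \<le> (\<Sum>a\<in>A. real (card (S a \<inter> grid N)))"
    unfolding of_nat_sum[symmetric] of_nat_le_iff .
  then show ?thesis
    by (simp add: grid_measure_def divide_right_mono flip: sum_divide_distrib)
qed

lemma grid_measure_UN_disjoint:
  assumes "finite A" and disj: "\<And>a b. a \<in> A \<Longrightarrow> b \<in> A \<Longrightarrow> a \<noteq> b \<Longrightarrow> S a \<inter> S b = {}"
  shows "grid_measure N (\<Union>a\<in>A. S a) = (\<Sum>a\<in>A. grid_measure N (S a))"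
proof -
  have "(\<Union>a\<in>A. S a) \<inter> grid N = (\<Union>a\<in>A. S a \<inter> grid N)"
    by blast
  moreover have "card (\<Union>a\<in>A. S a \<inter> grid N) = (\<Sum>a\<in>A. card (S a \<inter> grid N))"
  proof (rule card_UN_disjoint)
    show "\<forall>a\<in>A. \<forall>b\<in>A. a \<noteq> b \<longrightarrow> S a \<inter> grid N \<inter> (S b \<inter> grid N) = {}"
      using disj by blast
  qed (use assms in auto)
  ultimately show ?thesis
    by (simp add: grid_measure_def sum_divide_distrib)
qed

lemma grid_measure_diff:
  "grid_measure N (S - T) = grid_measure N S - grid_measure N (S \<inter> T)"
proof -
  have "card (S \<inter> grid N) = card ((S - T) \<inter> grid N) + card ((S \<inter> T) \<inter> grid N)"
    by (subst card_Un_disjoint[symmetric]) (auto intro!: arg_cong[where f = card])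
  then show ?thesis
    by (simp add: grid_measure_def add_divide_distrib)
qed

lemma dyadic_below_dyadic: "I \<in> dyadic_below N \<Longrightarrow> I \<in> dyadic"
  by (auto simp: dyadic_below_def dyadic_def)

lemma grid_measure_dyadic:
  assumes "I \<in> dyadic_below N"
  shows "grid_measure N I = measure lborel I"
  using assms card_dyadic_level_grid by (auto simp: dyadic_below_def grid_measure_def)

lemma dyadic_antichain_disjoint:
  assumes "I \<in> dyadic" "J \<in> dyadic" "\<not> I \<subseteq> J" "\<not> J \<subseteq> I"
  shows "I \<inter> J = {}"
  using dyadic_nested[OF assms(1,2)] assms(3,4) by blast

lemma ex_maximal_superset:
  assumes "finite \<E>" "J \<in> \<E>"
  obtains I where "I \<in> \<E>" "J \<subseteq> I" "\<And>K. K \<in> \<E> \<Longrightarrow> I \<subseteq> K \<Longrightarrow> K = I"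
  using finite_has_maximal2[OF assms] by metis

lemma sum_UN_le:
  fixes f :: "'b \<Rightarrow> real"
  assumes "finite A" "\<And>a. a \<in> A \<Longrightarrow> finite (S a)" and f: "\<And>x. 0 \<le> f x"
  shows "sum f (\<Union>a\<in>A. S a) \<le> (\<Sum>a\<in>A. sum f (S a))"
  using assms(1,2)
proof (induction A rule: finite_induct)
  case (insert a A)
  have "0 \<le> sum f (S a \<inter> (\<Union>a\<in>A. S a))"
    using f by (rule sum_nonneg)
  moreover have "sum f (S a \<union> (\<Union>a\<in>A. S a)) + sum f (S a \<inter> (\<Union>a\<in>A. S a)) = sum f (S a) + sum f (\<Union>a\<in>A. S a)"
    using insert by (intro sum.union_inter) auto
  ultimately show ?case
    using insert by simp
qed simp

text \<open>The packing condition is summed over the maximal intervals, which are disjoint.\<close>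

lemma carleson_packing_sum_le:
  assumes fin: "finite \<E>" and E: "\<E> \<subseteq> dyadic_below N" and pack: "carleson_packing c \<E>" and c: "0 \<le> c"
  shows "(\<Sum>J\<in>\<E>. measure lborel J) \<le> c * grid_measure N (\<Union>\<E>)"
proof -
  define M where "M = {I\<in>\<E>. \<forall>J\<in>\<E>. I \<subseteq> J \<longrightarrow> J = I}"
  have M: "finite M" "M \<subseteq> \<E>"
    using fin by (auto simp: M_def)
  have "\<E> \<subseteq> (\<Union>I\<in>M. {J\<in>\<E>. J \<subseteq> I})"
  proof
    fix J assume "J \<in> \<E>"
    then obtain I where "I \<in> \<E>" "J \<subseteq> I" "\<And>K. K \<in> \<E> \<Longrightarrow> I \<subseteq> K \<Longrightarrow> K = I"
      using ex_maximal_superset[OF fin] by metis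
    then have "I \<in> M"
      by (auto simp: M_def)
    then show "J \<in> (\<Union>I\<in>M. {J\<in>\<E>. J \<subseteq> I})"
      using \<open>J \<in> \<E>\<close> \<open>J \<subseteq> I\<close> by blast
  qed
  then have "(\<Sum>J\<in>\<E>. measure lborel J) \<le> (\<Sum>J\<in>(\<Union>I\<in>M. {J\<in>\<E>. J \<subseteq> I}). measure lborel J)"
    using M fin by (intro sum_mono2) auto
  also have "\<dots> \<le> (\<Sum>I\<in>M. \<Sum>J\<in>{J\<in>\<E>. J \<subseteq> I}. measure lborel J)"
    using M fin by (intro sum_UN_le) auto
  also have "\<dots> \<le> (\<Sum>I\<in>M. c * measure lborel I)"
    using pack M unfolding carleson_packing_def by (intro sum_mono) blast
  also have "\<dots> = c * (\<Sum>I\<in>M. grid_measure N I)"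
  proof -
    have "measure lborel I = grid_measure N I" if "I \<in> M" for I
      using that M E by (intro grid_measure_dyadic[symmetric]) blast
    then show ?thesis
      by (simp add: sum_distrib_left)
  qed
  also have "(\<Sum>I\<in>M. grid_measure N I) = grid_measure N (\<Union>I\<in>M. I)"
  proof (rule grid_measure_UN_disjoint[symmetric])
    fix I J assume IJ: "I \<in> M" "J \<in> M" "I \<noteq> J"
    then have "\<not> I \<subseteq> J" "\<not> J \<subseteq> I"
      unfolding M_def by blast+
    then show "I \<inter> J = {}"
      using IJ M E by (intro dyadic_antichain_disjoint) (auto intro: dyadic_below_dyadic)
  qed (rule M)
  also have "c * \<dots> \<le> c * grid_measure N (\<Union>\<E>)"
    using c M by (intro mult_left_mono grid_measure_mono) auto
  finally show ?thesis .
qed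

lemma carleson_le_iff_packing:
  assumes fin: "finite \<E>" and E: "\<E> \<subseteq> dyadic" and c: "0 \<le> c"
  shows "carleson \<E> \<le> ennreal c \<longleftrightarrow> carleson_packing c \<E>"
proof -
  have "(\<Sum>\<^sub>\<infinity>J\<in>{J \<in> \<E>. J \<subseteq> I}. emeasure lborel J) / emeasure lborel I
      = ennreal ((\<Sum>J\<in>{J\<in>\<E>. J \<subseteq> I}. measure lborel J) / measure lborel I)" if "I \<in> \<E>" for I
  proof -
    have "(\<Sum>\<^sub>\<infinity>J\<in>{J \<in> \<E>. J \<subseteq> I}. emeasure lborel J) = (\<Sum>J\<in>{J\<in>\<E>. J \<subseteq> I}. emeasure lborel J)"
      using fin by (intro infsum_finite) auto
    also have "\<dots> = (\<Sum>J\<in>{J\<in>\<E>. J \<subseteq> I}. ennreal (measure lborel J))"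
      using E emeasure_dyadic(1) by (intro sum.cong) auto
    also have "\<dots> = ennreal (\<Sum>J\<in>{J\<in>\<E>. J \<subseteq> I}. measure lborel J)"
      by (rule sum_ennreal) simp
    finally have "(\<Sum>\<^sub>\<infinity>J\<in>{J \<in> \<E>. J \<subseteq> I}. emeasure lborel J) / emeasure lborel I
        = ennreal (\<Sum>J\<in>{J\<in>\<E>. J \<subseteq> I}. measure lborel J) / ennreal (measure lborel I)"
      using emeasure_dyadic(1)[of I] that E by auto
    also have "\<dots> = ennreal ((\<Sum>J\<in>{J\<in>\<E>. J \<subseteq> I}. measure lborel J) / measure lborel I)"
      using emeasure_dyadic(2)[of I] that E by (intro divide_ennreal sum_nonneg) auto
    finally show ?thesis .
  qed
  then have "carleson \<E> \<le> ennreal c \<longleftrightarrow>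
      (\<forall>I\<in>\<E>. (\<Sum>J\<in>{J\<in>\<E>. J \<subseteq> I}. measure lborel J) / measure lborel I \<le> c)"
    unfolding carleson_def SUP_le_iff using c by (simp add: ennreal_le_iff)
  also have "\<dots> \<longleftrightarrow> carleson_packing c \<E>"
    unfolding carleson_packing_def using emeasure_dyadic(2) E
    by (intro ball_cong refl pos_divide_le_eq) auto
  finally show ?thesis .
qed

text \<open>The two-sided Carleson condition in the form in which it is used: for finite families and with real
constants.\<close>

locale carleson_bijection =
  fixes \<tau> :: "real set \<Rightarrow> real set" and A :: real
  assumes inj: "inj_on \<tau> dyadic"
    and dyadic: "I \<in> dyadic \<Longrightarrow> \<tau> I \<in> dyadic"
    and A: "1 \<le> A"
    and packing_image: "finite \<E> \<Longrightarrow> \<E> \<subseteq> dyadic \<Longrightarrow> 0 \<le> c \<Longrightarrow> carleson_packing c \<E> \<Longrightarrow> carleson_packing (A * c) (\<tau> ` \<E>)"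
    and packing_preimage: "finite \<E> \<Longrightarrow> \<E> \<subseteq> dyadic \<Longrightarrow> 0 \<le> c \<Longrightarrow> carleson_packing c (\<tau> ` \<E>) \<Longrightarrow> carleson_packing (A * c) \<E>"

lemma carleson_bijectionI:
  assumes bij: "bij_betw \<tau> dyadic dyadic" and A: "A \<ge> 1"
    and carl: "\<And>\<E>. \<E> \<subseteq> dyadic \<Longrightarrow> \<E> \<noteq> {} \<Longrightarrow>
           ennreal (1 / A) * carleson \<E> \<le> carleson (\<tau> ` \<E>) \<and>
           carleson (\<tau> ` \<E>) \<le> ennreal A * carleson \<E>"
  shows "carleson_bijection \<tau> A"
proof
  show "inj_on \<tau> dyadic" and tau: "\<And>I. I \<in> dyadic \<Longrightarrow> \<tau> I \<in> dyadic" and "1 \<le> A"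
    using bij A by (auto simp: bij_betw_def)
  fix \<E> :: "real set set" and c :: real
  assume E: "finite \<E>" "\<E> \<subseteq> dyadic" and c: "0 \<le> c"
  have tE: "finite (\<tau> ` \<E>)" "\<tau> ` \<E> \<subseteq> dyadic"
    using E tau by auto
  have Ac: "0 \<le> A * c"
    using A c by simp
  show "carleson_packing (A * c) (\<tau> ` \<E>)" if "carleson_packing c \<E>"
  proof (cases "\<E> = {}")
    case False
    have "carleson (\<tau> ` \<E>) \<le> ennreal A * carleson \<E>"
      using carl[OF E(2) False] ..
    also have "\<dots> \<le> ennreal A * ennreal c"
      using that carleson_le_iff_packing[OF E c] by (intro mult_left_mono) auto
    also have "\<dots> = ennreal (A * c)"
      using A c by (simp add: ennreal_mult)
    finally show ?thesis
      using carleson_le_iff_packing[OF tE Ac] by simp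
  qed (simp add: carleson_packing_def)
  show "carleson_packing (A * c) \<E>" if "carleson_packing c (\<tau> ` \<E>)"
  proof (cases "\<E> = {}")
    case False
    have "ennreal (1 / A) * carleson \<E> \<le> carleson (\<tau> ` \<E>)"
      using carl[OF E(2) False] ..
    also have "\<dots> \<le> ennreal c"
      using that carleson_le_iff_packing[OF tE c] by simp
    finally have "ennreal A * (ennreal (1 / A) * carleson \<E>) \<le> ennreal A * ennreal c"
      by (rule mult_left_mono) simp
    moreover have "ennreal A * (ennreal (1 / A) * carleson \<E>) = carleson \<E>"
      using A by (simp flip: ennreal_mult mult.assoc)
    moreover have "ennreal A * ennreal c = ennreal (A * c)"
      using A c by (simp add: ennreal_mult)
    ultimately show ?thesis
      using carleson_le_iff_packing[OF E Ac] by simp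
  qed (simp add: carleson_packing_def)
qed

context carleson_bijection
begin

text \<open>The union of the images is covered by the maximal ones. They form a disjoint family, with Carleson
constant \<open>1\<close>, so their preimages have Carleson constant at most \<open>A\<close> and hence total
length at most \<open>A\<close> times the measure of the union.\<close>

lemma grid_measure_image_le:
  assumes fin: "finite \<E>" and E: "\<E> \<subseteq> dyadic_below N" and tE: "\<tau> ` \<E> \<subseteq> dyadic_below N"
    and c: "0 \<le> c" and ratio: "\<And>I. I \<in> \<E> \<Longrightarrow> measure lborel (\<tau> I) \<le> c * measure lborel I"
  shows "grid_measure N (\<Union>(\<tau> ` \<E>)) \<le> c * A * grid_measure N (\<Union>\<E>)"
proof -
  define F where "F = {I\<in>\<E>. \<forall>J\<in>\<E>. \<tau> I \<subseteq> \<tau> J \<longrightarrow> \<tau> J = \<tau> I}"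
  have F: "finite F" "F \<subseteq> \<E>" "F \<subseteq> dyadic"
    using fin E dyadic_below_dyadic by (auto simp: F_def)
  have "\<Union>(\<tau> ` \<E>) \<subseteq> (\<Union>I\<in>F. \<tau> I)"
  proof
    fix t assume "t \<in> \<Union>(\<tau> ` \<E>)"
    then obtain J where J: "J \<in> \<E>" "t \<in> \<tau> J"
      by blast
    obtain K where K: "K \<in> \<tau> ` \<E>" "\<tau> J \<subseteq> K" "\<And>L. L \<in> \<tau> ` \<E> \<Longrightarrow> K \<subseteq> L \<Longrightarrow> L = K"
      using ex_maximal_superset[of "\<tau> ` \<E>" "\<tau> J"] fin J by blast
    then obtain I where "I \<in> \<E>" "K = \<tau> I"
      by blast
    then have "I \<in> F"
      using K(3) by (auto simp: F_def)
    then show "t \<in> (\<Union>I\<in>F. \<tau> I)"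
      using J K \<open>K = \<tau> I\<close> by blast
  qed
  then have "grid_measure N (\<Union>(\<tau> ` \<E>)) \<le> grid_measure N (\<Union>I\<in>F. \<tau> I)"
    by (rule grid_measure_mono)
  also have "\<dots> \<le> (\<Sum>I\<in>F. grid_measure N (\<tau> I))"
    using F by (intro grid_measure_UN_le) auto
  also have "\<dots> \<le> (\<Sum>I\<in>F. c * measure lborel I)"
    using F tE by (intro sum_mono) (auto simp: grid_measure_dyadic image_subset_iff subset_iff intro!: ratio)
  also have "\<dots> = c * (\<Sum>I\<in>F. measure lborel I)"
    by (simp add: sum_distrib_left)
  also have "\<dots> \<le> c * (A * 1 * grid_measure N (\<Union>F))"
  proof (intro mult_left_mono carleson_packing_sum_le packing_preimage)
    show "carleson_packing 1 (\<tau> ` F)"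
      unfolding carleson_packing_def
    proof
      fix K assume "K \<in> \<tau> ` F"
      then have "{J\<in>\<tau> ` F. J \<subseteq> K} = {K}"
        by (auto simp: F_def)
      then show "(\<Sum>J\<in>{J\<in>\<tau> ` F. J \<subseteq> K}. measure lborel J) \<le> 1 * measure lborel K"
        by simp
    qed
  qed (use F E A c in auto)
  also have "\<dots> \<le> c * (A * 1 * grid_measure N (\<Union>\<E>))"
    using F A c by (intro mult_left_mono grid_measure_mono) auto
  finally show ?thesis
    by (simp add: mult.assoc)
qed

text \<open>Families of intervals on which the length ratio belongs to different classes \<open>m\<close> cannot
overlap much.

Let \<open>G\<close> consist of the maximal intervals of each class. The sum on the left is at most the total
length of \<open>G\<close>, so a bound for the Carleson constant of \<open>G\<close> is needed, and by the
hypothesis on \<open>\<tau>\<close> it is enough to bound the Carleson constant of \<open>\<tau> ` G\<close>.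
Fix \<open>L\<close> in \<open>\<tau> ` G\<close> and let \<open>H\<close> be the intervals of \<open>G\<close>
whose image lies in \<open>L\<close>. Call \<open>I\<close> in \<open>H\<close> good if at least half of it is
not covered by intervals of \<open>H\<close> of smaller class. The good intervals have disjoint large parts, so
they are a sparse family with Carleson constant \<open>2\<close>; their images have Carleson constant at most
\<open>2 * A\<close> and therefore total length at most \<open>2 * A * |L|\<close>. A bad interval is charged to
the intervals of smaller class that cover half of it. With the weights \<open>4^(-m)\<close>, which make
\<open>4^(-m) |I|\<close> comparable to \<open>|\<tau> I|\<close>, the charges form a geometric series, and the
bad intervals contribute at most \<open>2/3\<close> of the whole sum \<open>S\<close>. Absorbing this part
leaves \<open>S \<le> 24 * A * |L|\<close>.\<close>

lemma sum_ratio_classes_le: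
  fixes m :: "real set \<Rightarrow> int"
  assumes fin: "finite \<E>" and E: "\<E> \<subseteq> dyadic_below N" and tE: "\<tau> ` \<E> \<subseteq> dyadic_below N"
    and m: "\<And>I. I \<in> \<E> \<Longrightarrow> 4 powr m I * measure lborel (\<tau> I) \<le> measure lborel I"
      "\<And>I. I \<in> \<E> \<Longrightarrow> measure lborel I \<le> 4 * 4 powr m I * measure lborel (\<tau> I)"
  shows "(\<Sum>j\<in>m ` \<E>. grid_measure N (\<Union>{I\<in>\<E>. m I = j})) \<le> 24 * A\<^sup>2 * grid_measure N (\<Union>\<E>)"
proof -
  define G where "G = {I\<in>\<E>. \<forall>J\<in>\<E>. m J = m I \<longrightarrow> I \<subseteq> J \<longrightarrow> J = I}"
  have G: "finite G" "G \<subseteq> \<E>" "G \<subseteq> dyadic" "G \<subseteq> dyadic_below N"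
    using fin E dyadic_below_dyadic by (auto simp: G_def)
  have tG: "\<tau> I \<in> dyadic_below N" if "I \<in> G" for I
    using that G tE by blast
  have gm: "grid_measure N I = measure lborel I" if "I \<in> G" for I
    using that G by (intro grid_measure_dyadic) blast
  have gmt: "grid_measure N (\<tau> I) = measure lborel (\<tau> I)" if "I \<in> G" for I
    using tG[OF that] by (rule grid_measure_dyadic)
  have G_disjoint: "I \<inter> J = {}" if "I \<in> G" "J \<in> G" "m I = m J" "I \<noteq> J" for I J
  proof (rule dyadic_antichain_disjoint)
    show "\<not> I \<subseteq> J" "\<not> J \<subseteq> I"
      using that by (auto simp: G_def)
  qed (use that G in auto)
  have pack: "carleson_packing (24 * A) (\<tau> ` G)"
    unfolding carleson_packing_def
  proof
    fix L assume "L \<in> \<tau> ` G"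
    then obtain K where K: "K \<in> G" and L: "L = \<tau> K"
      by blast
    define H where "H = {I\<in>G. \<tau> I \<subseteq> L}"
    have H: "finite H" "H \<subseteq> G"
      using G by (auto simp: H_def)
    define V where "V I = (\<Union>J\<in>{J\<in>H. m J < m I}. J)" for I
    define S where "S = (\<Sum>I\<in>H. 4 powr (- m I) * measure lborel I)"
    \<comment> \<open>The good intervals.\<close>
    define B where "B = {I\<in>H. grid_measure N (I \<inter> V I) \<le> measure lborel I / 2}"
    have B: "finite B" "B \<subseteq> H" "B \<subseteq> G" "B \<subseteq> dyadic"
      using H G by (auto simp: B_def)
    have "carleson_packing 2 B"
      unfolding carleson_packing_def
    proof
      fix I assume I: "I \<in> B"
      let ?J = "{J\<in>B. J \<subseteq> I}"
      have "(\<Sum>J\<in>?J. measure lborel J) \<le> (\<Sum>J\<in>?J. 2 * grid_measure N (J - V J))"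
      proof (rule sum_mono)
        fix J assume J: "J \<in> ?J"
        then have "grid_measure N J = measure lborel J" "grid_measure N (J \<inter> V J) \<le> measure lborel J / 2"
          using B gm by (auto simp: B_def)
        then show "measure lborel J \<le> 2 * grid_measure N (J - V J)"
          unfolding grid_measure_diff by simp
      qed
      also have "\<dots> = 2 * (\<Sum>J\<in>?J. grid_measure N (J - V J))"
        by (simp add: sum_distrib_left)
      also have "(\<Sum>J\<in>?J. grid_measure N (J - V J)) = grid_measure N (\<Union>J\<in>?J. J - V J)"
      proof (rule grid_measure_UN_disjoint[symmetric])
        fix J J' assume J: "J \<in> ?J" "J' \<in> ?J" "J \<noteq> J'"
        show "(J - V J) \<inter> (J' - V J') = {}"
        proof (cases "m J = m J'")
          case True
          then show ?thesis
            using G_disjoint[of J J'] J B by blast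
        next
          case False
          then have "J \<subseteq> V J' \<or> J' \<subseteq> V J"
            using J B unfolding V_def by (cases "m J < m J'") auto
          then show ?thesis
            by blast
        qed
      qed (use B in auto)
      also have "\<dots> \<le> grid_measure N I"
        by (rule grid_measure_mono) auto
      also have "\<dots> = measure lborel I"
        using I B gm by auto
      finally show "(\<Sum>J\<in>?J. measure lborel J) \<le> 2 * measure lborel I"
        by simp
    qed
    then have "carleson_packing (A * 2) (\<tau> ` B)"
      using B by (intro packing_image) auto
    then have "(\<Sum>J\<in>\<tau> ` B. measure lborel J) \<le> A * 2 * grid_measure N (\<Union>(\<tau> ` B))"
      using B A tG by (intro carleson_packing_sum_le) auto
    also have "\<dots> \<le> A * 2 * grid_measure N L"
      using A B by (intro mult_left_mono grid_measure_mono) (auto simp: H_def)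
    also have "(\<Sum>J\<in>\<tau> ` B. measure lborel J) = (\<Sum>I\<in>B. measure lborel (\<tau> I))"
      using B inj by (subst sum.reindex) (auto intro: inj_on_subset)
    finally have good: "(\<Sum>I\<in>B. measure lborel (\<tau> I)) \<le> 2 * A * measure lborel L"
      using gmt[OF K] by (simp add: L mult.commute)
    have inv: "4 powr real_of_int (- j) * (4 powr real_of_int j * x) = x" for j and x :: real
      by (simp flip: powr_add mult.assoc)
    have "(\<Sum>I\<in>B. 4 powr (- m I) * measure lborel I) \<le> (\<Sum>I\<in>B. 4 * measure lborel (\<tau> I))"
    proof (rule sum_mono)
      fix I assume "I \<in> B"
      then have "I \<in> \<E>"
        using B G by blast
      then have "4 powr (- m I) * measure lborel I \<le> 4 powr (- m I) * (4 powr m I * (4 * measure lborel (\<tau> I)))"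
        using m(2)[of I] by (intro mult_left_mono) (simp_all add: mult_ac)
      then show "4 powr (- m I) * measure lborel I \<le> 4 * measure lborel (\<tau> I)"
        unfolding inv .
    qed
    also have "\<dots> \<le> 8 * A * measure lborel L"
      using good by (simp flip: sum_distrib_left)
    finally have good_sum: "(\<Sum>I\<in>B. 4 powr (- m I) * measure lborel I) \<le> 8 * A * measure lborel L" .
    have "(\<Sum>I\<in>H - B. 4 powr (- m I) * measure lborel I)
        \<le> (\<Sum>I\<in>H - B. \<Sum>J\<in>{J\<in>H. m J < m I}. 2 * (4 powr (- m I) * grid_measure N (I \<inter> J)))"
    proof (rule sum_mono)
      fix I assume "I \<in> H - B"
      then have "measure lborel I \<le> 2 * grid_measure N (I \<inter> V I)"
        by (auto simp: B_def)
      also have "I \<inter> V I = (\<Union>J\<in>{J\<in>H. m J < m I}. I \<inter> J)"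
        by (auto simp: V_def)
      also have "grid_measure N \<dots> \<le> (\<Sum>J\<in>{J\<in>H. m J < m I}. grid_measure N (I \<inter> J))"
        using H by (intro grid_measure_UN_le) auto
      finally have "4 powr (- m I) * measure lborel I \<le> 4 powr (- m I) * (2 * (\<Sum>J\<in>{J\<in>H. m J < m I}. grid_measure N (I \<inter> J)))"
        by (intro mult_left_mono) auto
      then show "4 powr (- m I) * measure lborel I
          \<le> (\<Sum>J\<in>{J\<in>H. m J < m I}. 2 * (4 powr (- m I) * grid_measure N (I \<inter> J)))"
        by (simp add: sum_distrib_left mult.left_commute)
    qed
    also have "\<dots> \<le> (\<Sum>I\<in>H. \<Sum>J\<in>{J\<in>H. m J < m I}. 2 * (4 powr (- m I) * grid_measure N (I \<inter> J)))"
      using H by (intro sum_mono2) (auto intro!: sum_nonneg)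
    also have "\<dots> = (\<Sum>J\<in>H. \<Sum>I\<in>{I\<in>H. m J < m I}. 2 * (4 powr (- m I) * grid_measure N (I \<inter> J)))"
      using H by (intro sum.swap_restrict) auto
    also have "\<dots> \<le> (\<Sum>J\<in>H. (2 / 3) * (4 powr (- m J) * measure lborel J))"
    proof (rule sum_mono)
      fix J assume J: "J \<in> H"
      let ?H = "{I\<in>H. m J < m I}"
      have "(\<Sum>I\<in>?H. 4 powr (- m I) * grid_measure N (I \<inter> J))
          = (\<Sum>j\<in>m ` ?H. \<Sum>I\<in>{I\<in>?H. m I = j}. 4 powr (- m I) * grid_measure N (I \<inter> J))"
        using H by (intro sum.image_gen) auto
      also have "\<dots> \<le> (\<Sum>j\<in>m ` ?H. 4 powr (- j) * measure lborel J)"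
      proof (rule sum_mono)
        fix j
        have "(\<Sum>I\<in>{I\<in>?H. m I = j}. grid_measure N (I \<inter> J)) = grid_measure N (\<Union>I\<in>{I\<in>?H. m I = j}. I \<inter> J)"
        proof (rule grid_measure_UN_disjoint[symmetric])
          fix I I' assume "I \<in> {I\<in>?H. m I = j}" "I' \<in> {I\<in>?H. m I = j}" "I \<noteq> I'"
          then have "I \<inter> I' = {}"
            using H by (intro G_disjoint) auto
          then show "I \<inter> J \<inter> (I' \<inter> J) = {}"
            by blast
        qed (use H in auto)
        also have "\<dots> \<le> grid_measure N J"
          by (rule grid_measure_mono) auto
        also have "\<dots> = measure lborel J"
          using J H gm by auto
        finally have "4 powr (- j) * (\<Sum>I\<in>{I\<in>?H. m I = j}. grid_measure N (I \<inter> J)) \<le> 4 powr (- j) * measure lborel J"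
          by (intro mult_left_mono) auto
        then show "(\<Sum>I\<in>{I\<in>?H. m I = j}. 4 powr (- m I) * grid_measure N (I \<inter> J)) \<le> 4 powr (- j) * measure lborel J"
          by (simp add: sum_distrib_left)
      qed
      also have "\<dots> = (\<Sum>j\<in>m ` ?H. 2 powr (- (2 * j))) * measure lborel J"
      proof -
        have "4 powr (- real_of_int j) = 2 powr (- (2 * real_of_int j))" for j
          using powr_powr[of 2 2 "- real_of_int j"] by simp
        then show ?thesis
          by (simp add: sum_distrib_right)
      qed
      also have "\<dots> \<le> 2 powr (- (2 * (m J + 1))) / (1 - 2 powr - 2) * measure lborel J"
      proof (rule mult_right_mono)
        show "(\<Sum>j\<in>m ` ?H. 2 powr (- (2 * j))) \<le> 2 powr (- (2 * (m J + 1))) / (1 - 2 powr - 2)"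
        proof -
          have "real_of_int (m J + 1) \<le> real_of_int n" if "n \<in> m ` ?H" for n
            using that by auto
          from sum_powr_uminus_int_le[OF _ this, where b = 2] show ?thesis
            using H by simp
        qed
      qed simp
      also have "2 powr (- (2 * (m J + 1))) / (1 - 2 powr - 2) = 4 powr (- m J) / 3"
      proof -
        have e1: "(2::real) powr (- (2 * (m J + 1))) = 2 powr (- (2 * m J)) * 2 powr - 2"
          by (simp flip: powr_add)
        have e2: "(2::real) powr - 2 = 1 / 4"
          by (simp add: powr_minus divide_simps)
        have e3: "(2::real) powr (- (2 * m J)) = 4 powr (- m J)"
          using powr_powr[of 2 2 "- real_of_int (m J)"] by simp
        show ?thesis
          unfolding e1 e2 e3 by simp
      qed
      finally have "(\<Sum>I\<in>?H. 4 powr (- m I) * grid_measure N (I \<inter> J)) \<le> 4 powr (- m J) / 3 * measure lborel J" .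
      then show "(\<Sum>I\<in>?H. 2 * (4 powr (- m I) * grid_measure N (I \<inter> J))) \<le> (2 / 3) * (4 powr (- m J) * measure lborel J)"
        unfolding sum_distrib_left[symmetric] by linarith
    qed
    also have "\<dots> = (2 / 3) * S"
      by (simp add: S_def sum_distrib_left)
    finally have bad_sum: "(\<Sum>I\<in>H - B. 4 powr (- m I) * measure lborel I) \<le> (2 / 3) * S" .
    have "S = (\<Sum>I\<in>H - B. 4 powr (- m I) * measure lborel I) + (\<Sum>I\<in>B. 4 powr (- m I) * measure lborel I)"
      unfolding S_def using H B by (intro sum.subset_diff) auto
    then have S: "S \<le> 24 * A * measure lborel L"
      using good_sum bad_sum by simp
    have "{J\<in>\<tau> ` G. J \<subseteq> L} = \<tau> ` H"
      by (auto simp: H_def)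
    then have "(\<Sum>J\<in>{J\<in>\<tau> ` G. J \<subseteq> L}. measure lborel J) = (\<Sum>I\<in>H. measure lborel (\<tau> I))"
      using H G inj by (simp add: sum.reindex inj_on_subset[of \<tau> dyadic])
    also have "\<dots> \<le> S"
      unfolding S_def
    proof (rule sum_mono)
      fix I assume "I \<in> H"
      then have "I \<in> \<E>"
        using H G by blast
      then have "4 powr (- m I) * (4 powr m I * measure lborel (\<tau> I)) \<le> 4 powr (- m I) * measure lborel I"
        using m(1)[of I] by (intro mult_left_mono) auto
      then show "measure lborel (\<tau> I) \<le> 4 powr (- m I) * measure lborel I"
        unfolding inv .
    qed
    finally show "(\<Sum>J\<in>{J\<in>\<tau> ` G. J \<subseteq> L}. measure lborel J) \<le> 24 * A * measure lborel L"
      using S by simp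
  qed
  have "(\<Sum>j\<in>m ` \<E>. grid_measure N (\<Union>{I\<in>\<E>. m I = j})) \<le> (\<Sum>j\<in>m ` \<E>. \<Sum>I\<in>{I\<in>G. m I = j}. measure lborel I)"
  proof (rule sum_mono)
    fix j
    have "\<Union>{I\<in>\<E>. m I = j} \<subseteq> (\<Union>I\<in>{I\<in>G. m I = j}. I)"
    proof
      fix t assume "t \<in> \<Union>{I\<in>\<E>. m I = j}"
      then obtain J where J: "J \<in> {I\<in>\<E>. m I = j}" "t \<in> J"
        by blast
      obtain I where I: "I \<in> {I\<in>\<E>. m I = j}" "J \<subseteq> I" "\<And>K. K \<in> {I\<in>\<E>. m I = j} \<Longrightarrow> I \<subseteq> K \<Longrightarrow> K = I"
        using ex_maximal_superset[of "{I\<in>\<E>. m I = j}" J] fin J by auto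
      then have "I \<in> G"
        by (auto simp: G_def)
      then show "t \<in> (\<Union>I\<in>{I\<in>G. m I = j}. I)"
        using I J by blast
    qed
    then have "grid_measure N (\<Union>{I\<in>\<E>. m I = j}) \<le> grid_measure N (\<Union>I\<in>{I\<in>G. m I = j}. I)"
      by (rule grid_measure_mono)
    also have "\<dots> \<le> (\<Sum>I\<in>{I\<in>G. m I = j}. grid_measure N I)"
      using G by (intro grid_measure_UN_le) auto
    also have "\<dots> = (\<Sum>I\<in>{I\<in>G. m I = j}. measure lborel I)"
      using gm by (intro sum.cong) auto
    finally show "grid_measure N (\<Union>{I\<in>\<E>. m I = j}) \<le> (\<Sum>I\<in>{I\<in>G. m I = j}. measure lborel I)" .
  qed
  also have "\<dots> = (\<Sum>I\<in>G. measure lborel I)"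
    using G fin by (intro sum.group) auto
  also have "\<dots> \<le> A * (24 * A) * grid_measure N (\<Union>G)"
    using G A pack by (intro carleson_packing_sum_le packing_preimage) auto
  also have "\<dots> \<le> A * (24 * A) * grid_measure N (\<Union>\<E>)"
    using G A by (intro mult_left_mono grid_measure_mono) auto
  finally show ?thesis
    by (simp add: power2_eq_square mult_ac)
qed

end

section \<open>Interpolation along strata of height and length ratio\<close>

definition grid_avg :: "nat \<Rightarrow> (real \<Rightarrow> real) \<Rightarrow> real" where
  "grid_avg N f = (\<Sum>t\<in>grid N. f t) / 2 ^ N"

lemma grid_avg_mono: "(\<And>t. t \<in> grid N \<Longrightarrow> f t \<le> g t) \<Longrightarrow> grid_avg N f \<le> grid_avg N g"
  by (simp add: grid_avg_def divide_right_mono sum_mono)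

lemma grid_avg_nonneg: "(\<And>t. t \<in> grid N \<Longrightarrow> 0 \<le> f t) \<Longrightarrow> 0 \<le> grid_avg N f"
  by (simp add: grid_avg_def sum_nonneg)

lemma grid_avg_cmult: "grid_avg N (\<lambda>t. c * f t) = c * grid_avg N f"
  by (simp add: grid_avg_def sum_distrib_left)

lemma grid_avg_add: "grid_avg N (\<lambda>t. f t + g t) = grid_avg N f + grid_avg N g"
  by (simp add: grid_avg_def sum.distrib add_divide_distrib)

lemma grid_avg_sum: "grid_avg N (\<lambda>t. \<Sum>a\<in>A. f a t) = (\<Sum>a\<in>A. grid_avg N (f a))"
  unfolding grid_avg_def by (subst sum.swap) (rule sum_divide_distrib)

lemma grid_avg_of_bool: "grid_avg N (\<lambda>t. of_bool (t \<in> S)) = grid_measure N S"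
  by (simp add: grid_avg_def grid_measure_def Int_commute)

definition ratio :: "(real set \<Rightarrow> real set) \<Rightarrow> real set \<Rightarrow> real" where
  "ratio \<tau> I = measure lborel I / measure lborel (\<tau> I)"

text \<open>The height of an interval relative to a maximal or square function \<open>\<phi>\<close>. The
minimum makes the height increase along every branch, and makes the union of the intervals of height at least
\<open>\<lambda>\<close> part of \<open>{\<phi> \<ge> \<lambda>}\<close> without any loss.\<close>

definition min_on :: "nat \<Rightarrow> (real \<Rightarrow> real) \<Rightarrow> real set \<Rightarrow> real" where
  "min_on N \<phi> I = Min (\<phi> ` (I \<inter> grid N))"

definition stratum_index :: "nat \<Rightarrow> (real \<Rightarrow> real) \<Rightarrow> (real set \<Rightarrow> real set) \<Rightarrow> real set \<Rightarrow> int \<times> int" where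
  "stratum_index N \<phi> \<tau> I = (\<lfloor>log 2 (min_on N \<phi> I)\<rfloor>, \<lfloor>log 4 (ratio \<tau> I)\<rfloor>)"

text \<open>A term of stratum \<open>(k, m)\<close> has height about \<open>2^k 4^(m/q)\<close> after the
rearrangement. Rounding only \<open>2m/q\<close> down, which depends on the class alone, makes \<open>(k, m)
\<mapsto> (output level, m)\<close> injective.\<close>

definition output_level :: "real \<Rightarrow> int \<times> int \<Rightarrow> int" where
  "output_level q km = fst km + \<lfloor>2 * real_of_int (snd km) / q\<rfloor>"

abbreviation level_set :: "real \<Rightarrow> nat \<Rightarrow> (real \<Rightarrow> real) \<Rightarrow> (real set \<Rightarrow> real set) \<Rightarrow> real set set \<Rightarrow> int \<Rightarrow> real set set" where
  "level_set q N \<phi> \<tau> F n \<equiv> {I\<in>F. output_level q (stratum_index N \<phi> \<tau> I) = n}"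

text \<open>Up to the factor \<open>A\<close>, a bound for the measure of the support of the image of the part
with output level \<open>n\<close>.\<close>

abbreviation level_mass :: "real \<Rightarrow> nat \<Rightarrow> (real \<Rightarrow> real) \<Rightarrow> (real set \<Rightarrow> real set) \<Rightarrow> real set set \<Rightarrow> int \<Rightarrow> real" where
  "level_mass q N \<phi> \<tau> F n \<equiv> \<Sum>km\<in>{km\<in>stratum_index N \<phi> \<tau> ` F. output_level q km = n}.
    4 powr real_of_int (- snd km) * grid_measure N (\<Union>{I\<in>F. stratum_index N \<phi> \<tau> I = km})"

lemma floor_log_bounds:
  assumes b: "1 < b" and x: "0 < x"
  shows "b powr \<lfloor>log b x\<rfloor> \<le> x" "x < b * b powr \<lfloor>log b x\<rfloor>"
proof -
  have "b powr \<lfloor>log b x\<rfloor> \<le> b powr (log b x)"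
    using b by (intro powr_mono) auto
  then show "b powr \<lfloor>log b x\<rfloor> \<le> x"
    using b x by simp
  have "b powr (log b x) < b powr (1 + \<lfloor>log b x\<rfloor>)"
    using b by (intro powr_less_mono) linarith+
  then show "x < b * b powr \<lfloor>log b x\<rfloor>"
    using b x by (simp add: powr_add)
qed

lemma floor_log_ratio_bounds:
  assumes "I \<in> dyadic" "\<tau> I \<in> dyadic"
  shows "4 powr \<lfloor>log 4 (ratio \<tau> I)\<rfloor> * measure lborel (\<tau> I) \<le> measure lborel I"
    "measure lborel I \<le> 4 * 4 powr \<lfloor>log 4 (ratio \<tau> I)\<rfloor> * measure lborel (\<tau> I)"
proof -
  have pos: "0 < measure lborel I" "0 < measure lborel (\<tau> I)"
    using emeasure_dyadic(2) assms by auto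
  then have r: "0 < ratio \<tau> I"
    by (simp add: ratio_def)
  have eq: "ratio \<tau> I * measure lborel (\<tau> I) = measure lborel I"
    using pos by (simp add: ratio_def)
  show "4 powr \<lfloor>log 4 (ratio \<tau> I)\<rfloor> * measure lborel (\<tau> I) \<le> measure lborel I"
    unfolding eq[symmetric] using floor_log_bounds(1)[of 4 "ratio \<tau> I"] r pos by (intro mult_right_mono) auto
  show "measure lborel I \<le> 4 * 4 powr \<lfloor>log 4 (ratio \<tau> I)\<rfloor> * measure lborel (\<tau> I)"
    unfolding eq[symmetric] using floor_log_bounds(2)[of 4 "ratio \<tau> I"] r pos by (intro mult_right_mono) auto
qed

context carleson_bijection
begin

text \<open>For fixed height the classes of length ratios are summed by \<open>sum_ratio_classes_le\<close>; the
remaining sum over the heights is a layer-cake sum for \<open>\<phi>\<close>.\<close>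

lemma sum_strata_le:
  fixes q :: real
  assumes q: "0 < q"
    and F: "finite F" "F \<subseteq> dyadic_below N" "\<tau> ` F \<subseteq> dyadic_below N"
    and pos: "\<And>I. I \<in> F \<Longrightarrow> 0 < min_on N \<phi> I"
  shows "(\<Sum>km\<in>stratum_index N \<phi> \<tau> ` F. 2 powr (q * real_of_int (fst km)) * grid_measure N (\<Union>{I\<in>F. stratum_index N \<phi> \<tau> I = km}))
    \<le> 24 * A\<^sup>2 / (1 - 2 powr - q) * grid_avg N (\<lambda>t. \<phi> t powr q)"
proof -
  define k where "k I = \<lfloor>log 2 (min_on N \<phi> I)\<rfloor>" for I
  define m where "m I = \<lfloor>log 4 (ratio \<tau> I)\<rfloor>" for I
  have km: "stratum_index N \<phi> \<tau> I = (k I, m I)" for I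
    by (simp add: stratum_index_def k_def m_def)
  have dy: "I \<in> dyadic" "\<tau> I \<in> dyadic" if "I \<in> F" for I
    using that F dyadic_below_dyadic by blast+
  have img: "stratum_index N \<phi> \<tau> ` F = Sigma (k ` F) (\<lambda>j. m ` {I\<in>F. k I = j})"
  proof (intro equalityI subsetI)
    fix z assume "z \<in> Sigma (k ` F) (\<lambda>j. m ` {I\<in>F. k I = j})"
    then obtain j I where "z = (j, m I)" "I \<in> F" "k I = j"
      by blast
    then show "z \<in> stratum_index N \<phi> \<tau> ` F"
      by (metis km imageI)
  qed (auto simp: km)
  have "(\<Sum>km\<in>stratum_index N \<phi> \<tau> ` F. 2 powr (q * real_of_int (fst km)) * grid_measure N (\<Union>{I\<in>F. stratum_index N \<phi> \<tau> I = km}))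
      = (\<Sum>j\<in>k ` F. \<Sum>i\<in>m ` {I\<in>F. k I = j}. 2 powr (q * j) * grid_measure N (\<Union>{I\<in>{I\<in>F. k I = j}. m I = i}))"
  proof -
    have Sigma: "sum g (Sigma (k ` F) (\<lambda>j. m ` {I\<in>F. k I = j})) = (\<Sum>j\<in>k ` F. \<Sum>i\<in>m ` {I\<in>F. k I = j}. g (j, i))"
      for g :: "int \<times> int \<Rightarrow> real"
      using F(1) by (subst sum.Sigma) auto
    have "{I\<in>F. (k I, m I) = (j, i)} = {I\<in>{I\<in>F. k I = j}. m I = i}" for i j
      by blast
    then show ?thesis
      unfolding img Sigma km by (simp only: fst_conv)
  qed
  also have "\<dots> \<le> (\<Sum>j\<in>k ` F. 2 powr (q * j) * (24 * A\<^sup>2 * grid_measure N (\<Union>{I\<in>F. k I = j})))"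
  proof (rule sum_mono)
    fix j
    have "(\<Sum>i\<in>m ` {I\<in>F. k I = j}. grid_measure N (\<Union>{I\<in>{I\<in>F. k I = j}. m I = i}))
        \<le> 24 * A\<^sup>2 * grid_measure N (\<Union>{I\<in>F. k I = j})"
      using F dy by (intro sum_ratio_classes_le) (auto simp: m_def intro: floor_log_ratio_bounds)
    then show "(\<Sum>i\<in>m ` {I\<in>F. k I = j}. 2 powr (q * j) * grid_measure N (\<Union>{I\<in>{I\<in>F. k I = j}. m I = i}))
        \<le> 2 powr (q * j) * (24 * A\<^sup>2 * grid_measure N (\<Union>{I\<in>F. k I = j}))"
      unfolding sum_distrib_left[symmetric] by (intro mult_left_mono) auto
  qed
  also have "\<dots> = 24 * A\<^sup>2 * grid_avg N (\<lambda>t. \<Sum>j\<in>k ` F. 2 powr (q * j) * of_bool (t \<in> \<Union>{I\<in>F. k I = j}))"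
    by (simp only: grid_avg_sum grid_avg_cmult grid_avg_of_bool sum_distrib_left mult_ac)
  also have "\<dots> \<le> 24 * A\<^sup>2 * grid_avg N (\<lambda>t. (1 / (1 - 2 powr - q)) * \<phi> t powr q)"
  proof (intro mult_left_mono grid_avg_mono)
    fix t assume t: "t \<in> grid N"
    have "(\<Sum>j\<in>k ` F. 2 powr (q * j) * of_bool (t \<in> \<Union>{I\<in>F. k I = j})) \<le> (\<Sum>j\<in>k ` F. 2 powr (q * j) * of_bool (2 powr j \<le> \<phi> t))"
    proof (intro sum_mono mult_left_mono)
      fix j
      have "2 powr j \<le> \<phi> t" if I: "I \<in> F" "t \<in> I" "k I = j" for I
      proof -
        have "2 powr j \<le> min_on N \<phi> I"
          using floor_log_bounds(1)[of 2 "min_on N \<phi> I"] pos[OF I(1)] I(3) by (simp add: k_def)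
        also have "\<dots> \<le> \<phi> t"
          unfolding min_on_def using t I by (intro Min_le) auto
        finally show ?thesis .
      qed
      then show "of_bool (t \<in> \<Union>{I\<in>F. k I = j}) \<le> (of_bool (2 powr j \<le> \<phi> t) :: real)"
        by auto
    qed simp
    also have "\<dots> \<le> \<phi> t powr q / (1 - 2 powr - q)"
      using q F(1) by (intro sum_levels_le) auto
    finally show "(\<Sum>j\<in>k ` F. 2 powr (q * j) * of_bool (t \<in> \<Union>{I\<in>F. k I = j})) \<le> (1 / (1 - 2 powr - q)) * \<phi> t powr q"
      by simp
  qed simp
  also have "\<dots> = 24 * A\<^sup>2 / (1 - 2 powr - q) * grid_avg N (\<lambda>t. \<phi> t powr q)"
    unfolding grid_avg_cmult by simp
  finally show ?thesis .
qed

text \<open>The image of the Haar sum is split according to the output level. On every level the support is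
controlled by \<open>grid_measure_image_le\<close> and the \<open>p\<close>-th moment by the hypothesis
\<open>level\<close>; these are the two inputs of \<open>powr_sum_le_sum_endpoints\<close>. In the resulting sum
over the strata the output level and the ratio class combine to the power \<open>2^(qk)\<close> of the height
alone.\<close>

lemma stratified_interpolation:
  fixes p q C :: real and x :: "real set \<Rightarrow> 'a::real_normed_vector"
  assumes q: "0 < q" and qp: "q < p" and C: "0 \<le> C"
    and F: "finite F" "F \<subseteq> dyadic_below N" "\<tau> ` F \<subseteq> dyadic_below N"
    and pos: "\<And>I. I \<in> F \<Longrightarrow> 0 < min_on N \<phi> I"
    and level: "\<And>n. grid_avg N (\<lambda>t. norm (\<Sum>I\<in>level_set q N \<phi> \<tau> F n. haar (\<tau> I) t *\<^sub>R x I) powr p)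
        \<le> C * 2 powr (p * n) * level_mass q N \<phi> \<tau> F n"
  shows "grid_avg N (\<lambda>t. norm (\<Sum>I\<in>F. haar (\<tau> I) t *\<^sub>R x I) powr q)
    \<le> endpoint_const q p * ((A + C) * (24 * A\<^sup>2 / (1 - 2 powr - q))) * grid_avg N (\<lambda>t. \<phi> t powr q)"
proof -
  define C0 where "C0 = endpoint_const q p"
  have C0: "0 \<le> C0"
    by (simp add: C0_def endpoint_const_def)
  define E where "E = 24 * A\<^sup>2 / (1 - 2 powr - q)"
  define \<kappa> where "\<kappa> = stratum_index N \<phi> \<tau>"
  define lev where "lev I = output_level q (\<kappa> I)" for I
  define U where "U km = \<Union>{I\<in>F. \<kappa> I = km}" for km
  define v where "v n t = (\<Sum>I\<in>{I\<in>F. lev I = n}. haar (\<tau> I) t *\<^sub>R x I)" for n t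
  define W where "W n = (\<Union>I\<in>{I\<in>F. lev I = n}. \<tau> I)" for n
  define P where "P n = {km\<in>\<kappa> ` F. output_level q km = n}" for n
  have Lp: "grid_avg N (\<lambda>t. norm (v n t) powr p)
      \<le> C * 2 powr (p * n) * (\<Sum>km\<in>P n. 4 powr real_of_int (- snd km) * grid_measure N (U km))" for n
    using level[of n] by (simp only: v_def P_def U_def lev_def \<kappa>_def)
  have dy: "I \<in> dyadic" "\<tau> I \<in> dyadic" if "I \<in> F" for I
    using that F dyadic_below_dyadic by blast+
  have v_zero: "v n t = 0" if "t \<notin> W n" for n t
    unfolding v_def
  proof (rule sum.neutral, rule ballI)
    fix I assume "I \<in> {I\<in>F. lev I = n}"
    then show "haar (\<tau> I) t *\<^sub>R x I = 0"
      using that dy by (auto simp: W_def haar_outside)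
  qed
  have pointwise: "norm (\<Sum>I\<in>F. haar (\<tau> I) t *\<^sub>R x I) powr q
      \<le> C0 * (\<Sum>n\<in>lev ` F. 2 powr (q * n) * of_bool (t \<in> W n) + 2 powr ((q - p) * n) * norm (v n t) powr p)" for t
  proof -
    let ?K = "{n\<in>lev ` F. t \<in> W n}"
    have "(\<Sum>I\<in>F. haar (\<tau> I) t *\<^sub>R x I) = (\<Sum>n\<in>lev ` F. v n t)"
      unfolding v_def using F(1) by (rule sum.image_gen)
    also have "\<dots> = (\<Sum>n\<in>?K. v n t)"
      using F(1) v_zero by (intro sum.mono_neutral_right) auto
    finally have "norm (\<Sum>I\<in>F. haar (\<tau> I) t *\<^sub>R x I) \<le> (\<Sum>n\<in>?K. norm (v n t))"
      by (simp only: norm_sum)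
    then have "norm (\<Sum>I\<in>F. haar (\<tau> I) t *\<^sub>R x I) powr q \<le> (\<Sum>n\<in>?K. norm (v n t)) powr q"
      using q by (intro powr_mono2) auto
    also have "\<dots> \<le> C0 * (\<Sum>n\<in>?K. 2 powr (q * n) + 2 powr ((q - p) * n) * norm (v n t) powr p)"
      unfolding C0_def using F(1) by (intro powr_sum_le_sum_endpoints[OF q qp]) auto
    also have "(\<Sum>n\<in>?K. 2 powr (q * n) + 2 powr ((q - p) * n) * norm (v n t) powr p)
        = (\<Sum>n\<in>?K. 2 powr (q * n) * of_bool (t \<in> W n) + 2 powr ((q - p) * n) * norm (v n t) powr p)"
      by (intro sum.cong) auto
    also have "\<dots> \<le> (\<Sum>n\<in>lev ` F. 2 powr (q * n) * of_bool (t \<in> W n) + 2 powr ((q - p) * n) * norm (v n t) powr p)"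
      using F(1) by (intro sum_mono2) auto
    finally show ?thesis
      using C0 by (simp add: mult_left_mono)
  qed
  have gmW: "grid_measure N (W n) \<le> A * (\<Sum>km\<in>P n. 4 powr real_of_int (- snd km) * grid_measure N (U km))" for n
  proof -
    have "W n = (\<Union>km\<in>P n. \<Union>(\<tau> ` {I\<in>F. \<kappa> I = km}))"
      by (auto simp: W_def P_def lev_def)
    also have "grid_measure N \<dots> \<le> (\<Sum>km\<in>P n. grid_measure N (\<Union>(\<tau> ` {I\<in>F. \<kappa> I = km})))"
      using F(1) by (intro grid_measure_UN_le) (simp add: P_def)
    also have "\<dots> \<le> (\<Sum>km\<in>P n. 4 powr real_of_int (- snd km) * A * grid_measure N (U km))"
      unfolding U_def
    proof (intro sum_mono grid_measure_image_le)
      fix km I assume I: "I \<in> {I\<in>F. \<kappa> I = km}"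
      then have m: "snd km = \<lfloor>log 4 (ratio \<tau> I)\<rfloor>"
        by (auto simp: \<kappa>_def stratum_index_def)
      have "4 powr real_of_int (- snd km) * (4 powr real_of_int (snd km) * measure lborel (\<tau> I)) \<le> 4 powr real_of_int (- snd km) * measure lborel I"
        unfolding m using I dy by (intro mult_left_mono floor_log_ratio_bounds(1)) auto
      then show "measure lborel (\<tau> I) \<le> 4 powr real_of_int (- snd km) * measure lborel I"
        by (simp flip: powr_add mult.assoc)
    qed (use F in auto)
    also have "\<dots> = A * (\<Sum>km\<in>P n. 4 powr real_of_int (- snd km) * grid_measure N (U km))"
      by (simp add: sum_distrib_left mult_ac)
    finally show ?thesis .
  qed
  have "grid_avg N (\<lambda>t. norm (\<Sum>I\<in>F. haar (\<tau> I) t *\<^sub>R x I) powr q)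
      \<le> grid_avg N (\<lambda>t. C0 * (\<Sum>n\<in>lev ` F. 2 powr (q * n) * of_bool (t \<in> W n) + 2 powr ((q - p) * n) * norm (v n t) powr p))"
    by (intro grid_avg_mono pointwise)
  also have "\<dots> = C0 * (\<Sum>n\<in>lev ` F. 2 powr (q * n) * grid_measure N (W n) + 2 powr ((q - p) * n) * grid_avg N (\<lambda>t. norm (v n t) powr p))"
    by (simp only: grid_avg_cmult grid_avg_sum grid_avg_add grid_avg_of_bool)
  also have "\<dots> \<le> C0 * (\<Sum>n\<in>lev ` F. (A + C) * (\<Sum>km\<in>P n. 2 powr (q * n) * (4 powr real_of_int (- snd km) * grid_measure N (U km))))"
  proof (intro mult_left_mono sum_mono)
    fix n
    let ?s = "\<Sum>km\<in>P n. 4 powr real_of_int (- snd km) * grid_measure N (U km)"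
    have "2 powr (q * n) * grid_measure N (W n) \<le> 2 powr (q * n) * (A * ?s)"
      by (intro mult_left_mono gmW) simp
    moreover have "2 powr ((q - p) * n) * grid_avg N (\<lambda>t. norm (v n t) powr p) \<le> 2 powr ((q - p) * n) * (C * 2 powr (p * n) * ?s)"
      by (intro mult_left_mono Lp) simp
    moreover have "2 powr ((q - p) * n) * (C * 2 powr (p * n) * ?s) = 2 powr (q * n) * (C * ?s)"
    proof -
      have "2 powr (q * n) = 2 powr ((q - p) * n) * 2 powr (p * n)"
        by (simp add: algebra_simps flip: powr_add)
      then show ?thesis
        by simp
    qed
    ultimately have "2 powr (q * n) * grid_measure N (W n) + 2 powr ((q - p) * n) * grid_avg N (\<lambda>t. norm (v n t) powr p)
        \<le> 2 powr (q * n) * (A * ?s) + 2 powr (q * n) * (C * ?s)"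
      by linarith
    also have "\<dots> = (A + C) * (2 powr (q * n) * ?s)"
      by (simp add: algebra_simps)
    finally have "2 powr (q * n) * grid_measure N (W n) + 2 powr ((q - p) * n) * grid_avg N (\<lambda>t. norm (v n t) powr p)
        \<le> (A + C) * (2 powr (q * n) * ?s)" .
    then show "2 powr (q * n) * grid_measure N (W n) + 2 powr ((q - p) * n) * grid_avg N (\<lambda>t. norm (v n t) powr p)
        \<le> (A + C) * (\<Sum>km\<in>P n. 2 powr (q * n) * (4 powr real_of_int (- snd km) * grid_measure N (U km)))"
      by (simp only: sum_distrib_left)
  qed (use C0 in simp)
  also have "\<dots> \<le> C0 * (\<Sum>n\<in>lev ` F. (A + C) * (\<Sum>km\<in>P n. 2 powr (q * real_of_int (fst km)) * grid_measure N (U km)))"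
  proof (intro mult_left_mono sum_mono)
    fix n km assume "km \<in> P n"
    then have "real_of_int n \<le> real_of_int (fst km) + 2 * real_of_int (snd km) / q"
      by (auto simp: P_def output_level_def)
    then have "q * n \<le> q * (real_of_int (fst km) + 2 * real_of_int (snd km) / q)"
      using q by (intro mult_left_mono) auto
    also have "\<dots> = q * real_of_int (fst km) + 2 * real_of_int (snd km)"
      using q by (simp add: field_simps)
    finally have "2 powr (q * n) \<le> 2 powr (q * real_of_int (fst km) + 2 * real_of_int (snd km))"
      by simp
    also have "\<dots> = 2 powr (q * real_of_int (fst km)) * 4 powr real_of_int (snd km)"
      using powr_powr[of 2 2 "real_of_int (snd km)"] by (simp add: powr_add)
    finally have "2 powr (q * n) * 4 powr real_of_int (- snd km) \<le> 2 powr (q * real_of_int (fst km)) * 4 powr real_of_int (snd km) * 4 powr real_of_int (- snd km)"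
      by (intro mult_right_mono) auto
    then have "2 powr (q * n) * 4 powr real_of_int (- snd km) \<le> 2 powr (q * real_of_int (fst km))"
      by (simp add: mult.assoc flip: powr_add)
    then have "2 powr (q * n) * 4 powr real_of_int (- snd km) * grid_measure N (U km) \<le> 2 powr (q * real_of_int (fst km)) * grid_measure N (U km)"
      by (intro mult_right_mono) auto
    then show "2 powr (q * n) * (4 powr real_of_int (- snd km) * grid_measure N (U km)) \<le> 2 powr (q * real_of_int (fst km)) * grid_measure N (U km)"
      by (simp only: mult.assoc)
  qed (use C0 A C in auto)
  also have "\<dots> = C0 * ((A + C) * (\<Sum>km\<in>\<kappa> ` F. 2 powr (q * real_of_int (fst km)) * grid_measure N (U km)))"
  proof -
    have "(\<Sum>n\<in>lev ` F. \<Sum>km\<in>P n. 2 powr (q * real_of_int (fst km)) * grid_measure N (U km)) = (\<Sum>km\<in>\<kappa> ` F. 2 powr (q * real_of_int (fst km)) * grid_measure N (U km))"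
      unfolding P_def using F(1) by (intro sum.group) (auto simp: lev_def)
    then show ?thesis
      by (simp flip: sum_distrib_left)
  qed
  also have "\<dots> \<le> C0 * ((A + C) * (E * grid_avg N (\<lambda>t. \<phi> t powr q)))"
    unfolding U_def \<kappa>_def E_def using C0 A C q F pos by (intro mult_left_mono sum_strata_le) auto
  finally show ?thesis
    by (simp only: C0_def E_def mult.assoc)
qed

end

section \<open>Boundedness of the rearrangement on the grid\<close>

definition haar_comb :: "(real set \<Rightarrow> real set) \<Rightarrow> real set set \<Rightarrow> (real set \<Rightarrow> 'a::real_vector) \<Rightarrow> real \<Rightarrow> 'a" where
  "haar_comb \<sigma> F y t = (\<Sum>I\<in>F. haar (\<sigma> I) t *\<^sub>R y I)"

lemma haar_dint_cong:
  assumes J: "J \<in> dyadic_below N" and t: "0 \<le> t" "t < 1" and s: "s \<in> dint N t"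
  shows "haar J s = haar J t"
proof -
  obtain k where k: "k < N" "J \<in> dyadic_level k"
    using J by (auto simp: dyadic_below_def)
  have st: "s \<in> dint k t" "s \<in> dint (Suc k) t"
    using dint_antimono[OF _ s] k by auto
  obtain j where j: "j \<in> J"
    using k(2) dyadic_level_nonempty by blast
  then have J: "J = dint k j"
    using k(2) dyadic_level_eq_dint by blast
  then have "s \<in> J \<longleftrightarrow> t \<in> J"
    using st(1) by (simp add: mem_dint_iff)
  moreover have "\<lfloor>2 ^ Suc k * s\<rfloor> = \<lfloor>2 ^ Suc k * t\<rfloor>"
    using st(2) by (simp only: mem_dint_iff)
  ultimately show ?thesis
    unfolding haar_dyadic_level[OF k(2) j] by (simp only:)
qed

lemma haar_comb_cong:
  assumes "\<sigma> ` F \<subseteq> dyadic_below N" "0 \<le> t" "t < 1" "s \<in> dint N t"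
  shows "haar_comb \<sigma> F y s = haar_comb \<sigma> F y t"
  unfolding haar_comb_def
proof (rule sum.cong)
  fix I assume "I \<in> F"
  then have "haar (\<sigma> I) s = haar (\<sigma> I) t"
    using assms by (intro haar_dint_cong) auto
  then show "haar (\<sigma> I) s *\<^sub>R y I = haar (\<sigma> I) t *\<^sub>R y I"
    by (simp only:)
qed simp

lemma Lp_norm_haar_comb:
  assumes "\<sigma> ` F \<subseteq> dyadic_below N"
  shows "Lp_norm p (haar_comb \<sigma> F y) = grid_avg N (\<lambda>t. norm (haar_comb \<sigma> F y t) powr p) powr (1 / p)"
  unfolding grid_avg_def by (rule Lp_norm_step_function) (rule haar_comb_cong[OF assms])

lemma haar_comb_id_eq_sum_haar_path:
  assumes F: "finite F" "F \<subseteq> dyadic_below N" and t: "0 \<le> t" "t < 1" and y: "\<And>I. I \<in> F \<Longrightarrow> y I = x I" "\<And>I. I \<notin> F \<Longrightarrow> y I = 0"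
  shows "haar_comb id F x t = (\<Sum>k<N. haar_path y t k)"
proof -
  let ?K = "{k. k < N \<and> dint k t \<in> F}"
  have lev: "dint k t \<in> dyadic_level k" for k
    using t by (rule dint_in_dyadic_level)
  have "haar_comb id F x t = (\<Sum>I\<in>{I\<in>F. t \<in> I}. haar I t *\<^sub>R y I)"
  proof -
    have "I \<in> dyadic" if "I \<in> F" for I
      using that F dyadic_below_dyadic by blast
    then show ?thesis
      unfolding haar_comb_def id_def using F(1) y
      by (intro sum.mono_neutral_cong_right) (auto simp: haar_outside)
  qed
  also have "{I\<in>F. t \<in> I} = (\<lambda>k. dint k t) ` ?K"
  proof (intro equalityI subsetI)
    fix I assume I: "I \<in> {I\<in>F. t \<in> I}"
    then obtain k where "k < N" "I \<in> dyadic_level k"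
      using F(2) by (auto simp: dyadic_below_def)
    then show "I \<in> (\<lambda>k. dint k t) ` ?K"
      using I dyadic_level_eq_dint[of I k t] by blast
  qed auto
  also have "(\<Sum>I\<in>(\<lambda>k. dint k t) ` ?K. haar I t *\<^sub>R y I) = (\<Sum>k\<in>?K. haar (dint k t) t *\<^sub>R y (dint k t))"
  proof (rule sum.reindex_cong[where l = "\<lambda>k. dint k t"])
    show "inj_on (\<lambda>k. dint k t) ?K"
      using lev dyadic_level_unique by (metis (mono_tags, lifting) inj_onI)
  qed auto
  also have "\<dots> = (\<Sum>k<N. haar_path y t k)"
    unfolding haar_path_def using y by (intro sum.mono_neutral_left) auto
  finally show ?thesis .
qed

lemma haar_sum_eq_haar_comb:
  assumes F: "finite F" "F \<subseteq> dyadic" and a: "\<And>I. I \<in> dyadic \<Longrightarrow> I \<notin> F \<Longrightarrow> a I = 0"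
    and y: "\<And>I. I \<in> F \<Longrightarrow> y I = (1 / measure lborel (\<sigma> I) powr (1 / p)) *\<^sub>R a I"
  shows "haar_sum p \<sigma> a = haar_comb \<sigma> F y"
proof
  fix t
  have "haar_sum p \<sigma> a t = (\<Sum>I\<in>F. (haar (\<sigma> I) t / measure lborel (\<sigma> I) powr (1 / p)) *\<^sub>R a I)"
    unfolding haar_sum_def using F a by (intro sum.mono_neutral_left) auto
  also have "\<dots> = haar_comb \<sigma> F y t"
    unfolding haar_comb_def by (rule sum.cong) (simp_all add: y)
  finally show "haar_sum p \<sigma> a t = haar_comb \<sigma> F y t" .
qed

lemma ratio_powr:
  "1 / measure lborel (\<tau> I) powr a * measure lborel I powr a = ratio \<tau> I powr a"
  by (simp add: ratio_def powr_divide)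

text \<open>Boundedness of the rearrangement on finite Haar sums in unnormalized coefficients. The grid has to
be fine enough to resolve the given and the rearranged Haar functions; the constant \<open>D\<close> does not
depend on it.\<close>

definition grid_bounded :: "'a::banach itself \<Rightarrow> real \<Rightarrow> (real set \<Rightarrow> real set) \<Rightarrow> real \<Rightarrow> bool" where
  "grid_bounded _ p \<tau> D \<longleftrightarrow> (\<forall>N F. \<forall>x :: real set \<Rightarrow> 'a. finite F \<longrightarrow> F \<subseteq> dyadic_below N \<longrightarrow> \<tau> ` F \<subseteq> dyadic_below N \<longrightarrow>
    grid_avg N (\<lambda>t. norm (haar_comb \<tau> F (\<lambda>I. ratio \<tau> I powr (1 / p) *\<^sub>R x I) t) powr p)
      \<le> D * grid_avg N (\<lambda>t. norm (haar_comb id F x t) powr p))"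

text \<open>Boundedness on the unit ball is turned into a homogeneous estimate by scaling. The norm is increased
by \<open>e / (B + 1)\<close> before it is divided out, so that a vanishing norm needs no separate
treatment.\<close>

lemma rearrangement_bounded_imp_grid_bounded:
  assumes p: "0 < p" and bdd: "rearrangement_bounded TYPE('a::banach) p \<tau>"
  obtains D where "0 \<le> D" "grid_bounded TYPE('a) p \<tau> D"
proof -
  obtain B where B: "Lp_norm p (haar_sum p \<tau> a) \<le> B" if "finite_family a" "Lp_norm p (haar_sum p id a) \<le> 1" for a :: "real set \<Rightarrow> 'a"
    using bdd unfolding rearrangement_bounded_def bdd_above_def by blast
  have "0 \<le> Lp_norm p (haar_sum p \<tau> (\<lambda>_. 0 :: 'a))"
    by (simp add: Lp_norm_def)
  also have "\<dots> \<le> B"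
    using p by (intro B) (auto simp: finite_family_def Lp_norm_def haar_sum_def)
  finally have B0: "0 \<le> B" .
  have "grid_bounded TYPE('a) p \<tau> (B powr p)"
    unfolding grid_bounded_def
  proof (intro allI impI)
    fix N F and x :: "real set \<Rightarrow> 'a"
    assume F: "finite F" "F \<subseteq> dyadic_below N" "\<tau> ` F \<subseteq> dyadic_below N"
    define f where "f t = haar_comb id F x t" for t
    define g where "g t = haar_comb \<tau> F (\<lambda>I. ratio \<tau> I powr (1 / p) *\<^sub>R x I) t" for t
    define \<alpha> where "\<alpha> = grid_avg N (\<lambda>t. norm (f t) powr p)"
    define \<beta> where "\<beta> = grid_avg N (\<lambda>t. norm (g t) powr p)"
    have ab: "0 \<le> \<alpha>" "0 \<le> \<beta>"
      by (auto simp: \<alpha>_def \<beta>_def intro: grid_avg_nonneg)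
    have dy: "I \<in> dyadic" if "I \<in> F" for I
      using that F dyadic_below_dyadic by blast
    have main: "r * \<beta> powr (1 / p) \<le> B" if r: "0 < r" "r * \<alpha> powr (1 / p) \<le> 1" for r
    proof -
      define a where "a I = (if I \<in> F then measure lborel I powr (1 / p) *\<^sub>R r *\<^sub>R x I else 0)" for I
      have id: "haar_sum p id a = haar_comb id F (\<lambda>I. r *\<^sub>R x I)"
      proof (rule haar_sum_eq_haar_comb)
        fix I assume "I \<in> F"
        then show "r *\<^sub>R x I = (1 / measure lborel (id I) powr (1 / p)) *\<^sub>R a I"
          using emeasure_dyadic(2)[OF dy[of I]] by (simp add: a_def)
      qed (use F(1) dy in \<open>auto simp: a_def\<close>)
      have tau: "haar_sum p \<tau> a = haar_comb \<tau> F (\<lambda>I. r *\<^sub>R ratio \<tau> I powr (1 / p) *\<^sub>R x I)"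
      proof (rule haar_sum_eq_haar_comb)
        fix I assume "I \<in> F"
        then show "r *\<^sub>R ratio \<tau> I powr (1 / p) *\<^sub>R x I = (1 / measure lborel (\<tau> I) powr (1 / p)) *\<^sub>R a I"
          unfolding ratio_powr[symmetric] by (simp add: a_def mult_ac)
      qed (use F(1) dy in \<open>auto simp: a_def\<close>)
      have scale: "haar_comb \<sigma> F (\<lambda>I. r *\<^sub>R y I) t = r *\<^sub>R haar_comb \<sigma> F y t" for \<sigma> t and y :: "real set \<Rightarrow> 'a"
        by (simp add: haar_comb_def scaleR_sum_right mult.commute)
      have Lp: "Lp_norm p (haar_comb \<sigma> F (\<lambda>I. r *\<^sub>R y I)) = r * grid_avg N (\<lambda>t. norm (haar_comb \<sigma> F y t) powr p) powr (1 / p)"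
        if "\<sigma> ` F \<subseteq> dyadic_below N" for \<sigma> and y :: "real set \<Rightarrow> 'a"
      proof -
        have "norm (haar_comb \<sigma> F (\<lambda>I. r *\<^sub>R y I) t) powr p = r powr p * norm (haar_comb \<sigma> F y t) powr p" for t
          unfolding scale using r(1) by (simp add: powr_mult)
        then have "Lp_norm p (haar_comb \<sigma> F (\<lambda>I. r *\<^sub>R y I)) = (r powr p * grid_avg N (\<lambda>t. norm (haar_comb \<sigma> F y t) powr p)) powr (1 / p)"
          unfolding Lp_norm_haar_comb[OF that] grid_avg_cmult[symmetric] by (simp only:)
        also have "\<dots> = (r powr p) powr (1 / p) * grid_avg N (\<lambda>t. norm (haar_comb \<sigma> F y t) powr p) powr (1 / p)"
          by (rule powr_mult)
        also have "(r powr p) powr (1 / p) = r"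
          using p r(1) by (simp add: powr_powr)
        finally show ?thesis .
      qed
      have "finite_family a"
        unfolding finite_family_def by (rule finite_subset[OF _ F(1)]) (auto simp: a_def)
      moreover have "Lp_norm p (haar_sum p id a) \<le> 1"
        unfolding id using Lp[of id x] F(2) r(2) by (simp add: \<alpha>_def f_def)
      ultimately have "Lp_norm p (haar_sum p \<tau> a) \<le> B"
        by (rule B)
      then show ?thesis
        unfolding tau Lp[OF F(3)] by (simp add: \<beta>_def g_def)
    qed
    have "\<beta> powr (1 / p) \<le> B * \<alpha> powr (1 / p)"
    proof (rule field_le_epsilon)
      fix e :: real assume e: "0 < e"
      define d where "d = \<alpha> powr (1 / p) + e / (B + 1)"
      have d: "0 < d" "\<alpha> powr (1 / p) \<le> d"
        using e B0 by (auto simp: d_def intro: add_nonneg_pos)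
      have "1 / d * \<beta> powr (1 / p) \<le> B"
        using d by (intro main) auto
      then have "\<beta> powr (1 / p) \<le> B * d"
        using d by (simp add: field_simps)
      also have "\<dots> = B * \<alpha> powr (1 / p) + B / (B + 1) * e"
        by (simp add: d_def distrib_left)
      also have "B / (B + 1) * e \<le> 1 * e"
        using B0 e by (intro mult_right_mono) auto
      finally show "\<beta> powr (1 / p) \<le> B * \<alpha> powr (1 / p) + e"
        by simp
    qed
    then have "(\<beta> powr (1 / p)) powr p \<le> (B * \<alpha> powr (1 / p)) powr p"
      by (rule powr_mono2[rotated 2]) (use p in auto)
    also have "\<dots> = B powr p * (\<alpha> powr (1 / p)) powr p"
      by (rule powr_mult)
    finally show "grid_avg N (\<lambda>t. norm (haar_comb \<tau> F (\<lambda>I. ratio \<tau> I powr (1 / p) *\<^sub>R x I) t) powr p)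
      \<le> B powr p * grid_avg N (\<lambda>t. norm (haar_comb id F x t) powr p)"
      using p ab by (simp add: powr_powr \<alpha>_def \<beta>_def f_def g_def)
  qed
  then show thesis
    by (intro that) auto
qed

lemma dyadic_below_mono: "M \<le> N \<Longrightarrow> dyadic_below M \<subseteq> dyadic_below N"
  unfolding dyadic_below_def by (intro UN_mono) auto

lemma finite_dyadic_below:
  assumes "finite F" "F \<subseteq> dyadic"
  shows "\<exists>N. F \<subseteq> dyadic_below N"
  using assms
proof (induction F rule: finite_induct)
  case (insert I F)
  then obtain N k where N: "F \<subseteq> dyadic_below N" "I \<in> dyadic_level k"
    by (auto simp: dyadic_def)
  have "dyadic_below N \<subseteq> dyadic_below (max N (Suc k))"
    by (rule dyadic_below_mono) simp
  moreover have "I \<in> dyadic_below (max N (Suc k))"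
    unfolding dyadic_below_def using N(2) by (intro UN_I[of k]) auto
  ultimately show ?case
    using N(1) by blast
qed simp

lemma grid_bounded_imp_rearrangement_bounded:
  assumes p: "0 < p" and tau: "\<And>I. I \<in> dyadic \<Longrightarrow> \<tau> I \<in> dyadic"
    and D: "0 \<le> D" and bdd: "grid_bounded TYPE('a::banach) p \<tau> D"
  shows "rearrangement_bounded TYPE('a) p \<tau>"
  unfolding rearrangement_bounded_def
proof (rule bdd_aboveI)
  fix v assume "v \<in> {Lp_norm p (haar_sum p \<tau> a) | a :: real set \<Rightarrow> 'a. finite_family a \<and> Lp_norm p (haar_sum p id a) \<le> 1}"
  then obtain a :: "real set \<Rightarrow> 'a" where v: "v = Lp_norm p (haar_sum p \<tau> a)"
    and a: "finite_family a" "Lp_norm p (haar_sum p id a) \<le> 1"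
    by blast
  define F where "F = {I\<in>dyadic. a I \<noteq> 0}"
  have F: "finite F" "F \<subseteq> dyadic"
    using a by (auto simp: F_def finite_family_def)
  obtain N1 N2 where "F \<subseteq> dyadic_below N1" "\<tau> ` F \<subseteq> dyadic_below N2"
    using finite_dyadic_below[of F] finite_dyadic_below[of "\<tau> ` F"] F tau by (metis finite_imageI image_subset_iff subsetD)
  then obtain N where N: "F \<subseteq> dyadic_below N" "\<tau> ` F \<subseteq> dyadic_below N"
    using dyadic_below_mono[of N1 "max N1 N2"] dyadic_below_mono[of N2 "max N1 N2"] by (meson max.cobounded1 max.cobounded2 order_trans)
  define x where "x I = (1 / measure lborel I powr (1 / p)) *\<^sub>R a I" for I
  have id: "haar_sum p id a = haar_comb id F x"
    by (rule haar_sum_eq_haar_comb) (use F in \<open>auto simp: F_def x_def\<close>)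
  have tau: "haar_sum p \<tau> a = haar_comb \<tau> F (\<lambda>I. ratio \<tau> I powr (1 / p) *\<^sub>R x I)"
  proof (rule haar_sum_eq_haar_comb)
    fix I assume "I \<in> F"
    then have "I \<in> dyadic" "0 < measure lborel I"
      using F emeasure_dyadic(2) by auto
    then show "ratio \<tau> I powr (1 / p) *\<^sub>R x I = (1 / measure lborel (\<tau> I) powr (1 / p)) *\<^sub>R a I"
      by (simp add: x_def ratio_powr[symmetric])
  qed (use F in \<open>auto simp: F_def\<close>)
  let ?f = "grid_avg N (\<lambda>t. norm (haar_comb id F x t) powr p)"
  have f0: "0 \<le> ?f"
    by (rule grid_avg_nonneg) simp
  have "v = grid_avg N (\<lambda>t. norm (haar_comb \<tau> F (\<lambda>I. ratio \<tau> I powr (1 / p) *\<^sub>R x I) t) powr p) powr (1 / p)"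
    unfolding v tau by (rule Lp_norm_haar_comb[OF N(2)])
  also have "\<dots> \<le> (D * ?f) powr (1 / p)"
    using bdd F N p unfolding grid_bounded_def by (intro powr_mono2 grid_avg_nonneg) auto
  also have "\<dots> = D powr (1 / p) * ?f powr (1 / p)"
    by (rule powr_mult)
  also have "?f powr (1 / p) = Lp_norm p (haar_sum p id a)"
    unfolding id using N(1) by (intro Lp_norm_haar_comb[symmetric]) simp
  also have "D powr (1 / p) * \<dots> \<le> D powr (1 / p) * 1"
    using a by (intro mult_left_mono) auto
  finally show "v \<le> D powr (1 / p) * 1" .
qed

section \<open>Norms of Haar sums restricted to a stratum\<close>

lemma min_on_attained:
  assumes "t \<in> I" "t \<in> grid N"
  obtains s where "s \<in> I" "s \<in> grid N" "min_on N \<phi> I = \<phi> s"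
proof -
  have "min_on N \<phi> I \<in> \<phi> ` (I \<inter> grid N)"
    unfolding min_on_def using assms by (intro Min_in) auto
  then show thesis
    using that by blast
qed

lemma min_on_antimono:
  assumes "t \<in> I" "t \<in> grid N" "I \<subseteq> J"
  shows "min_on N \<phi> J \<le> min_on N \<phi> I"
  unfolding min_on_def using assms by (intro Min_antimono) auto

text \<open>A nonzero coefficient forces a jump of the path norm at every point of its interval.\<close>

lemma (in path_norm) min_on_pmax_pos:
  assumes "I \<in> dyadic_below N" "x I \<noteq> 0"
  shows "0 < min_on N (\<lambda>t. pmax N \<nu> (haar_path x t)) I"
proof -
  obtain k where k: "k < N" "I \<in> dyadic_level k"
    using assms(1) by (auto simp: dyadic_below_def)
  obtain t where "t \<in> I" "t \<in> grid k"
    using dyadic_level_nonempty[OF k(2)] by blast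
  then have t: "t \<in> I" "t \<in> grid N"
    using grid_mono[of k N] k(1) by auto
  obtain s where s: "s \<in> I" "s \<in> grid N" "min_on N (\<lambda>t. pmax N \<nu> (haar_path x t)) I = pmax N \<nu> (haar_path x s)"
    using min_on_attained[OF t] by metis
  have "I = dint k s"
    using k(2) s(1) by (rule dyadic_level_eq_dint)
  then have "0 < norm (haar_path x s k)"
    using assms(2) norm_haar_path[of s x k] s(2) by (simp add: mem_grid_iff)
  also have "\<dots> \<le> 2 * pmax N \<nu> (haar_path x s)"
    using k(1) by (rule norm_le_pmax)
  finally show ?thesis
    using s(3) by simp
qed

text \<open>At the point \<open>t\<close>, the selected intervals that contain \<open>t\<close> form a part of
the branch down to the smallest of them. By the contraction principle the multipliers and the omitted intervals
cost only the factor \<open>M\<close>, and the norm of the branch down to the smallest selected interval is at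
most its height, since it is the same at all points of that interval.\<close>

lemma (in sign_invariant_path_norm) haar_path_restrict_le:
  fixes x :: "real set \<Rightarrow> 'a"
  assumes t: "t \<in> grid N" and c: "\<And>I. I \<in> S \<Longrightarrow> \<bar>c I\<bar> \<le> M"
    and L: "\<And>I. I \<in> S \<Longrightarrow> min_on N (\<lambda>t. \<nu> (haar_path x t)) I \<le> L" and M: "0 \<le> M"
  shows "\<nu> (haar_path (\<lambda>I. if I \<in> S then c I *\<^sub>R x I else 0) t) \<le> M * L * of_bool (t \<in> \<Union>S)"
proof -
  have t01: "0 \<le> t" "t < 1"
    using t by (auto simp: mem_grid_iff)
  let ?y = "\<lambda>I. if I \<in> S then c I *\<^sub>R x I else 0"
  let ?K = "{k. k < N \<and> dint k t \<in> S}"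
  show ?thesis
  proof (cases "?K = {}")
    case True
    then have "\<nu> (haar_path ?y t) = \<nu> (\<lambda>k. 0)"
      by (intro cong) (auto simp: haar_path_def)
    moreover have "0 \<le> L" if ti: "t \<in> I" and IS: "I \<in> S" for I
    proof -
      obtain s where "min_on N (\<lambda>t. \<nu> (haar_path x t)) I = \<nu> (haar_path x s)"
        using min_on_attained[OF ti t] by metis
      then show ?thesis
        using L[OF IS] nonneg[of "haar_path x s"] by simp
    qed
    ultimately show ?thesis
      using M by auto
  next
    case False
    define i where "i = Max ?K"
    have "i \<in> ?K"
      unfolding i_def using False by (intro Max_in) auto
    then have i: "i < N" "dint i t \<in> S"
      by auto
    have i_max: "k \<le> i" if "k < N" "dint k t \<in> S" for k
      unfolding i_def using that by (intro Max_ge) auto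
    obtain s where s: "s \<in> dint i t" "s \<in> grid N" "min_on N (\<lambda>t. \<nu> (haar_path x t)) (dint i t) = \<nu> (haar_path x s)"
      using min_on_attained[OF dint_self t] by metis
    define d where "d k = (if dint k t \<in> S then c (dint k t) / M else 0)" for k
    have d: "\<bar>d k\<bar> \<le> 1" for k
      using c[of "dint k t"] M by (auto simp: d_def divide_le_eq_1 abs_divide)
    have cM: "c (dint k t) = M * d k" if "dint k t \<in> S" for k
      using c[OF that] that by (cases "M = 0") (auto simp: d_def)
    have "\<nu> (haar_path ?y t) = \<nu> (\<lambda>k. M *\<^sub>R (d k *\<^sub>R trunc (Suc i) (haar_path x t) k))"
    proof (rule cong)
      fix k assume k: "k < N"
      show "haar_path ?y t k = M *\<^sub>R (d k *\<^sub>R trunc (Suc i) (haar_path x t) k)"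
      proof (cases "dint k t \<in> S")
        case True
        then show ?thesis
          using i_max[OF k True] cM[OF True] by (simp add: haar_path_def trunc_def mult_ac)
      qed (simp add: haar_path_def d_def)
    qed
    also have "\<dots> = M * \<nu> (\<lambda>k. d k *\<^sub>R trunc (Suc i) (haar_path x t) k)"
      unfolding scale using M by simp
    also have "\<dots> \<le> M * \<nu> (trunc (Suc i) (haar_path x t))"
      using M d by (intro mult_left_mono contraction) auto
    also have "\<nu> (trunc (Suc i) (haar_path x t)) = \<nu> (trunc (Suc i) (haar_path x s))"
    proof -
      have eq: "trunc i (haar_path x s) = trunc i (haar_path x t)"
        by (rule trunc_haar_path_cong[OF t01 s(1) order_refl])
      have lt: "haar_path x s k = haar_path x t k" if "k < i" for k
        using fun_cong[OF eq, of k] that by (simp add: trunc_def)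
      from haar_path_eq_or_minus[OF t01 s(1), of x] show ?thesis
      proof
        assume "haar_path x s i = haar_path x t i"
        then have "trunc (Suc i) (haar_path x s) = trunc (Suc i) (haar_path x t)"
          using lt by (auto simp: trunc_def less_Suc_eq)
        then show ?thesis
          by simp
      next
        assume m: "haar_path x s i = - haar_path x t i"
        have "trunc (Suc i) (haar_path x s) = (trunc (Suc i) (haar_path x t))(i := - trunc (Suc i) (haar_path x t) i)"
          using lt m by (auto simp: trunc_def less_Suc_eq)
        then show ?thesis
          by (simp only: flip)
      qed
    qed
    also have "M * \<dots> \<le> M * L"
      using M trunc_le[of "Suc i" "haar_path x s"] L[OF i(2)] s(3) by (intro mult_left_mono) auto
    finally show ?thesis
      using i(2) dint_self[of t i] by auto
  qed
qed

text \<open>Without sign invariance, intervals can be omitted only at the two ends of a branch: the convexity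
hypothesis says that the selection is a segment, and a segment is the difference of two truncations.\<close>

lemma (in path_norm) haar_path_restrict_max_le:
  fixes x :: "real set \<Rightarrow> 'a"
  assumes t: "t \<in> grid N"
    and convex: "\<And>i j k. i \<le> j \<Longrightarrow> j \<le> k \<Longrightarrow> k < N \<Longrightarrow> dint i t \<in> S \<Longrightarrow> dint k t \<in> S \<Longrightarrow> x (dint j t) \<noteq> 0 \<Longrightarrow> dint j t \<in> S"
    and L: "\<And>I. I \<in> S \<Longrightarrow> min_on N (\<lambda>t. pmax N \<nu> (haar_path x t)) I \<le> L"
  shows "\<nu> (haar_path (\<lambda>I. if I \<in> S then x I else 0) t) \<le> 6 * L * of_bool (t \<in> \<Union>S)"
proof -
  have t01: "0 \<le> t" "t < 1"
    using t by (auto simp: mem_grid_iff)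
  let ?y = "\<lambda>I. if I \<in> S then x I else 0"
  let ?K = "{k. k < N \<and> dint k t \<in> S}"
  show ?thesis
  proof (cases "?K = {}")
    case True
    then have "\<nu> (haar_path ?y t) = \<nu> (\<lambda>k. 0)"
      by (intro cong) (auto simp: haar_path_def)
    moreover have "0 \<le> L" if ti: "t \<in> I" and IS: "I \<in> S" for I
    proof -
      obtain s where "min_on N (\<lambda>t. pmax N \<nu> (haar_path x t)) I = pmax N \<nu> (haar_path x s)"
        using min_on_attained[OF ti t] by metis
      then show ?thesis
        using L[OF IS] pmax_nonneg[of N "haar_path x s"] by simp
    qed
    ultimately show ?thesis
      by auto
  next
    case False
    define i where "i = Min ?K"
    define k where "k = Max ?K"
    have "i \<in> ?K" "k \<in> ?K"
      unfolding i_def k_def using False by (intro Min_in Max_in; auto)+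
    then have i: "i < N" "dint i t \<in> S" and k: "k < N" "dint k t \<in> S"
      by auto
    have range: "i \<le> j \<and> j \<le> k" if "j < N" "dint j t \<in> S" for j
      unfolding i_def k_def using that by (intro conjI Min_le Max_ge) auto
    obtain s where s: "s \<in> dint k t" "s \<in> grid N" "min_on N (\<lambda>t. pmax N \<nu> (haar_path x t)) (dint k t) = pmax N \<nu> (haar_path x s)"
      using min_on_attained[OF dint_self t] by metis
    have le: "\<nu> (trunc n (haar_path x t)) \<le> 3 * L" if "n \<le> Suc k" for n
      using trunc_Suc_le_pmax[OF t01 s(1) k(1) that, of x] L[OF k(2)] s(3) by simp
    have "\<nu> (haar_path ?y t) = \<nu> (\<lambda>j. trunc (Suc k) (haar_path x t) j - trunc i (haar_path x t) j)"
    proof (rule cong)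
      fix j assume j: "j < N"
      show "haar_path ?y t j = trunc (Suc k) (haar_path x t) j - trunc i (haar_path x t) j"
      proof (cases "i \<le> j \<and> j \<le> k")
        case True
        then show ?thesis
          using convex[of i j k] i k by (auto simp: haar_path_def trunc_def)
      next
        case False
        then have "dint j t \<notin> S"
          using range[OF j] by blast
        then show ?thesis
          using False range[OF i] by (auto simp: haar_path_def trunc_def)
      qed
    qed
    also have "\<dots> \<le> \<nu> (trunc (Suc k) (haar_path x t)) + \<nu> (trunc i (haar_path x t))"
      by (rule triangle_diff)
    also have "\<dots> \<le> 6 * L"
      using le[of "Suc k"] le[of i] range[OF i] by simp
    finally show ?thesis
      using i(2) dint_self[of t i] by auto
  qed
qed

section \<open>Extrapolation of the rearrangement operator\<close>

context carleson_bijection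
begin

text \<open>The part common to both cases. What is left to provide is a function \<open>\<phi>\<close> that
controls heights, is bounded in \<open>L^q\<close> by the Haar sum, and bounds the part of every output level
before the rearrangement in \<open>L^p\<close>.\<close>

lemma grid_bounded_extrapolation:
  fixes \<phi> :: "nat \<Rightarrow> (real set \<Rightarrow> 'a::banach) \<Rightarrow> real \<Rightarrow> real" and p q C E :: real
  assumes q: "0 < q" and qp: "q < p" and C: "0 \<le> C" and E: "0 \<le> E" and B: "0 \<le> B"
    and bdd: "grid_bounded TYPE('a) p \<tau> B"
    and avg: "\<And>N x. grid_avg N (\<lambda>t. \<phi> N x t powr q) \<le> E * grid_avg N (\<lambda>t. norm (\<Sum>k<N. haar_path x t k) powr q)"
    and pos: "\<And>N x I. I \<in> dyadic_below N \<Longrightarrow> x I \<noteq> 0 \<Longrightarrow> 0 < min_on N (\<phi> N x) I"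
    and level: "\<And>N F x n. finite F \<Longrightarrow> F \<subseteq> dyadic_below N \<Longrightarrow> (\<And>I. x I \<noteq> 0 \<longleftrightarrow> I \<in> F) \<Longrightarrow>
      grid_avg N (\<lambda>t. norm (\<Sum>k<N. haar_path (\<lambda>I. if I \<in> level_set q N (\<phi> N x) \<tau> F n
          then ratio \<tau> I powr (1 / q - 1 / p) *\<^sub>R x I else 0) t k) powr p)
        \<le> C * 2 powr (p * n) * level_mass q N (\<phi> N x) \<tau> F n"
  shows "\<exists>D\<ge>0. grid_bounded TYPE('a) q \<tau> D"
proof -
  have BC: "0 \<le> B * C"
    using B C by simp
  define D where "D = endpoint_const q p * ((A + B * C) * (24 * A\<^sup>2 / (1 - 2 powr - q)))"
  have "(2::real) powr - q < 1"
    using q by (auto simp: powr_less_one)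
  then have D: "0 \<le> D"
    using A BC by (simp add: D_def endpoint_const_def)
  have "grid_bounded TYPE('a) q \<tau> (D * E)"
    unfolding grid_bounded_def
  proof (intro allI impI)
    fix N F0 and x0 :: "real set \<Rightarrow> 'a"
    assume F0: "finite F0" "F0 \<subseteq> dyadic_below N" "\<tau> ` F0 \<subseteq> dyadic_below N"
    define x where "x I = (if I \<in> F0 then x0 I else 0)" for I
    define F where "F = {I\<in>F0. x I \<noteq> 0}"
    have F: "finite F" "F \<subseteq> dyadic_below N" "\<tau> ` F \<subseteq> dyadic_below N" and xF: "x I \<noteq> 0 \<longleftrightarrow> I \<in> F" for I
      using F0 by (auto simp: F_def x_def)
    define w where "w I = ratio \<tau> I powr (1 / q - 1 / p)" for I
    have comb: "haar_comb \<tau> F0 (\<lambda>I. ratio \<tau> I powr (1 / q) *\<^sub>R x0 I) t = (\<Sum>I\<in>F. haar (\<tau> I) t *\<^sub>R ratio \<tau> I powr (1 / q) *\<^sub>R x I)" for t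
      unfolding haar_comb_def using F0(1) by (intro sum.mono_neutral_cong_right) (auto simp: F_def x_def)
    have "grid_avg N (\<lambda>t. norm (haar_comb \<tau> F0 (\<lambda>I. ratio \<tau> I powr (1 / q) *\<^sub>R x0 I) t) powr q) \<le> D * grid_avg N (\<lambda>t. \<phi> N x t powr q)"
      unfolding comb D_def
    proof (rule stratified_interpolation[OF q qp BC F])
      fix I assume "I \<in> F"
      then show "0 < min_on N (\<phi> N x) I"
        using F(2) xF by (intro pos) auto
    next
      fix n
      define S where "S = level_set q N (\<phi> N x) \<tau> F n"
      define y where "y I = (if I \<in> S then w I *\<^sub>R x I else 0)" for I
      define R where "R = 2 powr (p * n) * level_mass q N (\<phi> N x) \<tau> F n"
      have S: "finite S" "S \<subseteq> dyadic_below N" "\<tau> ` S \<subseteq> dyadic_below N"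
        using F by (auto simp: S_def)
      have tau: "(\<Sum>I\<in>S. haar (\<tau> I) t *\<^sub>R ratio \<tau> I powr (1 / q) *\<^sub>R x I) = haar_comb \<tau> S (\<lambda>I. ratio \<tau> I powr (1 / p) *\<^sub>R (w I *\<^sub>R x I)) t" for t
      proof -
        have "ratio \<tau> I powr (1 / p) * w I = ratio \<tau> I powr (1 / q)" for I
          by (simp add: w_def flip: powr_add)
        then show ?thesis
          by (simp add: haar_comb_def)
      qed
      have id: "haar_comb id S (\<lambda>I. w I *\<^sub>R x I) t = (\<Sum>k<N. haar_path y t k)" if "t \<in> grid N" for t
      proof (rule haar_comb_id_eq_sum_haar_path[OF S(1,2)])
        show "0 \<le> t" "t < 1"
          using that by (auto simp: mem_grid_iff)
      qed (simp_all add: y_def)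
      have "grid_avg N (\<lambda>t. norm (haar_comb id S (\<lambda>I. w I *\<^sub>R x I) t) powr p) = grid_avg N (\<lambda>t. norm (\<Sum>k<N. haar_path y t k) powr p)"
        unfolding grid_avg_def using id by (simp cong: sum.cong)
      also have "\<dots> \<le> C * R"
        unfolding y_def S_def w_def R_def mult.assoc[symmetric] by (rule level[OF F(1,2) xF])
      finally have "B * grid_avg N (\<lambda>t. norm (haar_comb id S (\<lambda>I. w I *\<^sub>R x I) t) powr p) \<le> B * (C * R)"
        using B by (rule mult_left_mono)
      moreover have "grid_avg N (\<lambda>t. norm (haar_comb \<tau> S (\<lambda>I. ratio \<tau> I powr (1 / p) *\<^sub>R (w I *\<^sub>R x I)) t) powr p)
          \<le> B * grid_avg N (\<lambda>t. norm (haar_comb id S (\<lambda>I. w I *\<^sub>R x I) t) powr p)"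
        using bdd[unfolded grid_bounded_def, rule_format, OF S] .
      ultimately have "grid_avg N (\<lambda>t. norm (\<Sum>I\<in>S. haar (\<tau> I) t *\<^sub>R ratio \<tau> I powr (1 / q) *\<^sub>R x I) powr p) \<le> B * (C * R)"
        unfolding tau by linarith
      then show "grid_avg N (\<lambda>t. norm (\<Sum>I\<in>level_set q N (\<phi> N x) \<tau> F n. haar (\<tau> I) t *\<^sub>R ratio \<tau> I powr (1 / q) *\<^sub>R x I) powr p)
        \<le> B * C * 2 powr (p * n) * level_mass q N (\<phi> N x) \<tau> F n"
        unfolding S_def R_def by (simp only: mult.assoc)
    qed
    also have "\<dots> \<le> D * (E * grid_avg N (\<lambda>t. norm (\<Sum>k<N. haar_path x t k) powr q))"
      using D by (intro mult_left_mono avg)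
    also have "grid_avg N (\<lambda>t. norm (\<Sum>k<N. haar_path x t k) powr q) = grid_avg N (\<lambda>t. norm (haar_comb id F0 x0 t) powr q)"
    proof -
      have "haar_comb id F0 x0 t = (\<Sum>k<N. haar_path x t k)" if "t \<in> grid N" for t
      proof (rule haar_comb_id_eq_sum_haar_path[OF F0(1,2)])
        show "0 \<le> t" "t < 1"
          using that by (auto simp: mem_grid_iff)
      qed (simp_all add: x_def)
      then show ?thesis
        unfolding grid_avg_def by (simp cong: sum.cong)
    qed
    finally show "grid_avg N (\<lambda>t. norm (haar_comb \<tau> F0 (\<lambda>I. ratio \<tau> I powr (1 / q) *\<^sub>R x0 I) t) powr q)
        \<le> D * E * grid_avg N (\<lambda>t. norm (haar_comb id F0 x0 t) powr q)"
      by (simp only: mult.assoc)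
  qed
  then show ?thesis
    using D E by (intro exI[of _ "D * E"]) auto
qed

text \<open>All length ratios are \<open>1\<close>, so an output level is a single class of heights. Along a
branch it is a segment, because heights increase along branches, and the martingale maximal function serves as
\<open>\<phi>\<close>.\<close>

lemma grid_bounded_extrapolation_isometric:
  assumes q: "1 < q" and qp: "q < p" and B: "0 \<le> B" and bdd: "grid_bounded TYPE('a::banach) p \<tau> B"
    and iso: "\<And>I. I \<in> dyadic \<Longrightarrow> measure lborel (\<tau> I) = measure lborel I"
  shows "\<exists>D\<ge>0. grid_bounded TYPE('a) q \<tau> D"
proof -
  define \<nu> where "\<nu> N y = norm (\<Sum>k<N. y k)" for N and y :: "nat \<Rightarrow> 'a"
  have pn: "path_norm N (\<nu> N)" for N
    unfolding \<nu>_def by (rule path_norm_sum)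
  define \<phi> where "\<phi> N x t = pmax N (\<nu> N) (haar_path x t)" for N x t
  have p: "0 < p"
    using q qp by simp
  have ratio: "ratio \<tau> I = 1" if "I \<in> dyadic" for I
    using iso[OF that] emeasure_dyadic(2)[OF that] by (simp add: ratio_def)
  show ?thesis
  proof (rule grid_bounded_extrapolation[where \<phi> = \<phi> and C = "12 powr p" and E = "(2 * (q / (q - 1))) powr q", OF _ qp _ _ B bdd])
    fix N and x :: "real set \<Rightarrow> 'a"
    show "grid_avg N (\<lambda>t. \<phi> N x t powr q) \<le> (2 * (q / (q - 1))) powr q * grid_avg N (\<lambda>t. norm (\<Sum>k<N. haar_path x t k) powr q)"
      using path_norm.doob_inequality[OF pn q, of N x]
      by (simp add: grid_avg_def \<phi>_def \<nu>_def divide_right_mono)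
    fix I assume I: "I \<in> dyadic_below N" "x I \<noteq> 0"
    then show "0 < min_on N (\<phi> N x) I"
      unfolding \<phi>_def by (rule path_norm.min_on_pmax_pos[OF pn])
  next
    fix N F and x :: "real set \<Rightarrow> 'a" and n :: int
    assume F: "finite F" "F \<subseteq> dyadic_below N" and xF: "\<And>I. x I \<noteq> 0 \<longleftrightarrow> I \<in> F"
    define S where "S = level_set q N (\<phi> N x) \<tau> F n"
    let ?R = "level_mass q N (\<phi> N x) \<tau> F n"
    have dy: "I \<in> dyadic" if "I \<in> F" for I
      using that F dyadic_below_dyadic by blast
    have index: "stratum_index N (\<phi> N x) \<tau> I = (\<lfloor>log 2 (min_on N (\<phi> N x) I)\<rfloor>, 0)" if "I \<in> F" for I
      using ratio[OF dy[OF that]] by (simp add: stratum_index_def)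
    have S: "I \<in> S \<longleftrightarrow> I \<in> F \<and> \<lfloor>log 2 (min_on N (\<phi> N x) I)\<rfloor> = n" for I
      by (auto simp: S_def index output_level_def)
    have pos: "0 < min_on N (\<phi> N x) I" if "I \<in> F" for I
      unfolding \<phi>_def using that F(2) xF by (intro path_norm.min_on_pmax_pos[OF pn]) auto
    have gm: "grid_measure N (\<Union>S) \<le> ?R"
    proof (cases "S = {}")
      case True
      have "0 \<le> ?R"
        by (intro sum_nonneg mult_nonneg_nonneg) simp_all
      then show ?thesis
        by (simp add: True grid_measure_def)
    next
      case False
      then obtain I where I: "I \<in> F" "\<lfloor>log 2 (min_on N (\<phi> N x) I)\<rfloor> = n"
        using S by blast
      have "(n, 0) \<in> {km\<in>stratum_index N (\<phi> N x) \<tau> ` F. output_level q km = n}"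
        using I index[OF I(1)] by (auto simp: output_level_def image_iff intro!: bexI[of _ I])
      then have "4 powr real_of_int (- snd (n, 0 :: int)) * grid_measure N (\<Union>{I\<in>F. stratum_index N (\<phi> N x) \<tau> I = (n, 0)}) \<le> ?R"
        using F(1) by (intro member_le_sum) auto
      moreover have "{I\<in>F. stratum_index N (\<phi> N x) \<tau> I = (n, 0)} = S"
        using index S by auto
      ultimately show ?thesis
        by simp
    qed
    have "grid_avg N (\<lambda>t. norm (\<Sum>k<N. haar_path (\<lambda>I. if I \<in> S then ratio \<tau> I powr (1 / q - 1 / p) *\<^sub>R x I else 0) t k) powr p)
        \<le> grid_avg N (\<lambda>t. 12 powr p * 2 powr (p * n) * of_bool (t \<in> \<Union>S))"
    proof (rule grid_avg_mono)
      fix t assume t: "t \<in> grid N"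
      have "(\<lambda>I. if I \<in> S then ratio \<tau> I powr (1 / q - 1 / p) *\<^sub>R x I else 0) = (\<lambda>I. if I \<in> S then x I else 0)"
        using ratio dy S by auto
      moreover have "\<nu> N (haar_path (\<lambda>I. if I \<in> S then x I else 0) t) \<le> 6 * (2 * 2 powr n) * of_bool (t \<in> \<Union>S)"
      proof (rule path_norm.haar_path_restrict_max_le[OF pn t])
        fix i j k assume ijk: "i \<le> j" "j \<le> k" "k < N" "dint i t \<in> S" "dint k t \<in> S" "x (dint j t) \<noteq> 0"
        have j: "dint j t \<in> F"
          using ijk(6) xF by blast
        have "dint k t \<subseteq> dint j t" "dint j t \<subseteq> dint i t"
          using dint_antimono ijk(1,2) by blast+
        then have "min_on N (\<phi> N x) (dint i t) \<le> min_on N (\<phi> N x) (dint j t)" "min_on N (\<phi> N x) (dint j t) \<le> min_on N (\<phi> N x) (dint k t)"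
          using t by (auto intro: min_on_antimono[OF dint_self])
        moreover have "\<lfloor>log 2 a\<rfloor> \<le> \<lfloor>log 2 b\<rfloor>" if "0 < a" "a \<le> b" for a b :: real
          using that by (intro floor_mono) simp
        ultimately have "\<lfloor>log 2 (min_on N (\<phi> N x) (dint i t))\<rfloor> \<le> \<lfloor>log 2 (min_on N (\<phi> N x) (dint j t))\<rfloor>"
          "\<lfloor>log 2 (min_on N (\<phi> N x) (dint j t))\<rfloor> \<le> \<lfloor>log 2 (min_on N (\<phi> N x) (dint k t))\<rfloor>"
          using pos[of "dint i t"] pos[OF j] ijk(4,5) S by blast+
        then show "dint j t \<in> S"
          using ijk(4,5) S j by auto
      next
        fix I assume "I \<in> S"
        then have "min_on N (\<phi> N x) I \<le> 2 * 2 powr n"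
          using floor_log_bounds(2)[of 2 "min_on N (\<phi> N x) I"] pos S by force
        then show "min_on N (\<lambda>t. pmax N (\<nu> N) (haar_path x t)) I \<le> 2 * 2 powr n"
          by (simp add: \<phi>_def[abs_def])
      qed
      ultimately have "norm (\<Sum>k<N. haar_path (\<lambda>I. if I \<in> S then ratio \<tau> I powr (1 / q - 1 / p) *\<^sub>R x I else 0) t k)
          \<le> 12 * 2 powr n * of_bool (t \<in> \<Union>S)"
        by (simp add: \<nu>_def)
      then have "norm (\<Sum>k<N. haar_path (\<lambda>I. if I \<in> S then ratio \<tau> I powr (1 / q - 1 / p) *\<^sub>R x I else 0) t k) powr p
          \<le> (12 * 2 powr n * of_bool (t \<in> \<Union>S)) powr p"
        by (rule powr_mono2[rotated 2]) (use p in auto)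
      also have "\<dots> = 12 powr p * 2 powr (p * n) * of_bool (t \<in> \<Union>S)"
        using p by (simp add: powr_mult powr_powr mult.commute)
      finally show "norm (\<Sum>k<N. haar_path (\<lambda>I. if I \<in> S then ratio \<tau> I powr (1 / q - 1 / p) *\<^sub>R x I else 0) t k) powr p
          \<le> 12 powr p * 2 powr (p * n) * of_bool (t \<in> \<Union>S)" .
    qed
    also have "\<dots> = 12 powr p * 2 powr (p * n) * grid_measure N (\<Union>S)"
      by (simp only: grid_avg_cmult grid_avg_of_bool)
    also have "\<dots> \<le> 12 powr p * 2 powr (p * n) * ?R"
      by (intro mult_left_mono gm) simp
    finally show "grid_avg N (\<lambda>t. norm (\<Sum>k<N. haar_path (\<lambda>I. if I \<in> level_set q N (\<phi> N x) \<tau> F n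
          then ratio \<tau> I powr (1 / q - 1 / p) *\<^sub>R x I else 0) t k) powr p) \<le> 12 powr p * 2 powr (p * n) * ?R"
      unfolding S_def .
  qed (use q in auto)
qed

end

lemma haar_path_sum:
  "haar_path (\<lambda>I. \<Sum>a\<in>A. y a I) t k = (\<Sum>a\<in>A. haar_path (y a) t k)"
  by (simp add: haar_path_def scaleR_sum_right)

context carleson_bijection
begin

text \<open>Here \<open>\<phi>\<close> is the square function. The part with output level \<open>n\<close> is
split into its strata; for a given \<open>n\<close> there is at most one stratum for each ratio class
\<open>m\<close>, and the square function of this stratum is at most a multiple of \<open>2^n 4^(-m/p)\<close>
on its support. The sum over \<open>m\<close> is geometric, so its \<open>p\<close>-th power is bounded by the
sum of the \<open>p\<close>-th powers. The UMD property enters twice: in \<open>L^p\<close> to pass from the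
square function to the Haar sum, and in \<open>L^q\<close> for the opposite estimate of
\<open>\<phi>\<close>.\<close>

lemma grid_bounded_extrapolation_UMD:
  assumes umd: "UMD_space TYPE('a::banach)" and q: "1 < q" and qp: "q < p" and B: "0 \<le> B"
    and bdd: "grid_bounded TYPE('a) p \<tau> B"
  shows "\<exists>D\<ge>0. grid_bounded TYPE('a) q \<tau> D"
proof -
  have p: "1 < p"
    using q qp by simp
  obtain r c :: real where r: "1 < r" and c: "0 < c"
    and upper: "\<And>N (x :: real set \<Rightarrow> 'a). (\<Sum>t\<in>grid N. rad_norm r N (haar_path x t) powr q)
      \<le> c * (\<Sum>t\<in>grid N. norm (\<Sum>k<N. haar_path x t k) powr q)"
    and lower: "\<And>N (x :: real set \<Rightarrow> 'a). (\<Sum>t\<in>grid N. norm (\<Sum>k<N. haar_path x t k) powr p)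
      \<le> c * (\<Sum>t\<in>grid N. rad_norm r N (haar_path x t) powr p)"
    using umd p q by (rule UMD_space_rad_norm_Lp) (rule that; assumption)
  have rad: "sign_invariant_path_norm N (rad_norm r N :: (nat \<Rightarrow> 'a) \<Rightarrow> real)" for N
    using r by (intro sign_invariant_rad_norm) simp
  have rad': "path_norm N (rad_norm r N :: (nat \<Rightarrow> 'a) \<Rightarrow> real)" for N
    using rad[of N] by (simp add: sign_invariant_path_norm_def)
  define \<phi> where "\<phi> N x t = rad_norm r N (haar_path x t)" for N and x :: "real set \<Rightarrow> 'a" and t
  have pos: "0 < min_on N (\<phi> N x) I" if "I \<in> dyadic_below N" "x I \<noteq> 0" for N x I
    using path_norm.min_on_pmax_pos[where x = x, OF rad' that]
    by (simp add: \<phi>_def[abs_def] sign_invariant_path_norm.pmax_eq[OF rad])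
  define \<delta> where "\<delta> = 1 / q - 1 / p"
  have \<delta>: "0 \<le> \<delta>"
    using q qp by (simp add: \<delta>_def field_simps)
  define M where "M = 4 * 4 powr \<delta>"
  define K where "K = (1 / (1 - 2 powr - (2 / p))) powr p"
  show ?thesis
  proof (rule grid_bounded_extrapolation[where \<phi> = \<phi> and C = "c * (M powr p * K)" and E = c, OF _ qp _ _ B bdd])
    fix N and x :: "real set \<Rightarrow> 'a"
    show "grid_avg N (\<lambda>t. \<phi> N x t powr q) \<le> c * grid_avg N (\<lambda>t. norm (\<Sum>k<N. haar_path x t k) powr q)"
      using upper[where N = N and x = x] by (simp add: grid_avg_def \<phi>_def divide_right_mono)
  next
    fix N and x :: "real set \<Rightarrow> 'a" and I
    assume "I \<in> dyadic_below N" "x I \<noteq> 0"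
    then show "0 < min_on N (\<phi> N x) I"
      by (rule pos)
  next
    fix N F and x :: "real set \<Rightarrow> 'a" and n :: int
    assume F: "finite F" "F \<subseteq> dyadic_below N" and xF: "\<And>I. x I \<noteq> 0 \<longleftrightarrow> I \<in> F"
    define \<kappa> where "\<kappa> = stratum_index N (\<phi> N x) \<tau>"
    define P where "P = {km\<in>\<kappa> ` F. output_level q km = n}"
    define T where "T km = {I\<in>F. \<kappa> I = km}" for km
    define y where "y I = (if I \<in> {I\<in>F. output_level q (\<kappa> I) = n} then ratio \<tau> I powr \<delta> *\<^sub>R x I else 0)" for I
    define z where "z km I = (if I \<in> T km then ratio \<tau> I powr \<delta> *\<^sub>R x I else 0)" for km I
    have P: "finite P"
      using F(1) by (simp add: P_def)
    have yz: "y = (\<lambda>I. \<Sum>km\<in>P. z km I)"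
    proof
      fix I
      show "y I = (\<Sum>km\<in>P. z km I)"
      proof (cases "I \<in> F \<and> output_level q (\<kappa> I) = n")
        case True
        have "(\<Sum>km\<in>P. z km I) = (\<Sum>km\<in>P. if km = \<kappa> I then ratio \<tau> I powr \<delta> *\<^sub>R x I else 0)"
          using True by (intro sum.cong) (auto simp: z_def T_def)
        also have "\<dots> = ratio \<tau> I powr \<delta> *\<^sub>R x I"
          using True P by (simp add: P_def)
        finally show ?thesis
          using True by (simp add: y_def)
      next
        case False
        then have "z km I = 0" if "km \<in> P" for km
          using that by (auto simp: z_def T_def P_def)
        then show ?thesis
          using False by (auto simp: y_def)
      qed
    qed
    have piece: "rad_norm r N (haar_path (z km) t) \<le> M * 2 powr n * 2 powr (- (2 / p * real_of_int (snd km))) * of_bool (t \<in> \<Union>(T km))"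
      if t: "t \<in> grid N" and km: "km \<in> P" for t km
    proof -
      obtain k m where km_eq: "km = (k, m)"
        by (cases km)
      have n: "n = k + \<lfloor>2 * real_of_int m / q\<rfloor>"
        using km by (simp add: P_def output_level_def km_eq)
      have "rad_norm r N (haar_path (z km) t) \<le> (4 * 4 powr m) powr \<delta> * (2 * 2 powr k) * of_bool (t \<in> \<Union>(T km))"
        unfolding z_def
      proof (rule sign_invariant_path_norm.haar_path_restrict_le[OF rad t])
        fix I assume I: "I \<in> T km"
        then have IF: "I \<in> F" and k: "\<lfloor>log 2 (min_on N (\<phi> N x) I)\<rfloor> = k" and m: "\<lfloor>log 4 (ratio \<tau> I)\<rfloor> = m"
          by (auto simp: T_def \<kappa>_def stratum_index_def km_eq)
        have "I \<in> dyadic"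
          using IF F(2) dyadic_below_dyadic by blast
        then have "0 < ratio \<tau> I"
          using emeasure_dyadic(2) dyadic by (simp add: ratio_def)
        then have "0 \<le> ratio \<tau> I" "ratio \<tau> I \<le> 4 * 4 powr m"
          using floor_log_bounds(2)[of 4 "ratio \<tau> I"] by (simp_all add: m)
        then show "\<bar>ratio \<tau> I powr \<delta>\<bar> \<le> (4 * 4 powr m) powr \<delta>"
          using \<delta> by (simp add: powr_mono2)
        have "I \<in> dyadic_below N" "x I \<noteq> 0"
          using IF F(2) xF by auto
        then have "min_on N (\<phi> N x) I \<le> 2 * 2 powr k"
          using floor_log_bounds(2)[of 2 "min_on N (\<phi> N x) I"] pos[of I N x] by (simp add: k)
        then show "min_on N (\<lambda>t. rad_norm r N (haar_path x t)) I \<le> 2 * 2 powr k"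
          by (simp add: \<phi>_def[abs_def])
      qed simp
      also have "\<dots> \<le> M * 2 powr n * 2 powr (- (2 / p * real_of_int (snd km))) * of_bool (t \<in> \<Union>(T km))"
      proof (rule mult_right_mono)
        have "real_of_int k \<le> n - 2 * m / q + 1"
          unfolding n by simp linarith
        then have "2 powr k \<le> 2 powr (n - 2 * m / q + 1)"
          by simp
        moreover have "(4 * 4 powr m) powr \<delta> = 4 powr \<delta> * 2 powr (2 * m * \<delta>)"
        proof -
          have "(4 powr m) powr \<delta> = 2 powr (2 * m * \<delta>)"
            using powr_powr[of 2 2 "m * \<delta>"] by (simp add: powr_powr mult.assoc)
          then show ?thesis
            by (simp add: powr_mult)
        qed
        ultimately have "(4 * 4 powr m) powr \<delta> * (2 * 2 powr k) \<le> 4 powr \<delta> * 2 powr (2 * m * \<delta>) * (2 * 2 powr (n - 2 * m / q + 1))"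
          by (simp add: mult_left_mono)
        also have "\<dots> = 4 powr \<delta> * 2 * 2 powr (2 * m * \<delta> + (n - 2 * m / q + 1))"
          unfolding powr_add by simp
        also have "2 * m * \<delta> + (n - 2 * m / q + 1) = 1 + (n + - (2 / p * m))"
          by (simp add: \<delta>_def algebra_simps)
        also have "4 powr \<delta> * 2 * 2 powr (1 + (n + - (2 / p * m))) = M * 2 powr n * 2 powr (- (2 / p * real_of_int (snd km)))"
          unfolding powr_add by (simp add: M_def km_eq)
        finally show "(4 * 4 powr m) powr \<delta> * (2 * 2 powr k) \<le> M * 2 powr n * 2 powr (- (2 / p * real_of_int (snd km)))" .
      qed simp
      finally show ?thesis .
    qed
    have pointwise: "rad_norm r N (haar_path y t) powr p
        \<le> M powr p * K * 2 powr (p * n) * (\<Sum>km\<in>P. 4 powr real_of_int (- snd km) * of_bool (t \<in> \<Union>(T km)))"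
      if t: "t \<in> grid N" for t
    proof -
      let ?P = "{km\<in>P. t \<in> \<Union>(T km)}"
      have inj: "inj_on snd ?P"
        by (rule inj_onI) (auto simp: P_def output_level_def prod_eq_iff)
      have "rad_norm r N (haar_path y t) = rad_norm r N (\<lambda>k. \<Sum>km\<in>P. haar_path (z km) t k)"
        unfolding yz by (simp only: haar_path_sum[abs_def])
      also have "\<dots> \<le> (\<Sum>km\<in>P. rad_norm r N (haar_path (z km) t))"
        by (rule path_norm.triangle_sum[OF rad' P])
      also have "\<dots> \<le> (\<Sum>km\<in>P. M * 2 powr n * 2 powr (- (2 / p * real_of_int (snd km))) * of_bool (t \<in> \<Union>(T km)))"
        using t by (intro sum_mono piece)
      also have "\<dots> = (\<Sum>km\<in>?P. M * 2 powr n * 2 powr (- (2 / p * real_of_int (snd km))))"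
        using P by (intro sum.mono_neutral_cong_right) auto
      also have "\<dots> = M * 2 powr n * (\<Sum>m\<in>snd ` ?P. 2 powr (- (2 / p * real_of_int m)))"
        using inj by (simp add: sum.reindex sum_distrib_left)
      finally have "rad_norm r N (haar_path y t) powr p \<le> (M * 2 powr n * (\<Sum>m\<in>snd ` ?P. 2 powr (- (2 / p * real_of_int m)))) powr p"
        by (rule powr_mono2[rotated 2]) (use p path_norm.nonneg[OF rad'] in auto)
      also have "\<dots> = M powr p * 2 powr (p * n) * (\<Sum>m\<in>snd ` ?P. 2 powr (- (2 / p * real_of_int m))) powr p"
        by (simp add: powr_mult powr_powr mult.commute)
      also have "\<dots> \<le> M powr p * 2 powr (p * n) * (K * (\<Sum>m\<in>snd ` ?P. 2 powr (- (2 / p * p * real_of_int m))))"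
        unfolding K_def using P p by (intro mult_left_mono powr_sum_geometric_le) auto
      also have "(\<Sum>m\<in>snd ` ?P. 2 powr (- (2 / p * p * real_of_int m))) = (\<Sum>m\<in>snd ` ?P. 4 powr real_of_int (- m))"
      proof (rule sum.cong)
        fix m :: int
        show "2 powr (- (2 / p * p * real_of_int m)) = 4 powr real_of_int (- m)"
          using p powr_powr[of 2 2 "- real_of_int m"] by simp
      qed simp
      also have "\<dots> = (\<Sum>km\<in>?P. 4 powr real_of_int (- snd km))"
        using inj by (simp add: sum.reindex)
      also have "\<dots> = (\<Sum>km\<in>P. 4 powr real_of_int (- snd km) * of_bool (t \<in> \<Union>(T km)))"
        using P by (intro sum.mono_neutral_cong_left) auto
      finally show ?thesis
        by (simp only: mult_ac)
    qed
    have "grid_avg N (\<lambda>t. norm (\<Sum>k<N. haar_path y t k) powr p) \<le> c * grid_avg N (\<lambda>t. rad_norm r N (haar_path y t) powr p)"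
      using lower[where N = N and x = y] by (simp add: grid_avg_def divide_right_mono)
    also have "\<dots> \<le> c * grid_avg N (\<lambda>t. M powr p * K * 2 powr (p * n) * (\<Sum>km\<in>P. 4 powr real_of_int (- snd km) * of_bool (t \<in> \<Union>(T km))))"
      using c by (intro mult_left_mono grid_avg_mono pointwise) auto
    also have "\<dots> = c * (M powr p * K * 2 powr (p * n) * (\<Sum>km\<in>P. 4 powr real_of_int (- snd km) * grid_measure N (\<Union>(T km))))"
      by (simp only: grid_avg_cmult grid_avg_sum grid_avg_of_bool)
    finally have "grid_avg N (\<lambda>t. norm (\<Sum>k<N. haar_path y t k) powr p)
        \<le> c * (M powr p * K) * 2 powr (p * n) * (\<Sum>km\<in>P. 4 powr real_of_int (- snd km) * grid_measure N (\<Union>(T km)))"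
      by (simp only: mult.assoc)
    then show "grid_avg N (\<lambda>t. norm (\<Sum>k<N. haar_path (\<lambda>I. if I \<in> level_set q N (\<phi> N x) \<tau> F n
          then ratio \<tau> I powr (1 / q - 1 / p) *\<^sub>R x I else 0) t k) powr p)
        \<le> c * (M powr p * K) * 2 powr (p * n) * level_mass q N (\<phi> N x) \<tau> F n"
      unfolding y_def P_def T_def \<kappa>_def \<delta>_def .
  qed (use q c in \<open>auto simp: K_def\<close>)
qed

end

theorem corollary5p6:
  fixes \<tau> :: "real set \<Rightarrow> real set" and A p q :: real
  assumes "\<exists>x::'a::complex_banach. x \<noteq> 0"
    and "bij_betw \<tau> dyadic dyadic"
    and "A \<ge> 1"
    and "\<And>\<E>. \<E> \<subseteq> dyadic \<Longrightarrow> \<E> \<noteq> {} \<Longrightarrow>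
           ennreal (1 / A) * carleson \<E> \<le> carleson (\<tau> ` \<E>) \<and>
           carleson (\<tau> ` \<E>) \<le> ennreal A * carleson \<E>"
    and "1 < q" and "q < p"
  shows "(UMD_space TYPE('a) \<longrightarrow>
            rearrangement_bounded TYPE('a) p \<tau> \<longrightarrow> rearrangement_bounded TYPE('a) q \<tau>) \<and>
         ((\<forall>I\<in>dyadic. measure lborel (\<tau> I) = measure lborel I) \<longrightarrow>
            rearrangement_bounded TYPE('a) p \<tau> \<longrightarrow> rearrangement_bounded TYPE('a) q \<tau>)"
proof -
  interpret carleson_bijection \<tau> A
    using assms(2-4) by (rule carleson_bijectionI)
  have pq: "0 < p" "0 < q"
    using assms(5,6) by auto
  have conclude: "rearrangement_bounded TYPE('a) q \<tau>" if "0 \<le> D" "grid_bounded TYPE('a) q \<tau> D" for D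
    using pq(2) dyadic that by (rule grid_bounded_imp_rearrangement_bounded)
  show ?thesis
  proof (intro conjI impI)
    assume umd: "UMD_space TYPE('a)" and bdd: "rearrangement_bounded TYPE('a) p \<tau>"
    obtain B where B: "0 \<le> B" "grid_bounded TYPE('a) p \<tau> B"
      using rearrangement_bounded_imp_grid_bounded[OF pq(1) bdd] by blast
    show "rearrangement_bounded TYPE('a) q \<tau>"
      using grid_bounded_extrapolation_UMD[OF umd assms(5,6) B] conclude by blast
  next
    assume iso: "\<forall>I\<in>dyadic. measure lborel (\<tau> I) = measure lborel I" and bdd: "rearrangement_bounded TYPE('a) p \<tau>"
    obtain B where B: "0 \<le> B" "grid_bounded TYPE('a) p \<tau> B"
      using rearrangement_bounded_imp_grid_bounded[OF pq(1) bdd] by blast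
    show "rearrangement_bounded TYPE('a) q \<tau>"
      using grid_bounded_extrapolation_isometric[OF assms(5,6) B] iso conclude by blast
  qed
qed

end
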